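(* Let $G$ be a non-empty finite simple graph and let $k=\lambda(G)$. Then $\chi(G)\leq \lambda(G)+1$, and equality $\chi(G)=\lambda(G)+1$ holds if and only if $G$ has a block belonging to the class $\mathcal{H}_{\lambda(G)}$.
   Context: Graphs are finite, undirected, without loops or multiple edges; $\chi(G)$ is the chromatic number. For distinct vertices $v,w$ of $G$, the local edge connectivity $\lambda_G(v,w)$ is the maximum number of pairwise edge-disjoint $v$-$w$ paths in $G$. The maximum local edge connectivity is $\lambda(G)=\max\{\lambda_G(v,w): v,w\in V(G), v\neq w\}$ if $G$ has at least two vertices, and $\lambda(G)=0$ if $G$ has exactly one vertex. A block is a maximal connected subgraph without a separating (cut) vertex. Hajós join: let $G_1,G_2$ be vertex-disjoint graphs and $e_i=v_iw_i\in E(G_i)$ for $i=1,2$. The Hajós join $G_1\triangle G_2$ is obtained from $G_1$ and $G_2$ by deleting $e_1$ and $e_2$, identifying $v_1$ with $v_2$, and adding the new edge $w_1w_2$. For an integer $k\geq 0$: if $k\in\{0,1\}$, $\mathcal{H}_k$ is the class of complete graphs of order $k+1$; $\mathcal{H}_2$ is the class of odd cycles; $\mathcal{H}_3$ is the smallest class of graphs containing all odd wheels (an odd cycle together with a new vertex joined to all vertices of the cycle) and closed under taking Hajós joins; for $k\geq 4$, $\mathcal{H}_k$ is the smallest class of graphs containing all complete graphs of order $k+1$ and closed under taking Hajós joins. *)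

theory Defs
  imports "Graph_Theory.Graph_Theory" "HOL-Library.Disjoint_Sets"
begin

text \<open>
  Graphs are represented as in the library: a finite simple undirected graph is a
  symmetric, loop-free digraph \<open>G\<close> with \<open>pair_graph G\<close>, where each
  edge \<open>{u, v}\<close> is the pair of arcs \<open>(u, v)\<close> and \<open>(v, u)\<close>.
\<close>

definition proper_coloring :: "'a pair_pre_digraph \<Rightarrow> nat \<Rightarrow> ('a \<Rightarrow> nat) \<Rightarrow> bool" where
  "proper_coloring G k c \<longleftrightarrow>
     c ` pverts G \<subseteq> {..<k} \<and> (\<forall>(u, v) \<in> parcs G. c u \<noteq> c v)"

definition chromatic_number :: "'a pair_pre_digraph \<Rightarrow> nat" where
  "chromatic_number G = (LEAST k. \<exists>c. proper_coloring G k c)"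

text \<open>
  Edge-disjointness of paths refers to undirected edges, so the orientation in which a
  path traverses an edge has to be forgotten.
\<close>

definition path_edges :: "('a \<times> 'a) awalk \<Rightarrow> 'a set set" where
  "path_edges p = (\<lambda>(x, y). {x, y}) ` set p"

definition local_edge_connectivity :: "'a pair_pre_digraph \<Rightarrow> 'a \<Rightarrow> 'a \<Rightarrow> nat" where
  "local_edge_connectivity G v w =
     Max {card P | P. P \<subseteq> {p. pre_digraph.apath (with_proj G) v p w} \<and>
                      disjoint_family_on path_edges P}"

definition max_local_edge_connectivity :: "'a pair_pre_digraph \<Rightarrow> nat" where
  "max_local_edge_connectivity G =
     (if card (pverts G) = 1 then 0
      else Max {local_edge_connectivity G v w | v w.
                  v \<in> pverts G \<and> w \<in> pverts G \<and> v \<noteq> w})"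

text \<open>
  A separating vertex separates two other vertices of the same component.  The library's
  \<open>connected\<close> is false for the graph without vertices, so that blocks below are
  non-empty; a single vertex is a block exactly if it is isolated.
\<close>

definition separating_vertex :: "('a, 'b) pre_digraph \<Rightarrow> 'a \<Rightarrow> bool" where
  "separating_vertex G v \<longleftrightarrow>
     v \<in> verts G \<and>
     (\<exists>x \<in> verts G - {v}. \<exists>y \<in> verts G - {v}.
        x \<rightarrow>\<^sup>*\<^bsub>G\<^esub> y \<and> \<not> x \<rightarrow>\<^sup>*\<^bsub>pre_digraph.del_vert G v\<^esub> y)"

definition is_block :: "'a pair_pre_digraph \<Rightarrow> 'a pair_pre_digraph \<Rightarrow> bool" where
  "is_block G B \<longleftrightarrow>
     pre_digraph.max_subgraph (with_proj G)
       (\<lambda>H. graph H \<and> connected H \<and> (\<forall>v. \<not> separating_vertex H v)) (with_proj B)"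

definition cycle_graph :: "nat \<Rightarrow> nat pair_pre_digraph" where
  "cycle_graph n =
     \<lparr>pverts = {..<n},
      parcs = {(i, j). i < n \<and> j < n \<and> (j = Suc i mod n \<or> i = Suc j mod n)}\<rparr>"

definition wheel_graph :: "nat \<Rightarrow> nat pair_pre_digraph" where
  "wheel_graph n =
     \<lparr>pverts = insert n (pverts (cycle_graph n)),
      parcs = parcs (cycle_graph n) \<union> {..<n} \<times> {n} \<union> {n} \<times> {..<n}\<rparr>"

text \<open>
  The Hajos join with respect to the edges \<open>v1 w1\<close> of \<open>G1\<close> and
  \<open>v2 w2\<close> of \<open>G2\<close>; the vertex arising from the identification is called
  \<open>v1\<close>.
\<close>

definition hajos_join ::
    "'a pair_pre_digraph \<Rightarrow> 'a \<Rightarrow> 'a \<Rightarrow> 'a pair_pre_digraph \<Rightarrow> 'a \<Rightarrow> 'a \<Rightarrow> 'a pair_pre_digraph"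
where
  "hajos_join G1 v1 w1 G2 v2 w2 =
     (let f = (\<lambda>x. if x = v2 then v1 else x) in
      \<lparr>pverts = pverts G1 \<union> f ` pverts G2,
       parcs = (parcs G1 - {(v1, w1), (w1, v1)}) \<union>
               map_prod f f ` (parcs G2 - {(v2, w2), (w2, v2)}) \<union>
               {(w1, w2), (w2, w1)}\<rparr>)"

text \<open>
  Classes of graphs are closed under isomorphism.  They are built over the infinite vertex
  type \<open>nat\<close>, so that disjoint copies always exist, and are transferred to other
  vertex types by isomorphism.
\<close>

inductive hajos_closure :: "(nat pair_pre_digraph \<Rightarrow> bool) \<Rightarrow> nat pair_pre_digraph \<Rightarrow> bool"
  for P where
  base: "P G \<Longrightarrow> hajos_closure P G"
| iso: "hajos_closure P G \<Longrightarrow> digraph_iso (with_proj G) (with_proj H) \<Longrightarrow> hajos_closure P H"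
| join: "hajos_closure P G1 \<Longrightarrow> hajos_closure P G2 \<Longrightarrow> pverts G1 \<inter> pverts G2 = {} \<Longrightarrow>
         (v1, w1) \<in> parcs G1 \<Longrightarrow> (v2, w2) \<in> parcs G2 \<Longrightarrow>
         hajos_closure P (hajos_join G1 v1 w1 G2 v2 w2)"

definition hajos_class_nat :: "nat \<Rightarrow> nat pair_pre_digraph \<Rightarrow> bool" where
  "hajos_class_nat k G \<longleftrightarrow>
     (if k \<le> 1 then complete_digraph (k + 1) (with_proj G)
      else if k = 2 then
        \<exists>n \<ge> 3. odd n \<and> digraph_iso (with_proj (cycle_graph n)) (with_proj G)
      else if k = 3 then hajos_closure (\<lambda>H. \<exists>n \<ge> 3. odd n \<and> H = wheel_graph n) G
      else hajos_closure (\<lambda>H. complete_digraph (k + 1) (with_proj H)) G)"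

definition hajos_class :: "nat \<Rightarrow> 'a pair_pre_digraph \<Rightarrow> bool" where
  "hajos_class k G \<longleftrightarrow>
     (\<exists>H. hajos_class_nat k H \<and> digraph_iso (with_proj H) (with_proj G))"

end

theory Submission
  imports Defs "HOL-Combinatorics.Permutations"
begin

text \<open>
  Put \<open>k = \<lambda>(G)\<close>. By Menger's theorem any two vertices of \<open>G\<close> are separated by at most \<open>k\<close>
  edges, and this passes to subgraphs. On the other hand a graph that is critical for not being
  \<open>k\<close>-colourable is \<open>k\<close>-edge-connected (Dirac), because fewer than \<open>k\<close> edges cannot block all
  \<open>k\<close> cyclic shifts of the colours on one side of a cut. This gives \<open>\<chi>(G) \<le> k + 1\<close>, and if
  equality holds, a critical subgraph \<open>H\<close> is a block, since an ear of \<open>H\<close> would produce two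
  vertices that \<open>k\<close> edges do not separate.

  It remains to see that \<open>H\<close> lies in the class \<open>\<H>\<^sub>k\<close>. For \<open>k \<ge> 3\<close>, if \<open>V(H) = P \<union> Q\<close> with
  \<open>P \<inter> Q = {v}\<close> and a single edge joins \<open>P - v\<close> to \<open>Q - v\<close>, then \<open>H\<close> is a Hajos join of two
  smaller graphs of the same kind. Otherwise \<open>H\<close> has a hub and is an odd wheel (\<open>k = 3\<close>) or a
  complete graph. If at most one vertex has
  degree larger than \<open>k\<close>, a greedy colouring argument in the style of Brooks' theorem shows this. If
  there are two such vertices, they are separated by exactly \<open>k\<close> edges; in every colouring the
  ends of these edges have one colour on one side and pairwise distinct colours on the other side.
  Replacing the latter side by a complete graph on these ends yields a smaller irreducible graph of
  the same kind, whose hub contradicts the choice of the two vertices.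
\<close>

section \<open>Colourings and critical graphs\<close>


text \<open>The hypothesis \<open>\<lambda>(G) \<le> k\<close> is carried as
  \<open>cut_bounded\<close>, because together with criticality this form survives undoing a Hajos
  join and the clique replacement; the pair is the invariant of the inductions on the number of
  vertices. Criticality bounds cuts from below, so the cuts that \<open>cut_bounded\<close> supplies
  have exactly \<open>k\<close> edges. Such a tight cut blocks every permutation of the colours on
  one side, not just the cyclic shifts, and this rigidity makes one side monochromatic at the cut
  and the other one rainbow.

  The obstacle is two vertices of degree above \<open>k\<close>: the greedy argument tolerates one,
  as a member of the precoloured pair, but not two.

  The bound \<open>k \<ge> 3\<close> supplies the third colour needed to undo a Hajos join. The
  values \<open>k = 1\<close> and \<open>k = 2\<close> give a single edge and an odd cycle directly,
  and for \<open>k = 0\<close> there is no critical graph. The converse direction rests on the fact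
  that Hajos joins preserve non-\<open>k\<close>-colourability.\<close>

definition ugraph :: "'a set \<Rightarrow> 'a rel \<Rightarrow> bool" where
  "ugraph V E \<longleftrightarrow> finite V \<and> E \<subseteq> V \<times> V \<and> sym E \<and> irrefl E"

definition coloring :: "nat \<Rightarrow> 'a rel \<Rightarrow> 'a set \<Rightarrow> ('a \<Rightarrow> nat) \<Rightarrow> bool" where
  "coloring k E A c \<longleftrightarrow> (\<forall>u\<in>A. c u < k) \<and> (\<forall>u\<in>A. \<forall>v\<in>A. (u, v) \<in> E \<longrightarrow> c u \<noteq> c v)"

text \<open>Criticality refers to edges. Together with the absence of isolated vertices it makes
  every proper vertex subset colourable, and \<open>E\<close> determines \<open>V\<close>.\<close>

definition critical :: "nat \<Rightarrow> 'a set \<Rightarrow> 'a rel \<Rightarrow> bool" where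
  "critical k V E \<longleftrightarrow> ugraph V E \<and> (\<forall>v\<in>V. \<exists>u. (v, u) \<in> E) \<and> (\<nexists>c. coloring k E V c) \<and>
     (\<forall>x y. (x, y) \<in> E \<longrightarrow> (\<exists>c. coloring k (E - {(x, y), (y, x)}) V c))"

text \<open>For symmetric \<open>E\<close> each edge with exactly one end in \<open>A\<close> is
  counted once, through its arc that leaves \<open>A\<close>. The complement is taken in the whole
  type, so \<open>A\<close> may contain points outside the graph.\<close>

definition edge_cut :: "'a rel \<Rightarrow> 'a set \<Rightarrow> 'a rel" where
  "edge_cut E A = E \<inter> A \<times> - A"

text \<open>The cut form of \<open>\<lambda> \<le> k\<close>; the structural argument can then
  uncross cuts instead of rerouting paths.\<close>

definition cut_bounded :: "nat \<Rightarrow> 'a set \<Rightarrow> 'a rel \<Rightarrow> bool" where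
  "cut_bounded k V E \<longleftrightarrow>
     (\<forall>x\<in>V. \<forall>y\<in>V. x \<noteq> y \<longrightarrow> (\<exists>A. x \<in> A \<and> y \<notin> A \<and> card (edge_cut E A) \<le> k))"

lemma ugraphD:
  assumes "ugraph V E"
  shows "finite V" "E \<subseteq> V \<times> V" "sym E" "irrefl E" "finite E"
  using assms by (auto simp: ugraph_def intro: finite_subset)

lemma coloring_mono:
  "coloring k E A c \<Longrightarrow> B \<subseteq> A \<Longrightarrow> E' \<inter> B \<times> B \<subseteq> E \<Longrightarrow> coloring k E' B c"
  unfolding coloring_def by blast

lemma coloring_permutes:
  assumes "coloring k E A c" "\<sigma> permutes {..<k}"
  shows "coloring k E A (\<sigma> \<circ> c)"
  using assms permutes_in_image[OF assms(2)] permutes_inj[OF assms(2)]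
  unfolding coloring_def by (auto dest: injD)

text \<open>Transpose \<open>a\<close> with \<open>a'\<close>, then the image of \<open>b\<close>
  with \<open>b'\<close>. The last hypothesis keeps the second transposition away from
  \<open>a'\<close> or makes it trivial.\<close>

lemma permutes_two_points:
  fixes a b :: nat
  assumes "a < k" "b < k" "a' < k" "b' < k" "a = b \<longleftrightarrow> a' = b'"
  obtains \<sigma> where "\<sigma> permutes {..<k}" "\<sigma> a = a'" "\<sigma> b = b'"
proof -
  define \<tau> where "\<tau> = transpose a a'"
  define \<sigma> where "\<sigma> = transpose (\<tau> b) b' \<circ> \<tau>"
  have "\<tau> permutes {..<k}" unfolding \<tau>_def using assms by (intro permutes_swap_id) auto
  moreover have "\<tau> b < k" unfolding \<tau>_def transpose_def using assms by auto
  ultimately have "\<sigma> permutes {..<k}" unfolding \<sigma>_def using assms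
    by (intro permutes_compose permutes_swap_id) auto
  moreover have "\<sigma> a = a'" "\<sigma> b = b'"
    unfolding \<sigma>_def \<tau>_def using assms by (auto simp: transpose_def)
  ultimately show thesis using that by blast
qed

lemma coloring_glue:
  assumes "coloring k E P f" "coloring k E Q g" "sym E"
    and "\<And>x. x \<in> P \<Longrightarrow> x \<in> Q \<Longrightarrow> f x = g x"
    and "\<And>x y. x \<in> P - Q \<Longrightarrow> y \<in> Q - P \<Longrightarrow> (x, y) \<in> E \<Longrightarrow> f x \<noteq> g y"
  shows "coloring k E (P \<union> Q) (\<lambda>x. if x \<in> P then f x else g x)"
  unfolding coloring_def
proof (intro conjI ballI impI)
  fix u assume "u \<in> P \<union> Q"
  then show "(if u \<in> P then f u else g u) < k" using assms(1,2) by (auto simp: coloring_def)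
next
  fix u v assume uv: "u \<in> P \<union> Q" "v \<in> P \<union> Q" "(u, v) \<in> E"
  have vu: "(v, u) \<in> E" using uv assms(3) by (meson symD)
  have fP: "\<And>x y. x \<in> P \<Longrightarrow> y \<in> P \<Longrightarrow> (x, y) \<in> E \<Longrightarrow> f x \<noteq> f y"
    and gQ: "\<And>x y. x \<in> Q \<Longrightarrow> y \<in> Q \<Longrightarrow> (x, y) \<in> E \<Longrightarrow> g x \<noteq> g y"
    using assms(1,2) by (auto simp: coloring_def)
  show "(if u \<in> P then f u else g u) \<noteq> (if v \<in> P then f v else g v)"
    using uv vu fP[of u v] gQ[of u v] assms(4)[of u] assms(4)[of v] assms(5)[of u v] assms(5)[of v u]
    by (smt (verit) Diff_iff Un_iff)
qed

lemma criticalD: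
  assumes "critical k V E"
  shows "ugraph V E" "\<And>v. v \<in> V \<Longrightarrow> \<exists>u. (v, u) \<in> E" "\<not> coloring k E V c"
    "(x, y) \<in> E \<Longrightarrow> \<exists>c. coloring k (E - {(x, y), (y, x)}) V c"
  using assms by (auto simp: critical_def)

lemma critical_graph:
  assumes "critical k V E"
  shows "finite V" "E \<subseteq> V \<times> V" "sym E" "irrefl E" "finite E"
  using ugraphD criticalD(1) assms by blast+

text \<open>An edge at a vertex outside \<open>A\<close> can be deleted without affecting
  \<open>A\<close>.\<close>

lemma critical_subset_colorable:
  assumes "critical k V E" "A \<subset> V"
  obtains c where "coloring k E A c"
proof -
  obtain v where v: "v \<in> V" "v \<notin> A" using assms by auto
  then obtain u where "(v, u) \<in> E" using criticalD(2) assms by metis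
  then obtain c where "coloring k (E - {(v, u), (u, v)}) V c" using criticalD(4) assms by metis
  then have "coloring k E A c" by (rule coloring_mono) (use assms v in auto)
  then show thesis using that by blast
qed

lemma critical_pos: assumes "critical k V E" shows "V \<noteq> {}" "0 < k"
proof -
  show *: "V \<noteq> {}" using criticalD(3)[OF assms] by (auto simp: coloring_def)
  then obtain v u where "v \<in> V" "(v, u) \<in> E" using criticalD(2)[OF assms] by blast
  then obtain c where "coloring k (E - {(v, u), (u, v)}) V c" using criticalD(4) assms by metis
  then show "0 < k" using \<open>v \<in> V\<close> by (auto simp: coloring_def)
qed

lemma mod_shift_cancel:
  fixes b s t :: nat
  assumes "s < k" "t < k" "(b + s) mod k = (b + t) mod k"
  shows "s = t"
proof -
  obtain p q where "(b + s) + k * p = (b + t) + k * q" using assms(3) unfolding nat_mod_eq_iff by blast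
  then have "s mod k = t mod k" unfolding nat_mod_eq_iff by auto
  then show ?thesis using assms by simp
qed

text \<open>
  The \<open>k\<close> cyclic shifts of \<open>g\<close> are blocked by pairwise different edges of the cut.
\<close>

lemma blocking_edges:
  assumes "critical k V E" "A \<subseteq> V" "coloring k E A f" "coloring k E (V - A) g"
  obtains e where "\<And>s. s < k \<Longrightarrow> e s \<in> edge_cut E A"
    "\<And>s. s < k \<Longrightarrow> f (fst (e s)) = (g (snd (e s)) + s) mod k" "inj_on e {..<k}"
proof -
  have k: "k > 0" using critical_pos assms by blast
  have "\<exists>p. p \<in> edge_cut E A \<and> f (fst p) = (g (snd p) + s) mod k" if "s < k" for s
  proof (rule ccontr)
    assume *: "\<not> ?thesis"
    have "coloring k E (V - A) (\<lambda>y. (g y + s) mod k)"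
      unfolding coloring_def
    proof (intro conjI ballI impI)
      fix u v assume uv: "u \<in> V - A" "v \<in> V - A" "(u, v) \<in> E"
      then have "g u < k" "g v < k" "g u \<noteq> g v" using assms(4) by (auto simp: coloring_def)
      then show "(g u + s) mod k \<noteq> (g v + s) mod k"
        using mod_shift_cancel[of "g u" k "g v" s] by (auto simp: add.commute)
    qed (use k in auto)
    from coloring_glue[OF assms(3) this critical_graph(3)[OF assms(1)]] *
    have "coloring k E (A \<union> (V - A)) (\<lambda>x. if x \<in> A then f x else (g x + s) mod k)"
      by (force simp: edge_cut_def)
    then show False using criticalD(3)[OF assms(1)] assms(2) by (simp add: Un_absorb1)
  qed
  then obtain e where e: "\<And>s. s < k \<Longrightarrow> e s \<in> edge_cut E A \<and> f (fst (e s)) = (g (snd (e s)) + s) mod k"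
    by metis
  moreover have "inj_on e {..<k}"
    using e mod_shift_cancel by (intro inj_onI) (metis lessThan_iff)
  ultimately show thesis using that by blast
qed

lemma finite_edge_cut: "finite E \<Longrightarrow> finite (edge_cut E A)"
  by (simp add: edge_cut_def)

theorem critical_cut_ge:
  assumes "critical k V E" "A \<subseteq> V" "A \<noteq> {}" "A \<noteq> V"
  shows "k \<le> card (edge_cut E A)"
proof -
  obtain f where f: "coloring k E A f" using critical_subset_colorable[OF assms(1), of A] assms by blast
  obtain g where g: "coloring k E (V - A) g"
    using critical_subset_colorable[OF assms(1), of "V - A"] assms by blast
  obtain e where e: "\<And>s. s < k \<Longrightarrow> e s \<in> edge_cut E A" "inj_on e {..<k}"
    using blocking_edges[OF assms(1,2) f g] by metis
  have "card (e ` {..<k}) \<le> card (edge_cut E A)"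
    using e(1) critical_graph[OF assms(1)] by (intro card_mono finite_edge_cut) auto
  then show ?thesis using card_image[OF e(2)] by simp
qed

lemma cut_singleton: "irrefl E \<Longrightarrow> edge_cut E {v} = {v} \<times> E `` {v}"
  by (auto simp: edge_cut_def irrefl_def)

lemma card_cut_singleton: "irrefl E \<Longrightarrow> card (edge_cut E {v}) = card (E `` {v})"
  by (simp add: cut_singleton card_cartesian_product)

lemma critical_degree_ge:
  assumes "critical k V E" "v \<in> V"
  shows "k \<le> card (E `` {v})"
proof -
  obtain u where "(v, u) \<in> E" using criticalD(2) assms by metis
  then have "V \<noteq> {v}" using critical_graph[OF assms(1)] by (auto simp: irrefl_def)
  then show ?thesis using critical_cut_ge[OF assms(1), of "{v}"] assms
    card_cut_singleton[OF critical_graph(4)[OF assms(1)]] by auto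
qed

lemma cut_Compl: "sym E \<Longrightarrow> edge_cut E (- A) = (edge_cut E A)\<inverse>"
  by (auto simp: edge_cut_def dest: symD)

lemma card_cut_Compl: "sym E \<Longrightarrow> card (edge_cut E (- A)) = card (edge_cut E A)"
  by (simp add: cut_Compl)

lemma cut_Int_verts: "E \<subseteq> V \<times> V \<Longrightarrow> edge_cut E (A \<inter> V) = edge_cut E A"
  by (auto simp: edge_cut_def)

lemma critical_separating_cut_ge:
  assumes "critical k V E" "x \<in> V" "y \<in> V" "x \<in> A" "y \<notin> A"
  shows "k \<le> card (edge_cut E A)"
  using critical_cut_ge[OF assms(1), of "A \<inter> V"] cut_Int_verts[OF critical_graph(2)[OF assms(1)], of A] assms
  by auto

section \<open>Tight cuts\<close>


text \<open>Different cut edges block different shifts of \<open>g\<close>, also after any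
  permutation of its colours. If \<open>f\<close> and \<open>g\<close> both agreed on the two edges,
  these would block the same shift; if both differed, a permutation could make both edges block the
  shift by zero.\<close>

lemma tight_cut_pair:
  assumes "critical k V E" "A \<subseteq> V" "card (edge_cut E A) = k"
    and "coloring k E A f" "coloring k E (V - A) g"
    and "p \<in> edge_cut E A" "q \<in> edge_cut E A" "p \<noteq> q"
  shows "f (fst p) = f (fst q) \<longleftrightarrow> g (snd p) \<noteq> g (snd q)"
proof -
  have p: "fst p \<in> A" "snd p \<in> V - A" "fst q \<in> A" "snd q \<in> V - A"
    using assms(6,7) critical_graph(2)[OF assms(1)] by (auto simp: edge_cut_def)
  have lt: "f (fst p) < k" "f (fst q) < k" "g (snd p) < k" "g (snd q) < k"
    using assms(4,5) p by (auto simp: coloring_def)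
  have shifts: "\<exists>s t. s < k \<and> t < k \<and> s \<noteq> t \<and> f (fst p) = (\<sigma> (g (snd p)) + s) mod k
      \<and> f (fst q) = (\<sigma> (g (snd q)) + t) mod k" if \<sigma>: "\<sigma> permutes {..<k}" for \<sigma>
  proof -
    obtain e where e: "\<And>s. s < k \<Longrightarrow> e s \<in> edge_cut E A"
      "\<And>s. s < k \<Longrightarrow> f (fst (e s)) = ((\<sigma> \<circ> g) (snd (e s)) + s) mod k" "inj_on e {..<k}"
      using blocking_edges[OF assms(1,2,4) coloring_permutes[OF assms(5) \<sigma>]] by metis
    \<comment> \<open>The cut has just \<open>k\<close> edges, so the injective choice of blocking
      edges exhausts it, and \<open>p\<close> and \<open>q\<close> are both chosen.\<close>
    have "e ` {..<k} = edge_cut E A"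
      using e(1) card_image[OF e(3)] assms(3) critical_graph(5)[OF assms(1)]
      by (intro card_subset_eq finite_edge_cut) auto
    then obtain s t where "s < k" "t < k" "e s = p" "e t = q" using assms(6,7) by (metis imageE lessThan_iff)
    then show ?thesis using e(2)[of s] e(2)[of t] assms(8) by (metis comp_apply)
  qed
  show ?thesis
  proof (rule ccontr)
    assume *: "\<not> ?thesis"
    show False
    proof (cases "f (fst p) = f (fst q)")
      case True
      with * have eq: "g (snd p) = g (snd q)" by simp
      obtain s t where st: "s < k" "t < k" "s \<noteq> t" "f (fst p) = (g (snd p) + s) mod k"
        "f (fst q) = (g (snd q) + t) mod k" using shifts[OF permutes_id] by auto
      then show False using True eq mod_shift_cancel[of s k t "g (snd q)"] by metis
    next
      case False
      with * have "g (snd p) = g (snd q) \<longleftrightarrow> f (fst p) = f (fst q)" by auto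
      \<comment> \<open>Aligning \<open>g\<close> with \<open>f\<close> at both edges makes zero the
        only shift that either edge can block.\<close>
      then obtain \<sigma> where \<sigma>: "\<sigma> permutes {..<k}" "\<sigma> (g (snd p)) = f (fst p)" "\<sigma> (g (snd q)) = f (fst q)"
        using permutes_two_points[OF lt(3,4,1,2)] by metis
      obtain s t where st: "s < k" "t < k" "s \<noteq> t" "f (fst p) = (f (fst p) + s) mod k"
        "f (fst q) = (f (fst q) + t) mod k" using shifts[OF \<sigma>(1)] \<sigma>(2,3) by auto
      have "s = 0" using mod_shift_cancel[of s k 0 "f (fst p)"] st lt by auto
      moreover have "t = 0" using mod_shift_cancel[of t k 0 "f (fst q)"] st lt by auto
      ultimately show False using st by simp
    qed
  qed
qed

text \<open>For a fixed pair of colourings one side is constant on the cut and the other one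
  injective. Comparison with one pair \<open>f0\<close>, \<open>g0\<close> shows that the roles of
  the sides do not depend on the colourings. Stating the outcome for \<open>X\<close> gives both
  cases the same orientation.\<close>

theorem tight_cut_sides:
  assumes "critical k V E" "A \<subseteq> V" "card (edge_cut E A) = k" "2 \<le> k"
  obtains X where "X = A \<or> X = V - A"
    "\<And>f p q. coloring k E X f \<Longrightarrow> p \<in> edge_cut E X \<Longrightarrow> q \<in> edge_cut E X \<Longrightarrow> f (fst p) = f (fst q)"
    "\<And>g. coloring k E (V - X) g \<Longrightarrow> inj_on (g \<circ> snd) (edge_cut E X)"
proof -
  define M where "M = edge_cut E A"
  have fin: "finite M" "card M = k" using assms(3) finite_edge_cut[OF critical_graph(5)[OF assms(1)]] by (auto simp: M_def)
  have "M \<noteq> {}" using fin assms(4) by auto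
  then have ne: "A \<noteq> {}" "A \<noteq> V" using critical_graph(2)[OF assms(1)] by (auto simp: M_def edge_cut_def)
  obtain f0 where f0: "coloring k E A f0" using critical_subset_colorable[OF assms(1), of A] assms ne by blast
  obtain g0 where g0: "coloring k E (V - A) g0"
    using critical_subset_colorable[OF assms(1), of "V - A"] assms ne by blast
  have xor: "f (fst p) = f (fst q) \<longleftrightarrow> g (snd p) \<noteq> g (snd q)"
    if "coloring k E A f" "coloring k E (V - A) g" "p \<in> M" "q \<in> M" "p \<noteq> q" for f g p q
    using tight_cut_pair[OF assms(1,2,3)] that by (auto simp: M_def)
  \<comment> \<open>Equality of \<open>f\<close>-colours and equality of \<open>g\<close>-colours
    are equivalence relations on \<open>M\<close> that together relate any two edges, so one of them
    is total.\<close>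
  have const: "(\<forall>p\<in>M. \<forall>q\<in>M. f (fst p) = f (fst q)) \<or> (\<forall>p\<in>M. \<forall>q\<in>M. g (snd p) = g (snd q))"
    if "coloring k E A f" "coloring k E (V - A) g" for f g
    using xor[OF that] by metis
  obtain p0 q0 where pq: "p0 \<in> M" "q0 \<in> M" "p0 \<noteq> q0"
  proof -
    have "\<not> card M \<le> Suc 0" using fin assms(4) by simp
    then show thesis using that card_le_Suc0_iff_eq[OF fin(1)] by blast
  qed
  show thesis
  proof (cases "\<forall>p\<in>M. \<forall>q\<in>M. f0 (fst p) = f0 (fst q)")
    case True
    have "f (fst p) = f (fst q)" if "coloring k E A f" "p \<in> M" "q \<in> M" for f p q
      using const[OF that(1) g0] xor[OF f0 g0 pq] True that pq by blast
    moreover have "inj_on (g \<circ> snd) M" if "coloring k E (V - A) g" for g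
      using xor[OF f0 that] True by (intro inj_onI) fastforce
    ultimately show thesis using that[of A] by (auto simp: M_def)
  next
    case False
    have inv: "edge_cut E (V - A) = M\<inverse>"
      using critical_graph(2,3)[OF assms(1)] by (auto simp: M_def edge_cut_def dest: symD)
    have VA: "V - (V - A) = A" using assms(2) by auto
    have "g (snd p) = g (snd q)" if "coloring k E (V - A) g" "p \<in> M" "q \<in> M" for g p q
      using const[OF f0 that(1)] False that by blast
    moreover have "inj_on (f \<circ> fst) M" if "coloring k E A f" for f
      using xor[OF that g0] const[OF f0 g0] False by (intro inj_onI) (metis comp_apply)
    ultimately show thesis using that[of "V - A"] unfolding inv VA
      by (force simp: inj_on_def)
  qed
qed

section \<open>Connectedness, greedy colouring and separating pairs\<close>

definition connected_on :: "'a rel \<Rightarrow> 'a set \<Rightarrow> bool" where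
  "connected_on E W \<longleftrightarrow> (\<forall>A. A \<subseteq> W \<longrightarrow> A \<noteq> {} \<longrightarrow> A \<noteq> W \<longrightarrow> E \<inter> A \<times> (W - A) \<noteq> {})"

lemma connected_onD:
  assumes "connected_on E W" "A \<subseteq> W" "x \<in> A" "y \<in> W - A"
  obtains u v where "u \<in> A" "v \<in> W - A" "(u, v) \<in> E"
  using assms unfolding connected_on_def by blast

text \<open>Read backwards, the order of insertion is a greedy colouring order: every vertex but the
  root \<open>r\<close> still has an uncoloured neighbour when its turn comes.\<close>

inductive grows_from :: "'a rel \<Rightarrow> 'a \<Rightarrow> 'a set \<Rightarrow> bool" for E r where
  root: "grows_from E r {r}"
| insert: "grows_from E r U \<Longrightarrow> u \<notin> U \<Longrightarrow> w \<in> U \<Longrightarrow> (u, w) \<in> E \<Longrightarrow> grows_from E r (insert u U)"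

lemma connected_on_grows_from:
  assumes "connected_on E W" "finite W" "r \<in> W" "sym E"
  shows "grows_from E r W"
proof -
  define \<U> where "\<U> = {U. U \<subseteq> W \<and> grows_from E r U}"
  have "finite \<U>" "{r} \<in> \<U>" using assms by (auto simp: \<U>_def intro: root)
  then obtain U where U: "U \<in> \<U>" "\<And>U'. U' \<in> \<U> \<Longrightarrow> U \<subseteq> U' \<Longrightarrow> U = U'"
    using finite_has_maximal[of \<U>] by blast
  have rU: "r \<in> U" if "grows_from E r U" for U using that by induction auto
  have "U = W"
  proof (rule ccontr)
    assume "U \<noteq> W"
    with U(1) rU obtain y where "y \<in> W - U" "U \<subseteq> W" "r \<in> U" by (auto simp: \<U>_def)
    then obtain w u where "w \<in> U" "u \<in> W - U" "(w, u) \<in> E" using connected_onD[OF assms(1)] by metis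
    then have "insert u U \<in> \<U>" using U(1) assms(4) by (auto simp: \<U>_def intro!: insert dest: symD)
    with U(2)[of "insert u U"] \<open>u \<in> W - U\<close> show False by blast
  qed
  with U show ?thesis by (simp add: \<U>_def)
qed

lemma coloring_extend:
  assumes "coloring k E A c" "sym E" "irrefl E" "finite (E `` {u})" "card (c ` (E `` {u} \<inter> A)) < k"
  obtains x where "coloring k E (insert u A) (c(u := x))"
proof -
  have "card {..<k} > card (c ` (E `` {u} \<inter> A))" using assms by simp
  then obtain x where x: "x < k" "x \<notin> c ` (E `` {u} \<inter> A)"
    using assms(4) by (metis card_mono finite_Int finite_imageI lessThan_iff not_less subsetI)
  have "coloring k E (insert u A) (c(u := x))"
    unfolding coloring_def
  proof (intro conjI ballI impI)
    fix a assume "a \<in> insert u A"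
    then show "(c(u := x)) a < k" using x assms(1) by (auto simp: coloring_def)
  next
    fix a b assume ab: "a \<in> insert u A" "b \<in> insert u A" "(a, b) \<in> E"
    then have "(b, a) \<in> E" "a \<noteq> b" using assms(2,3) by (auto dest: symD simp: irrefl_def)
    then show "(c(u := x)) a \<noteq> (c(u := x)) b" using ab assms(1) x
      by (auto simp: coloring_def)
  qed
  then show thesis using that by blast
qed

text \<open>The vertices of \<open>U\<close> are coloured in the reverse order of growth. The root
  \<open>r\<close> comes last, without an uncoloured neighbour; it has a free colour because
  \<open>s\<close> and \<open>t\<close> share theirs.\<close>

lemma greedy_coloring:
  assumes "grows_from E r U" "U \<subseteq> V" "ugraph V E" "\<And>u. u \<in> U \<Longrightarrow> card (E `` {u}) \<le> k"
    and "(r, s) \<in> E" "(r, t) \<in> E" "s \<in> V - U" "t \<in> V - U" "s \<noteq> t"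
    and "coloring k E (V - U) c" "c s = c t"
  shows "\<exists>c. coloring k E V c"
  using assms(1,2,4,5-)
proof (induction arbitrary: c)
  case root
  note g = ugraphD[OF assms(3)]
  have fin: "finite (E `` {r})" using g(5) by (simp add: finite_Image)
  \<comment> \<open>Dropping \<open>t\<close> loses no colour, as \<open>s\<close> has the same
    one.\<close>
  have "c ` (E `` {r} \<inter> (V - {r})) \<subseteq> c ` (E `` {r} - {t})"
  proof (rule image_subsetI)
    fix x assume "x \<in> E `` {r} \<inter> (V - {r})"
    then show "c x \<in> c ` (E `` {r} - {t})"
      using root.prems by (cases "x = t") (auto intro: image_eqI[of _ _ s])
  qed
  then have "card (c ` (E `` {r} \<inter> (V - {r}))) \<le> card (E `` {r} - {t})"
    using fin by (meson card_image_le card_mono finite_Diff finite_imageI le_trans)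
  also have "\<dots> < card (E `` {r})" using root.prems fin by (intro card_Diff1_less) auto
  also have "\<dots> \<le> k" using root.prems by simp
  finally obtain x where "coloring k E (insert r (V - {r})) (c(r := x))"
    using coloring_extend[OF root.prems(8) g(3,4) fin] by metis
  then show ?case using root.prems by (auto simp: insert_absorb)
next
  case (insert U u w)
  note g = ugraphD[OF assms(3)]
  have fin: "finite (E `` {u})" using g(5) by (simp add: finite_Image)
  have "card (c ` (E `` {u} \<inter> (V - insert u U))) \<le> card (E `` {u} \<inter> (V - insert u U))"
    using fin by (intro card_image_le) auto
  \<comment> \<open>The vertex \<open>w\<close> lies in \<open>U\<close> and is still
    uncoloured.\<close>
  also have "\<dots> \<le> card (E `` {u} - {w})" using fin insert.hyps by (intro card_mono) auto
  also have "\<dots> < card (E `` {u})" using insert.hyps fin by (intro card_Diff1_less) auto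
  also have "\<dots> \<le> k" using insert.prems by simp
  finally obtain x where "coloring k E (insert u (V - insert u U)) (c(u := x))"
    using coloring_extend[OF insert.prems(8) g(3,4) fin] by metis
  moreover have "insert u (V - insert u U) = V - U" using insert by auto
  ultimately have "coloring k E (V - U) (c(u := x))" by simp
  moreover have "(c(u := x)) s = (c(u := x)) t" using insert.prems by auto
  ultimately show ?case using insert.prems by (intro insert.IH[of "c(u := x)"]) (auto simp del: fun_upd_apply)
qed

text \<open>The greedy step of Brooks' theorem, with \<open>s\<close> and \<open>t\<close>
  precoloured by 0. The degrees of \<open>s\<close> and \<open>t\<close> are unrestricted, which
  leaves room for one vertex of large degree.\<close>

lemma critical_greedy:
  assumes "critical k V E" "s \<in> V" "t \<in> V" "s \<noteq> t" "(s, t) \<notin> E"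
    and "r \<in> V - {s, t}" "(r, s) \<in> E" "(r, t) \<in> E" "\<And>u. u \<in> V - {s, t} \<Longrightarrow> card (E `` {u}) \<le> k"
  shows "\<not> connected_on E (V - {s, t})"
proof
  assume "connected_on E (V - {s, t})"
  note g = critical_graph[OF assms(1)]
  have "grows_from E r (V - {s, t})"
    using connected_on_grows_from[OF \<open>connected_on E (V - {s, t})\<close>] g assms by auto
  moreover have "V - (V - {s, t}) = {s, t}" using assms by auto
  moreover have "coloring k E {s, t} (\<lambda>_. 0)"
    using critical_pos[OF assms(1)] assms(5) g(3,4) by (auto simp: coloring_def irrefl_def dest: symD)
  ultimately have "\<exists>c. coloring k E V c"
    using assms criticalD(1)[OF assms(1)]
    by (intro greedy_coloring[of E r "V - {s, t}" V k s t "\<lambda>_. 0"]) auto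
  then show False using criticalD(3)[OF assms(1)] by blast
qed

lemma critical_connected_on:
  assumes "critical k V E"
  shows "connected_on E V"
  unfolding connected_on_def
proof (intro allI impI notI)
  fix A assume A: "A \<subseteq> V" "A \<noteq> {}" "A \<noteq> V" "E \<inter> A \<times> (V - A) = {}"
  then have "edge_cut E A = {}" using critical_graph(2)[OF assms] by (auto simp: edge_cut_def)
  then show False using critical_cut_ge[OF assms A(1,2,3)] critical_pos[OF assms] by simp
qed

text \<open>If both colourings treat the pair alike, a permutation of colours aligns them. The case
  \<open>a = b\<close> is included and serves for cut vertices.\<close>

lemma coloring_permuted_glue:
  assumes "coloring k E P f" "coloring k E Q g" "sym E" "P \<inter> Q = {a, b}"
    and "f a = f b \<longleftrightarrow> g a = g b"
    and "E \<inter> (P - {a, b}) \<times> (Q - {a, b}) = {}"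
  shows "\<exists>c. coloring k E (P \<union> Q) c"
proof -
  have "f a < k" "f b < k" "g a < k" "g b < k" using assms by (auto simp: coloring_def)
  then obtain \<sigma> where \<sigma>: "\<sigma> permutes {..<k}" "\<sigma> (g a) = f a" "\<sigma> (g b) = f b"
    using permutes_two_points assms(5) by metis
  have "coloring k E (P \<union> Q) (\<lambda>x. if x \<in> P then f x else (\<sigma> \<circ> g) x)"
  proof (rule coloring_glue[OF assms(1) coloring_permutes[OF assms(2) \<sigma>(1)] assms(3)])
    fix x assume "x \<in> P" "x \<in> Q"
    then have "x = a \<or> x = b" using assms(4) by auto
    then show "f x = (\<sigma> \<circ> g) x" using \<sigma> by auto
  next
    fix x y assume "x \<in> P - Q" "y \<in> Q - P" "(x, y) \<in> E"
    then have "(x, y) \<in> E \<inter> (P - {a, b}) \<times> (Q - {a, b})" using assms(4) by auto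
    then show "f x \<noteq> (\<sigma> \<circ> g) y" using assms(6) by blast
  qed
  then show ?thesis by blast
qed

lemma critical_no_cutvertex:
  assumes "critical k V E" "v \<in> V"
  shows "connected_on E (V - {v})"
  unfolding connected_on_def
proof (intro allI impI notI)
  fix A assume A: "A \<subseteq> V - {v}" "A \<noteq> {}" "A \<noteq> V - {v}" "E \<inter> A \<times> (V - {v} - A) = {}"
  define B where "B = V - A"
  have "insert v A \<subset> V" "B \<subset> V" using A assms by (auto simp: B_def)
  then obtain f g where fg: "coloring k E (insert v A) f" "coloring k E B g"
    using critical_subset_colorable[OF assms(1)] by metis
  have "insert v A \<inter> B = {v, v}" using A assms by (auto simp: B_def)
  moreover have "E \<inter> (insert v A - {v, v}) \<times> (B - {v, v}) = {}" using A by (auto simp: B_def)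
  ultimately have "\<exists>c. coloring k E (insert v A \<union> B) c"
    using coloring_permuted_glue[OF fg critical_graph(3)[OF assms(1)]] by blast
  moreover have "insert v A \<union> B = V" using A assms by (auto simp: B_def)
  ultimately show False using criticalD(3)[OF assms(1)] by auto
qed

text \<open>The \<open>Suc\<close> accounts for the present colour of \<open>a\<close>, which is to
  be avoided along with the colours of the neighbours.\<close>

lemma recolor:
  assumes "coloring k E P f" "sym E" "irrefl E" "finite E" "a \<in> P"
    and "Suc (card (E `` {a} \<inter> P)) < k"
  obtains x where "x \<noteq> f a" "coloring k E P (f(a := x))"
proof -
  have fin: "finite (E `` {a} \<inter> P)" using assms(4) by (simp add: finite_Image)
  have "card (insert (f a) (f ` (E `` {a} \<inter> P))) \<le> Suc (card (E `` {a} \<inter> P))"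
    using card_insert_le_m1 fin card_image_le[OF fin, of f] by (simp add: card_insert_if)
  then have "card (insert (f a) (f ` (E `` {a} \<inter> P))) < card {..<k}" using assms by simp
  then obtain x where x: "x < k" "x \<noteq> f a" "x \<notin> f ` (E `` {a} \<inter> P)"
    using fin by (metis card_mono finite_imageI finite_insert insertCI lessThan_iff not_less subsetI)
  have "coloring k E P (f(a := x))"
    unfolding coloring_def
  proof (intro conjI ballI impI)
    fix u assume "u \<in> P"
    then show "(f(a := x)) u < k" using x assms(1) by (auto simp: coloring_def)
  next
    fix u v assume uv: "u \<in> P" "v \<in> P" "(u, v) \<in> E"
    then have "(v, u) \<in> E" "u \<noteq> v" using assms(2,3) by (auto dest: symD simp: irrefl_def)
    then show "(f(a := x)) u \<noteq> (f(a := x)) v" using uv assms(1) x by (auto simp: coloring_def)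
  qed
  then show thesis using that x by blast
qed

text \<open>
  Two colourings of the sides of a separating pair that both identify or both distinguish the pair
  could be glued, hence one side always identifies it and the other one always distinguishes it.
\<close>

lemma critical_separating_pair:
  assumes "critical k V E" "a \<in> V" "b \<in> V" "a \<noteq> b" "\<not> connected_on E (V - {a, b})"
  obtains P Q where "P \<union> Q = V" "P \<inter> Q = {a, b}" "P - {a, b} \<noteq> {}" "Q - {a, b} \<noteq> {}"
    "E \<inter> (P - {a, b}) \<times> (Q - {a, b}) = {}" "(a, b) \<notin> E"
    "k \<le> Suc (card (E `` {a} \<inter> P))" "k \<le> Suc (card (E `` {b} \<inter> P))"
    "k \<le> card (E `` {a} \<inter> Q) + card (E `` {b} \<inter> Q)"
proof -
  note obt = that
  note g = critical_graph[OF assms(1)]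
  obtain A where A: "A \<subseteq> V - {a, b}" "A \<noteq> {}" "A \<noteq> V - {a, b}" "E \<inter> A \<times> (V - {a, b} - A) = {}"
    using assms(5) unfolding connected_on_def by blast
  have thesis if PQ: "P \<union> Q = V" "P \<inter> Q = {a, b}" "P - {a, b} \<noteq> {}" "Q - {a, b} \<noteq> {}"
    "E \<inter> (P - {a, b}) \<times> (Q - {a, b}) = {}" and f: "coloring k E P f" "f a = f b" for P Q f
  proof -
    have "P \<subset> V" "Q \<subset> V" using PQ by auto
    then obtain g0 where g0: "coloring k E Q g0" using critical_subset_colorable[OF assms(1)] by metis
    have gQ: "h a \<noteq> h b" if "coloring k E Q h" for h
      using coloring_permuted_glue[OF f(1) that g(3) PQ(2) _ PQ(5)] f(2) PQ(1) criticalD(3)[OF assms(1)] by blast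
    have fP: "h a = h b" if "coloring k E P h" for h
      using coloring_permuted_glue[OF that g0 g(3) PQ(2) _ PQ(5)] gQ[OF g0] PQ(1) criticalD(3)[OF assms(1)] by blast
    have ab: "a \<in> P" "b \<in> P" "a \<in> Q" "b \<in> Q" using PQ by auto
    have nE: "(a, b) \<notin> E" "(b, a) \<notin> E" using f ab g(3) by (auto simp: coloring_def dest: symD)
    \<comment> \<open>With fewer than \<open>k - 1\<close> neighbours in \<open>P\<close>, the
      vertex \<open>a\<close> could be recoloured, and \<open>P\<close> would not force equal
      colours on the pair.\<close>
    have "k \<le> Suc (card (E `` {a} \<inter> P))"
    proof (rule ccontr)
      assume "\<not> ?thesis"
      then obtain x where "x \<noteq> f a" "coloring k E P (f(a := x))"
        using recolor[OF f(1) g(3,4,5) ab(1)] by (metis not_le)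
      then show False using fP[of "f(a := x)"] f(2) assms(4) by auto
    qed
    moreover have "k \<le> Suc (card (E `` {b} \<inter> P))"
    proof (rule ccontr)
      assume "\<not> ?thesis"
      then obtain x where "x \<noteq> f b" "coloring k E P (f(b := x))"
        using recolor[OF f(1) g(3,4,5) ab(2)] by (metis not_le)
      then show False using fP[of "f(b := x)"] f(2) assms(4) by auto
    qed
    \<comment> \<open>Otherwise some colour is absent from both neighbourhoods in \<open>Q\<close>.
      Giving it to \<open>a\<close> and to \<open>b\<close>, which are not adjacent, would identify
      the pair on \<open>Q\<close>.\<close>
    moreover have "k \<le> card (E `` {a} \<inter> Q) + card (E `` {b} \<inter> Q)"
    proof (rule ccontr)
      define N where "N = E `` {a} \<inter> Q \<union> E `` {b} \<inter> Q"
      have fin: "finite N" using g(5) by (auto simp: N_def finite_Image)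
      assume "\<not> ?thesis"
      then have "card N < k" using card_Un_le[of "E `` {a} \<inter> Q" "E `` {b} \<inter> Q"] by (simp add: N_def)
      then have "card (g0 ` N) < card {..<k}" using card_image_le[OF fin, of g0] by simp
      then obtain x where x: "x < k" "x \<notin> g0 ` N"
        using fin by (metis card_mono finite_imageI lessThan_iff not_less subsetI)
      have N': "g0 v \<noteq> x" if "(a, v) \<in> E \<or> (b, v) \<in> E \<or> (v, a) \<in> E \<or> (v, b) \<in> E" "v \<in> Q" for v
        using x that g(3) by (auto simp: N_def dest: symD)
      have "coloring k E Q (g0(a := x, b := x))"
        unfolding coloring_def
      proof (intro conjI ballI impI)
        fix u assume "u \<in> Q"
        then show "(g0(a := x, b := x)) u < k" using x g0 by (auto simp: coloring_def)
      next
        fix u v assume uv: "u \<in> Q" "v \<in> Q" "(u, v) \<in> E"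
        then show "(g0(a := x, b := x)) u \<noteq> (g0(a := x, b := x)) v"
          using g0 N'[of u] N'[of v] nE g(4) by (auto simp: coloring_def irrefl_def)
      qed
      then show False using gQ[of "g0(a := x, b := x)"] assms(4) by auto
    qed
    ultimately show thesis by (rule obt[OF PQ nE(1)])
  qed note * = this
  define P where "P = A \<union> {a, b}"
  define Q where "Q = V - A"
  have PQ: "P \<union> Q = V" "P \<inter> Q = {a, b}" "P - {a, b} \<noteq> {}" "Q - {a, b} \<noteq> {}"
    "E \<inter> (P - {a, b}) \<times> (Q - {a, b}) = {}"
    using A assms by (auto simp: P_def Q_def)
  have QP: "Q \<union> P = V" "Q \<inter> P = {a, b}" "E \<inter> (Q - {a, b}) \<times> (P - {a, b}) = {}"
    using PQ g(3) by (auto dest: symD)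
  have "P \<subset> V" "Q \<subset> V" using PQ by auto
  then obtain f h where fh: "coloring k E P f" "coloring k E Q h"
    using critical_subset_colorable[OF assms(1)] by metis
  show thesis
  proof (cases "f a = f b")
    case True
    then show ?thesis using *[OF PQ fh(1)] by blast
  next
    case False
    have "h a = h b"
      using coloring_permuted_glue[OF fh g(3) PQ(2) _ PQ(5)] False PQ(1) criticalD(3)[OF assms(1)] by blast
    then show ?thesis using *[OF QP(1,2) PQ(4,3) QP(3) fh(2)] by blast
  qed
qed

section \<open>At most one vertex of large degree\<close>


text \<open>The shape of a Hajos join with identified vertex \<open>v\<close> and new edge
  \<open>w1 w2\<close>. That \<open>v\<close> is adjacent to neither \<open>w1\<close> nor
  \<open>w2\<close> follows later from criticality with \<open>k \<ge> 3\<close>.\<close>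

definition reducible :: "'a set \<Rightarrow> 'a rel \<Rightarrow> bool" where
  "reducible V E \<longleftrightarrow> (\<exists>v P Q w1 w2. P \<union> Q = V \<and> P \<inter> Q = {v} \<and> w1 \<in> P - {v} \<and> w2 \<in> Q - {v} \<and>
     E \<inter> (P - {v}) \<times> (Q - {v}) = {(w1, w2)})"

text \<open>If \<open>E\<close> is not complete, there are \<open>p\<close> and \<open>b\<close> at
  distance two, and the greedy argument makes them a separating pair. Each has at least
  \<open>k - 1\<close> of its at most \<open>k\<close> neighbours in \<open>P\<close>, hence at most
  one in \<open>Q\<close>, whereas \<open>Q\<close> requires \<open>k \<ge> 3\<close> in
  total.\<close>

lemma brooks_critical:
  assumes "critical k V E" "3 \<le> k" "\<And>u. u \<in> V \<Longrightarrow> card (E `` {u}) \<le> k"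
  shows "E = V \<times> V - Id" "card V = k + 1"
proof -
  note g = critical_graph[OF assms(1)]
  show E: "E = V \<times> V - Id"
  proof (rule ccontr)
    assume "E \<noteq> V \<times> V - Id"
    then obtain p q where pq: "p \<in> V" "q \<in> V" "p \<noteq> q" "(p, q) \<notin> E"
      using g(2,4) by (auto simp: irrefl_def)
    define A where "A = insert p (E `` {p})"
    have A: "A \<subseteq> V" "p \<in> A" "q \<in> V - A" using pq g(2) by (auto simp: A_def)
    obtain r b where rb: "r \<in> A" "b \<in> V - A" "(r, b) \<in> E"
      using connected_onD[OF critical_connected_on[OF assms(1)] A] by metis
    have r: "(p, r) \<in> E" "(p, b) \<notin> E" "p \<noteq> b" using rb by (auto simp: A_def)
    have "\<not> connected_on E (V - {p, b})"
      using rb r pq assms(3) g by (intro critical_greedy[OF assms(1), of p b r]) (auto dest: symD simp: irrefl_def)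
    then obtain P Q where PQ: "P \<union> Q = V" "P \<inter> Q = {p, b}"
      "k \<le> Suc (card (E `` {p} \<inter> P))" "k \<le> Suc (card (E `` {b} \<inter> P))"
      "k \<le> card (E `` {p} \<inter> Q) + card (E `` {b} \<inter> Q)"
      using critical_separating_pair[OF assms(1) pq(1) _ r(3)] rb by (metis DiffD1)
    have "card (E `` {x} \<inter> P) + card (E `` {x} \<inter> Q) \<le> k" if "x = p \<or> x = b" for x
    proof -
      have "E `` {x} \<inter> P \<inter> (E `` {x} \<inter> Q) = {}"
        using that PQ(2) r(2) g(3,4) by (auto simp: irrefl_def dest: symD)
      moreover have "finite (E `` {x})" using g(5) by (simp add: finite_Image)
      ultimately have "card (E `` {x} \<inter> P) + card (E `` {x} \<inter> Q) = card (E `` {x} \<inter> P \<union> E `` {x} \<inter> Q)"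
        by (subst card_Un_disjoint) auto
      also have "\<dots> \<le> card (E `` {x})" using \<open>finite (E `` {x})\<close> by (intro card_mono) auto
      also have "\<dots> \<le> k" using assms(3)[of x] that pq rb by auto
      finally show ?thesis .
    qed
    from this[of p] this[of b] PQ(3-) assms(2) show False by simp
  qed
  obtain x where x: "x \<in> V" using critical_pos[OF assms(1)] by auto
  have "E `` {x} = V - {x}" using E x by auto
  then have "card (E `` {x}) = card V - 1" using g(1) x by simp
  moreover have "card V > 0" using x g(1) by (simp add: card_gt_0_iff) blast
  ultimately show "card V = k + 1" using assms(3)[OF x] critical_degree_ge[OF assms(1) x] by linarith
qed

text \<open>No other vertex can have the colour of the hub, so deleting the hub saves exactly one
  colour.\<close>

lemma critical_remove_hub:
  assumes "critical k V E" "2 \<le> k" "v \<in> V" "\<And>u. u \<in> V - {v} \<Longrightarrow> (v, u) \<in> E"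
  shows "critical (k - 1) (V - {v}) (E \<inter> (V - {v}) \<times> (V - {v}))"
proof -
  let ?W = "V - {v}" let ?F = "E \<inter> (V - {v}) \<times> (V - {v})"
  note g = critical_graph[OF assms(1)]
  have "ugraph ?W ?F" using g by (auto simp: ugraph_def sym_def irrefl_def)
  moreover have "\<exists>w. (u, w) \<in> ?F" if "u \<in> ?W" for u
  proof (rule ccontr)
    assume "\<not> ?thesis"
    then have "E `` {u} \<subseteq> {v}" using g(2) that by auto
    then have "card (E `` {u}) \<le> 1" using card_mono[of "{v}"] by fastforce
    then show False using critical_degree_ge[OF assms(1), of u] that assms(2) by simp
  qed
  moreover have "\<not> coloring (k - 1) ?F ?W c" for c
  proof
    assume c: "coloring (k - 1) ?F ?W c"
    have "coloring k E V (c(v := k - 1))"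
      unfolding coloring_def
    proof (intro conjI ballI impI)
      fix u assume "u \<in> V"
      then have "u \<noteq> v \<Longrightarrow> c u < k - 1" using c by (auto simp: coloring_def)
      then show "(c(v := k - 1)) u < k" using assms(2) by fastforce
    next
      fix x y assume "x \<in> V" "y \<in> V" "(x, y) \<in> E"
      moreover from this have "x \<noteq> y" using g(4) by (auto simp: irrefl_def)
      moreover have "c u \<noteq> k - 1" if "u \<in> V" "u \<noteq> v" for u using c that unfolding coloring_def by (metis Diff_iff less_irrefl singletonD)
      ultimately show "(c(v := k - 1)) x \<noteq> (c(v := k - 1)) y" using c
        by (cases "x = v"; cases "y = v") (auto simp: coloring_def)
    qed
    then show False using criticalD(3)[OF assms(1)] by blast
  qed
  moreover have "\<exists>c. coloring (k - 1) (?F - {(x, y), (y, x)}) ?W c" if xy: "(x, y) \<in> ?F" for x y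
  proof -
    obtain h where h: "coloring k (E - {(x, y), (y, x)}) V h" using criticalD(4)[OF assms(1)] xy by blast
    have "h v < k" "k - 1 < k" using h assms by (auto simp: coloring_def)
    \<comment> \<open>Giving the hub the last colour leaves \<open>{..<k - 1}\<close> for the
      rest.\<close>
    then obtain \<sigma> where \<sigma>: "\<sigma> permutes {..<k}" "\<sigma> (h v) = k - 1"
      using permutes_two_points[of "h v" k "h v" "k - 1" "k - 1"] by metis
    define c where "c = \<sigma> \<circ> h"
    have c: "coloring k (E - {(x, y), (y, x)}) V c"
      using coloring_permutes[OF h \<sigma>(1)] by (simp add: c_def)
    have "c u < k - 1" if "u \<in> ?W" for u
    proof -
      have "(v, u) \<in> E - {(x, y), (y, x)}" using assms(4) xy that by auto
      then have "c u < k" "c v \<noteq> c u" using c that assms(3) unfolding coloring_def by blast+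
      then show ?thesis using \<sigma>(2) by (simp add: c_def)
    qed
    then have "coloring (k - 1) (?F - {(x, y), (y, x)}) ?W c" using c by (simp add: coloring_def)
    then show ?thesis by blast
  qed
  ultimately show ?thesis unfolding critical_def by blast
qed

text \<open>As in Brooks' theorem, with \<open>v\<close> itself in the pair at distance two, so that
  all greedily coloured vertices have degree at most \<open>k\<close>. The other vertex
  \<open>a\<close> has a single neighbour \<open>x\<close> in \<open>Q\<close>; leaving
  \<open>a\<close> to \<open>P\<close> alone makes \<open>a x\<close> the only edge that crosses
  away from \<open>v\<close>, which is a Hajos split.\<close>

lemma critical_one_large_vertex:
  assumes "critical k V E" "3 \<le> k" "\<not> reducible V E" "v \<in> V"
    and "\<And>u. u \<in> V - {v} \<Longrightarrow> card (E `` {u}) \<le> k"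
  shows "u \<in> V - {v} \<Longrightarrow> (v, u) \<in> E"
proof (rule ccontr)
  note g = critical_graph[OF assms(1)]
  assume u: "u \<in> V - {v}" "(v, u) \<notin> E"
  obtain n where n: "(v, n) \<in> E" using criticalD(2)[OF assms(1,4)] by blast
  then have n': "n \<in> E `` {v}" "E `` {v} \<subseteq> V - {v}" using g(2,4) by (auto simp: irrefl_def)
  have u': "u \<in> V - {v} - E `` {v}" using u by auto
  obtain r a where "r \<in> E `` {v}" "a \<in> V - {v} - E `` {v}" and ra: "(r, a) \<in> E"
    by (rule connected_onD[OF critical_no_cutvertex[OF assms(1,4)] n'(2,1) u'])
  then have ra: "(v, r) \<in> E" "(r, a) \<in> E" "a \<in> V - {v}" "(v, a) \<notin> E" by auto
  have "\<not> connected_on E (V - {v, a})"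
    using ra assms(4,5) g by (intro critical_greedy[OF assms(1), of v a r]) (auto dest: symD simp: irrefl_def)
  then obtain P Q where PQ: "P \<union> Q = V" "P \<inter> Q = {v, a}" "Q - {v, a} \<noteq> {}"
    "E \<inter> (P - {v, a}) \<times> (Q - {v, a}) = {}" "k \<le> Suc (card (E `` {a} \<inter> P))"
    using critical_separating_pair[OF assms(1,4)] ra by (metis DiffE insertI1)
  have fin: "finite (E `` {a})" using g(5) by (simp add: finite_Image)
  have "E `` {a} \<inter> P \<inter> (E `` {a} \<inter> Q) = {}"
    using PQ(2) ra g(3,4) by (auto simp: irrefl_def dest: symD)
  then have "card (E `` {a} \<inter> P) + card (E `` {a} \<inter> Q) = card (E `` {a} \<inter> P \<union> E `` {a} \<inter> Q)"
    using fin by (subst card_Un_disjoint) auto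
  also have "\<dots> \<le> card (E `` {a})" using fin by (intro card_mono) auto
  also have "\<dots> \<le> k" using assms(5) ra by auto
  finally have le1: "card (E `` {a} \<inter> Q) \<le> 1" using PQ(5) by linarith
  obtain q where q: "q \<in> Q - {v, a}" using PQ(3) by auto
  have "a \<in> V - {v} - (Q - {v, a})" "Q - {v, a} \<subseteq> V - {v}" using PQ ra by auto
  \<comment> \<open>As \<open>v\<close> is no cut vertex, some edge leaves \<open>Q - {v, a}\<close>
    without ending in \<open>v\<close>; it can only end in \<open>a\<close>.\<close>
  then obtain x y where xy: "x \<in> Q - {v, a}" "y \<in> V - {v} - (Q - {v, a})" "(x, y) \<in> E"
    using connected_onD[OF critical_no_cutvertex[OF assms(1,4)], of "Q - {v, a}" q a] q by metis
  have "(y, x) \<in> E" using xy g(3) by (meson symD)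
  then have "y = a" using xy PQ(1,2,4) by blast
  with xy \<open>(y, x) \<in> E\<close> have x: "x \<in> E `` {a} \<inter> Q" by auto
  with le1 fin have Qa: "E `` {a} \<inter> Q = {x}"
    by (metis One_nat_def card_le_Suc0_iff_eq finite_Int is_singletonI' is_singleton_def singletonD empty_iff)
  have "E \<inter> (P - {v}) \<times> (Q - {a} - {v}) = {(a, x)}"
  proof -
    have "e = (a, x)" if "e \<in> E \<inter> (P - {v}) \<times> (Q - {a} - {v})" for e
    proof -
      have "fst e = a" using that PQ(4) by (cases e) auto
      then show ?thesis using that Qa by (cases e) auto
    qed
    moreover have "(a, x) \<in> E \<inter> (P - {v}) \<times> (Q - {a} - {v})" using x xy ra PQ by auto
    ultimately show ?thesis by blast
  qed
  moreover have "P \<union> (Q - {a}) = V" "P \<inter> (Q - {a}) = {v}" using PQ(1,2) ra by auto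
  moreover have "a \<in> P - {v}" "x \<in> Q - {a} - {v}" using PQ(2) ra xy by auto
  ultimately have "reducible V E" unfolding reducible_def by blast
  then show False using assms(3) by blast
qed

text \<open>Without the hub the graph is critical for \<open>k - 1\<close> colours and has degrees
  at most \<open>k - 1\<close>, so Brooks' theorem applies because \<open>k - 1 \<ge> 3\<close>. For
  \<open>k = 3\<close> the remainder is an odd cycle instead.\<close>

lemma hub_critical_complete:
  assumes "critical k V E" "4 \<le> k" "v \<in> V" "\<And>u. u \<in> V - {v} \<Longrightarrow> (v, u) \<in> E"
    and "\<And>u. u \<in> V - {v} \<Longrightarrow> card (E `` {u}) \<le> k"
  shows "E = V \<times> V - Id" "card V = k + 1"
proof -
  note g = critical_graph[OF assms(1)]
  let ?W = "V - {v}" let ?F = "E \<inter> (V - {v}) \<times> (V - {v})"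
  have crit: "critical (k - 1) ?W ?F" using critical_remove_hub[OF assms(1)] assms by auto
  have deg: "card (?F `` {u}) \<le> k - 1" if "u \<in> ?W" for u
  proof -
    have "finite (E `` {u})" using g(5) by (simp add: finite_Image)
    moreover have "?F `` {u} = E `` {u} - {v}" "v \<in> E `` {u}"
      using that assms(4) g(2,3) by (auto dest: symD)
    ultimately show ?thesis using assms(5)[OF that] by simp
  qed
  have F: "?F = ?W \<times> ?W - Id" "card ?W = k - 1 + 1"
    using brooks_critical[OF crit _ deg] assms(2) by auto
  then show "card V = k + 1" using assms g(1) by (simp add: card_Diff_singleton)
  show "E = V \<times> V - Id"
  proof
    show "E \<subseteq> V \<times> V - Id" using g(2,4) by (auto simp: irrefl_def)
    show "V \<times> V - Id \<subseteq> E"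
    proof (rule subrelI)
      fix a b assume "(a, b) \<in> V \<times> V - Id"
      then have ab: "a \<in> V" "b \<in> V" "(a, b) \<notin> Id" by auto
      show "(a, b) \<in> E"
      proof (cases "a = v \<or> b = v")
        case True
        then show ?thesis using assms(4)[of a] assms(4)[of b] ab g(3) by (auto dest: symD)
      next
        case False
        then have "(a, b) \<in> ?F" unfolding F(1) using ab by auto
        then show ?thesis by simp
      qed
    qed
  qed
qed

section \<open>Replacing the rainbow side of a tight cut\<close>


lemma reducibleI:
  assumes "P \<union> Q = V" "P \<inter> Q = {v}" "w1 \<in> P - {v}" "w2 \<in> Q - {v}"
    "E \<inter> (P - {v}) \<times> (Q - {v}) = {(w1, w2)}"
  shows "reducible V E"
  unfolding reducible_def by (intro exI conjI) (rule assms)+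

lemma reducibleE:
  assumes "reducible V E"
  obtains v P Q w1 w2 where "P \<union> Q = V" "P \<inter> Q = {v}" "w1 \<in> P - {v}" "w2 \<in> Q - {v}"
    "E \<inter> (P - {v}) \<times> (Q - {v}) = {(w1, w2)}"
  using assms unfolding reducible_def by (elim exE conjE) (rule that)

text \<open>The cuts around \<open>P - {v}\<close> and \<open>Q - {v}\<close> have at least
  \<open>k\<close> edges each, all but \<open>w1 w2\<close> ending in \<open>v\<close>. Hence
  \<open>v\<close> has at least \<open>k - 1\<close> neighbours on each side.\<close>

lemma reducible_vertex_degree:
  assumes "critical k V E" "P \<union> Q = V" "P \<inter> Q = {v}" "w1 \<in> P - {v}" "w2 \<in> Q - {v}"
    and "E \<inter> (P - {v}) \<times> (Q - {v}) = {(w1, w2)}"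
  shows "2 * k \<le> card (E `` {v}) + 2"
proof -
  note g = critical_graph[OF assms(1)]
  have *: "k \<le> Suc (card (E `` {v} \<inter> P))" if PQ: "P \<union> Q = V" "P \<inter> Q = {v}" "w1 \<in> P - {v}"
    "E \<inter> (P - {v}) \<times> (Q - {v}) = {(w1, w2)}" for P Q w1 w2
  proof -
    have "edge_cut E (P - {v}) \<subseteq> insert (w1, w2) ((E `` {v} \<inter> P) \<times> {v})"
    proof (rule subrelI)
      fix x y assume xy: "(x, y) \<in> edge_cut E (P - {v})"
      then have "x \<in> P - {v}" "(x, y) \<in> E" "(y, x) \<in> E" "y \<in> V" "y \<notin> P - {v}"
        using g(2,3) by (auto simp: edge_cut_def dest: symD)
      moreover from this have "y \<noteq> v \<Longrightarrow> (x, y) \<in> E \<inter> (P - {v}) \<times> (Q - {v})" using PQ(1) by auto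
      ultimately show "(x, y) \<in> insert (w1, w2) ((E `` {v} \<inter> P) \<times> {v})" using PQ(4) by (cases "y = v") auto
    qed
    moreover have fin: "finite (E `` {v} \<inter> P)" using g(5) by (simp add: finite_Image)
    ultimately have "card (edge_cut E (P - {v})) \<le> card (insert (w1, w2) ((E `` {v} \<inter> P) \<times> {v}))"
      by (intro card_mono) auto
    also have "\<dots> \<le> Suc (card ((E `` {v} \<inter> P) \<times> {v}))" using fin by (simp add: card_insert_if)
    also have "\<dots> = Suc (card (E `` {v} \<inter> P))" by (simp add: card_cartesian_product)
    moreover have "k \<le> card (edge_cut E (P - {v}))" using PQ by (intro critical_cut_ge[OF assms(1)]) auto
    ultimately show ?thesis by linarith
  qed
  have "k \<le> Suc (card (E `` {v} \<inter> P))" using * assms by metis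
  moreover have "E \<inter> (Q - {v}) \<times> (P - {v}) = {(w2, w1)}"
    using assms(6) g(3) by (auto dest: symD)
  with * have "k \<le> Suc (card (E `` {v} \<inter> Q))" using assms(2,3,5) by (metis Un_commute Int_commute)
  moreover have "card (E `` {v} \<inter> P) + card (E `` {v} \<inter> Q) = card (E `` {v})"
  proof -
    have "E `` {v} \<inter> P \<inter> (E `` {v} \<inter> Q) = {}" using assms(3) g(4) by (auto simp: irrefl_def)
    moreover have "E `` {v} = E `` {v} \<inter> P \<union> E `` {v} \<inter> Q" using g(2) assms(2) by auto
    moreover have "finite (E `` {v})" using g(5) by (simp add: finite_Image)
    ultimately show ?thesis by (metis card_Un_disjoint finite_Un)
  qed
  ultimately show ?thesis by linarith
qed

text \<open>
  Replacing the rainbow side of a tight cut by a clique on the ends of the cut edges gives a smaller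
  graph with the same properties.
\<close>

locale tight_cut =
  fixes k :: nat and V :: "'a set" and E :: "'a rel" and X :: "'a set"
  assumes crit: "critical k V E" and k3: "3 \<le> k" and XV: "X \<subseteq> V" and card_cut: "card (edge_cut E X) = k"
    and const: "\<And>f p q. coloring k E X f \<Longrightarrow> p \<in> edge_cut E X \<Longrightarrow> q \<in> edge_cut E X \<Longrightarrow> f (fst p) = f (fst q)"
    and rainbow: "\<And>g. coloring k E (V - X) g \<Longrightarrow> inj_on (g \<circ> snd) (edge_cut E X)"
begin

definition "T = snd ` edge_cut E X"
definition "W = X \<union> T"
definition "F = E \<inter> X \<times> X \<union> edge_cut E X \<union> (edge_cut E X)\<inverse> \<union> (T \<times> T - Id)"

lemmas g = critical_graph[OF crit]

lemma cut_nonempty: "edge_cut E X \<noteq> {}"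
  using card_cut k3 by auto

lemma sides: "X \<noteq> {}" "V - X \<noteq> {}"
  using cut_nonempty g(2) by (auto simp: edge_cut_def)

text \<open>Distinct colours force distinct ends outside \<open>X\<close>, so every vertex of
  \<open>T\<close> is met by exactly one cut edge.\<close>

lemma inj_snd: "inj_on snd (edge_cut E X)"
proof -
  have "V - X \<subset> V" using sides XV by auto
  then obtain c where "coloring k E (V - X) c" using critical_subset_colorable[OF crit] by metis
  then show ?thesis using rainbow inj_on_imageI2 by blast
qed

lemma T: "card T = k" "finite T" "T \<subseteq> V - X"
  using card_image[OF inj_snd] card_cut finite_edge_cut[OF g(5)] g(2) by (auto simp: T_def edge_cut_def)

lemma W: "W \<subseteq> V" "finite W"
  using T XV g(1) finite_subset by (auto simp: W_def)

lemma TE: assumes "t \<in> T" obtains x where "x \<in> X" "(x, t) \<in> edge_cut E X" "(x, t) \<in> E"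
  using assms by (auto simp: T_def edge_cut_def)

lemma unique: "(x, t) \<in> edge_cut E X \<Longrightarrow> (y, t) \<in> edge_cut E X \<Longrightarrow> x = y"
  using inj_onD[OF inj_snd, of "(x, t)" "(y, t)"] by auto

lemma cutD: "(x, t) \<in> edge_cut E X \<Longrightarrow> x \<in> X \<and> t \<in> T \<and> t \<notin> X \<and> (x, t) \<in> E \<and> (t, x) \<in> E"
  using g(3) by (force simp: T_def edge_cut_def dest: symD)

lemma F_iff: "(x, y) \<in> F \<longleftrightarrow> x \<in> W \<and> y \<in> W \<and> (if x \<in> T \<and> y \<in> T then x \<noteq> y else (x, y) \<in> E)"
proof -
  have c: "(x, y) \<in> edge_cut E X \<longleftrightarrow> x \<in> X \<and> y \<in> T \<and> (x, y) \<in> E" for x y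
    using T(3) cutD[of x y] by (auto simp: edge_cut_def)
  have disj: "z \<notin> T" if "z \<in> X" for z using T(3) that by auto
  have s: "(x, y) \<in> E \<longleftrightarrow> (y, x) \<in> E" using g(3) by (meson symD)
  have "(x, y) \<in> F \<longleftrightarrow> (x, y) \<in> E \<and> x \<in> X \<and> y \<in> X \<or> x \<in> X \<and> y \<in> T \<and> (x, y) \<in> E
    \<or> y \<in> X \<and> x \<in> T \<and> (x, y) \<in> E \<or> x \<in> T \<and> y \<in> T \<and> x \<noteq> y"
    unfolding F_def using s by (auto simp: c)
  then show ?thesis using disj[of x] disj[of y] by (cases "x \<in> X"; cases "y \<in> X") (auto simp: W_def)
qed

lemma X_notin_T: "x \<in> X \<Longrightarrow> x \<notin> T"
  using T(3) by auto

lemma F_imp_E: "(x, y) \<in> F \<Longrightarrow> x \<in> X \<or> y \<in> X \<Longrightarrow> (x, y) \<in> E"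
  using X_notin_T by (auto simp: F_iff split: if_splits)

lemma ugraph_F: "ugraph W F"
  unfolding ugraph_def sym_def irrefl_def
  using W(2) g(3,4) by (auto simp: F_iff irrefl_def dest: symD)

text \<open>An edge of \<open>E\<close> that leaves a subset of \<open>X\<close> ends in
  \<open>X\<close> or in \<open>T\<close>, and \<open>F\<close> has the same edges there.\<close>

lemma cut_F: "C \<subseteq> X \<Longrightarrow> edge_cut F C = edge_cut E C"
proof -
  assume C: "C \<subseteq> X"
  have "(x, y) \<in> F \<longleftrightarrow> (x, y) \<in> E" if "x \<in> C" "y \<notin> C" for x y
  proof -
    have "x \<in> X" "x \<notin> T" using C T(3) that by auto
    moreover have "y \<in> W" if "(x, y) \<in> E"
      using that \<open>x \<in> X\<close> unfolding W_def T_def edge_cut_def by force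
    ultimately show ?thesis by (auto simp: F_iff W_def)
  qed
  then show ?thesis by (auto simp: edge_cut_def)
qed

lemma degree_T:
  assumes "t \<in> T" shows "card (F `` {t}) = k"
proof -
  obtain x where x: "x \<in> X" "(x, t) \<in> edge_cut E X" "(x, t) \<in> E" using TE assms by blast
  have "F `` {t} = insert x (T - {t})"
  proof (intro set_eqI)
    fix y
    show "y \<in> F `` {t} \<longleftrightarrow> y \<in> insert x (T - {t})"
    proof (cases "y \<in> T")
      case True
      then show ?thesis using x assms T(3) by (auto simp: F_iff W_def)
    next
      case False
      have "y = x" if "y \<in> X" "(t, y) \<in> E"
      proof -
        have "(y, t) \<in> edge_cut E X" using that assms T(3) g(3) by (auto simp: edge_cut_def dest: symD)
        then show ?thesis using unique x by blast
      qed
      then show ?thesis using x assms False cutD[OF x(2)] by (auto simp: F_iff W_def)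
    qed
  qed
  moreover have "x \<notin> T" using x T(3) by auto
  ultimately show ?thesis using T assms k3 by (simp add: card_Diff_singleton)
qed

text \<open>The clique \<open>T\<close> uses all \<open>k\<close> colours, including the one shared
  by all ends of cut edges in \<open>X\<close>. The vertex of \<open>T\<close> with this colour
  clashes along its cut edge.\<close>

lemma not_colorable_F: "\<not> coloring k F W c"
proof
  assume c: "coloring k F W c"
  have cX: "coloring k E X c"
    using c by (rule coloring_mono) (use T(3) in \<open>auto simp: F_iff W_def\<close>)
  obtain p where p: "p \<in> edge_cut E X" using cut_nonempty by auto
  have "inj_on c T"
  proof (intro inj_onI, rule ccontr)
    fix s t assume st: "s \<in> T" "t \<in> T" "c s = c t" "s \<noteq> t"
    then have "(s, t) \<in> F" by (auto simp: F_iff W_def)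
    then show False using c st by (auto simp: coloring_def W_def)
  qed
  then have "card (c ` T) = k" using T(1) by (simp add: card_image)
  moreover have "c ` T \<subseteq> {..<k}" using c by (auto simp: coloring_def W_def)
  ultimately have "c ` T = {..<k}" by (intro card_subset_eq) auto
  moreover have "fst p \<in> X" using p by (auto simp: edge_cut_def)
  ultimately have "c (fst p) \<in> c ` T" using cX by (auto simp: coloring_def)
  then obtain t where t: "t \<in> T" "c t = c (fst p)" by auto
  then obtain x where x: "x \<in> X" "(x, t) \<in> edge_cut E X" "(x, t) \<in> E" using TE by blast
  have "c x = c (fst p)" using const[OF cX x(2) p] by simp
  moreover have "(x, t) \<in> F" using x t T(3) by (auto simp: F_iff W_def)
  then have "c x \<noteq> c t" using c t(1) x(1) unfolding coloring_def W_def by blast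
  ultimately show False using t by simp
qed

text \<open>Away from the clique, a colouring of \<open>V\<close> without the edge is still rainbow
  at \<open>T\<close>. For an edge \<open>x y\<close> of the clique, \<open>x\<close> and
  \<open>y\<close> may share a colour; then \<open>k - 1\<close> colours suffice for
  \<open>T\<close> and can avoid the colour at the ends in \<open>X\<close>.\<close>

lemma edge_removal_F:
  assumes "(x, y) \<in> F"
  shows "\<exists>c. coloring k (F - {(x, y), (y, x)}) W c"
proof (cases "x \<in> T \<and> y \<in> T")
  case False
  then have xyE: "(x, y) \<in> E" "x \<in> X \<or> y \<in> X" using assms by (auto simp: F_iff W_def split: if_splits)
  then obtain h where h: "coloring k (E - {(x, y), (y, x)}) V h" using criticalD(4)[OF crit] by blast
  \<comment> \<open>The deleted edge meets \<open>X\<close>, so \<open>V - X\<close> keeps all its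
    edges and \<open>rainbow\<close> applies.\<close>
  have "coloring k E (V - X) h" using h by (rule coloring_mono) (use xyE in auto)
  then have "inj_on h T" unfolding T_def using rainbow by (intro inj_on_imageI) auto
  have "coloring k (F - {(x, y), (y, x)}) W h"
    unfolding coloring_def
  proof (intro conjI ballI impI)
    fix u assume "u \<in> W"
    then show "h u < k" using h W(1) by (auto simp: coloring_def)
  next
    fix u v assume uv: "u \<in> W" "v \<in> W" "(u, v) \<in> F - {(x, y), (y, x)}"
    show "h u \<noteq> h v"
    proof (cases "u \<in> T \<and> v \<in> T")
      case True
      then show ?thesis using uv \<open>inj_on h T\<close> by (auto simp: F_iff inj_on_def)
    next
      case False
      then have "(u, v) \<in> E - {(x, y), (y, x)}" using uv by (auto simp: F_iff)
      then show ?thesis using h uv W(1) by (auto simp: coloring_def)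
    qed
  qed
  then show ?thesis by blast
next
  case True
  then have xy: "x \<in> T" "y \<in> T" "x \<noteq> y" using assms by (auto simp: F_iff)
  have "X \<subset> V" using sides XV by auto
  then obtain f where f: "coloring k E X f" using critical_subset_colorable[OF crit] by metis
  obtain p where p: "p \<in> edge_cut E X" using cut_nonempty by auto
  define a where "a = f (fst p)"
  have "a < k" using p f by (auto simp: a_def edge_cut_def coloring_def)
  then have "card (T - {x}) = card ({..<k} - {a})" using T xy by simp
  then obtain \<beta> where \<beta>: "bij_betw \<beta> (T - {x}) ({..<k} - {a})"
    using T(2) finite_same_card_bij by (metis finite_Diff finite_lessThan)
  \<comment> \<open>The vertex \<open>x\<close> borrows the colour of \<open>y\<close>, and no
    vertex of \<open>T\<close> gets \<open>a\<close>.\<close>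
  define c where "c = (\<lambda>u. if u \<in> X then f u else if u = x then \<beta> y else \<beta> u)"
  have cT: "c t < k" "c t \<noteq> a" if "t \<in> T" for t
    using bij_betwE[OF \<beta>] that xy T(3) by (auto simp: c_def)
  have cdiff: "c s \<noteq> c t" if st: "s \<in> T" "t \<in> T" "s \<noteq> t" "(s, t) \<notin> {(x, y), (y, x)}" for s t
  proof -
    define s' t' where "s' = (if s = x then y else s)" and "t' = (if t = x then y else t)"
    have "s' \<in> T - {x}" "t' \<in> T - {x}" "s' \<noteq> t'" using st xy by (auto simp: s'_def t'_def)
    then have "\<beta> s' \<noteq> \<beta> t'" using bij_betw_imp_inj_on[OF \<beta>] by (auto simp: inj_on_def)
    moreover have "s \<notin> X" "t \<notin> X" using st T(3) by auto
    ultimately show ?thesis using st(3) by (simp add: c_def s'_def t'_def split: if_splits)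
  qed
  have cX: "c u = a" if ut: "u \<in> X" "t \<in> T" "(u, t) \<in> E" for u t
  proof -
    have "(u, t) \<in> edge_cut E X" using ut T(3) by (auto simp: edge_cut_def)
    then show ?thesis using const[OF f _ p] ut by (fastforce simp: c_def a_def)
  qed
  have "coloring k (F - {(x, y), (y, x)}) W c"
    unfolding coloring_def
  proof (intro conjI ballI impI)
    fix u assume "u \<in> W"
    moreover have "c u < k" if "u \<in> X" using f that by (auto simp: c_def coloring_def)
    ultimately show "c u < k" using cT(1) by (auto simp: W_def simp del: c_def)
  next
    fix u v assume uv: "u \<in> W" "v \<in> W" "(u, v) \<in> F - {(x, y), (y, x)}"
    then consider "u \<in> X" "v \<in> X" | "u \<in> X" "v \<in> T" | "u \<in> T" "v \<in> X" | "u \<in> T" "v \<in> T"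
      by (auto simp: W_def)
    then show "c u \<noteq> c v"
    proof cases
      case 1
      then have "(u, v) \<in> E" using uv F_imp_E by auto
      then show ?thesis using f 1 by (auto simp: c_def coloring_def)
    next
      case 2
      then have "(u, v) \<in> E" using uv F_imp_E by auto
      then show ?thesis using cX cT 2 by metis
    next
      case 3
      then have "(v, u) \<in> E" using uv F_imp_E g(3) by (auto dest: symD)
      then show ?thesis using cX cT 3 by metis
    next
      case 4
      then show ?thesis using cdiff uv by (auto simp: F_iff)
    qed
  qed
  then show ?thesis by blast
qed

lemma critical_F: "critical k W F"
proof -
  have "\<exists>v. (u, v) \<in> F" if "u \<in> W" for u
  proof (cases "u \<in> T")
    case True
    then obtain x where "x \<in> X" "(x, u) \<in> edge_cut E X" using TE by blast
    then have "(u, x) \<in> F" using cutD True T(3) by (auto simp: F_iff W_def)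
    then show ?thesis by blast
  next
    case False
    then have u: "u \<in> X" using that by (auto simp: W_def)
    then obtain v where "(u, v) \<in> E" using criticalD(2)[OF crit] XV by blast
    moreover from this u have "v \<in> W" unfolding W_def T_def edge_cut_def by force
    ultimately have "(u, v) \<in> F" using False that by (auto simp: F_iff)
    then show ?thesis by blast
  qed
  then show ?thesis unfolding critical_def
    using ugraph_F not_colorable_F edge_removal_F by blast
qed

text \<open>A vertex of \<open>T\<close> is cut off by its \<open>k\<close> edges. For two vertices
  of \<open>X\<close>, a small cut of the old graph is uncrossed with \<open>X\<close>, so that one
  of its sides lies inside \<open>X\<close>, where both graphs have the same cuts.\<close>

lemma cut_bounded_F:
  assumes "cut_bounded k V E"
  shows "cut_bounded k W F"
  unfolding cut_bounded_def
proof (intro ballI impI)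
  fix x y assume xy: "x \<in> W" "y \<in> W" "x \<noteq> y"
  note gF = ugraphD[OF ugraph_F]
  consider "x \<in> T" | "y \<in> T" | "x \<in> X" "y \<in> X" using xy by (auto simp: W_def)
  then show "\<exists>A. x \<in> A \<and> y \<notin> A \<and> card (edge_cut F A) \<le> k"
  proof cases
    case 1
    then show ?thesis using xy degree_T card_cut_singleton[OF gF(4)] by (intro exI[of _ "{x}"]) auto
  next
    case 2
    then show ?thesis using xy degree_T card_cut_singleton[OF gF(4)] card_cut_Compl[OF gF(3)]
      by (intro exI[of _ "- {y}"]) auto
  next
    case 3
    then obtain B where B: "x \<in> B" "y \<notin> B" "card (edge_cut E B) \<le> k"
      using assms xy XV unfolding cut_bounded_def by blast
    have fin: "finite (edge_cut E C)" for C by (rule finite_edge_cut[OF g(5)])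
    show ?thesis
    proof (cases "V - X \<subseteq> B")
      case True
      have eq: "edge_cut E (V - B) = edge_cut E (- B)" using g(2) by (auto simp: edge_cut_def)
      have "V - B \<subseteq> X" using True by auto
      then have "card (edge_cut F (V - B)) \<le> k" using cut_F eq card_cut_Compl[OF g(3)] B(3) by metis
      moreover have "card (edge_cut F (- (V - B))) = card (edge_cut F (V - B))" by (rule card_cut_Compl[OF gF(3)])
      moreover have "x \<in> - (V - B)" "y \<notin> - (V - B)" using B 3 XV by auto
      ultimately show ?thesis by metis
    next
      case False
      \<comment> \<open>Here \<open>B \<union> X\<close> misses a vertex, so its cut has at least
        \<open>k\<close> edges, and submodularity leaves at most \<open>k\<close> for
        \<open>B \<inter> X\<close>.\<close>
      then have *: "k \<le> card (edge_cut E (V \<inter> (B \<union> X)))"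
        using sides XV by (intro critical_cut_ge[OF crit]) auto
      have "card (edge_cut E (B \<inter> X)) + card (edge_cut E (B \<union> X)) \<le> card (edge_cut E B) + card (edge_cut E X)"
      proof -
        have "card (edge_cut E (B \<inter> X)) + card (edge_cut E (B \<union> X)) =
          card (edge_cut E (B \<inter> X) \<union> edge_cut E (B \<union> X)) + card (edge_cut E (B \<inter> X) \<inter> edge_cut E (B \<union> X))"
          by (rule card_Un_Int[OF fin fin])
        also have "\<dots> \<le> card (edge_cut E B \<union> edge_cut E X) + card (edge_cut E B \<inter> edge_cut E X)"
          using fin by (intro add_mono card_mono) (auto simp: edge_cut_def)
        also have "\<dots> = card (edge_cut E B) + card (edge_cut E X)"
          by (rule card_Un_Int[OF fin fin, symmetric])
        finally show ?thesis .
      qed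
      moreover have "edge_cut E (V \<inter> (B \<union> X)) = edge_cut E (B \<union> X)" using cut_Int_verts[OF g(2)] by (metis Int_commute)
      ultimately have "card (edge_cut E (B \<inter> X)) \<le> k" using * B(3) card_cut by simp
      then show ?thesis using cut_F[of "B \<inter> X"] B 3 by (intro exI[of _ "B \<inter> X"]) auto
    qed
  qed
qed

text \<open>The vertex \<open>v\<close> of a split has degree at least \<open>2 k - 2 > k\<close>,
  so it is not in \<open>T\<close>. A clique on three or more vertices cannot be divided by a single
  edge, so \<open>T\<close> lies on one side, and the removed vertices return to that side.\<close>

lemma reducible_F:
  assumes "reducible W F"
  shows "reducible V E"
proof -
  note gF = ugraphD[OF ugraph_F]
  obtain v P Q w1 w2 where r: "P \<union> Q = W" "P \<inter> Q = {v}" "w1 \<in> P - {v}" "w2 \<in> Q - {v}"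
    "F \<inter> (P - {v}) \<times> (Q - {v}) = {(w1, w2)}"
    using assms by (rule reducibleE)
  have "2 * k \<le> card (F `` {v}) + 2" by (rule reducible_vertex_degree[OF critical_F r])
  then have vT: "v \<notin> T" using degree_T k3 by fastforce
  have *: "reducible V E" if r: "P \<union> Q = W" "P \<inter> Q = {v}" "w1 \<in> P - {v}" "w2 \<in> Q - {v}"
    "F \<inter> (P - {v}) \<times> (Q - {v}) = {(w1, w2)}" and TP: "T \<subseteq> P" for P Q w1 w2
  proof -
    have PQW: "P \<subseteq> W" "Q \<subseteq> W" using r(1) by auto
    have "x \<notin> T" if "x \<in> Q" for x using r(2) TP vT that by (metis IntI singletonD subsetD)
    then have QX1: "Q \<subseteq> X" using PQW by (auto simp: W_def)
    have "v \<in> Q" using r(2) by blast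
    then have QX: "Q \<subseteq> X" "v \<in> X" using QX1 by auto
    have "(p, q) \<in> E \<and> p \<in> (P \<union> (V - X)) - {v} \<longleftrightarrow> (p, q) \<in> F \<and> p \<in> P - {v}" if q: "q \<in> Q - {v}" for p q
    proof -
      have qX: "q \<in> X" "q \<notin> T" "q \<in> W" using QX T(3) q by (auto simp: W_def)
      have "p \<in> T" if "(p, q) \<in> E" "p \<in> V - X"
        using that qX g(3) by (force simp: T_def edge_cut_def dest: symD)
      moreover have "p \<in> T \<Longrightarrow> p \<in> V - X" using T(3) by auto
      ultimately show ?thesis using qX TP QX(2) PQW(1) g(2) by (auto simp: F_iff W_def)
    qed
    then have "E \<inter> (P \<union> (V - X) - {v}) \<times> (Q - {v}) = F \<inter> (P - {v}) \<times> (Q - {v})" by auto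
    moreover have "(P \<union> (V - X)) \<union> Q = V" "(P \<union> (V - X)) \<inter> Q = {v}" using r W(1) QX XV by (auto simp: W_def)
    moreover have "w1 \<in> P \<union> (V - X) - {v}" using r by auto
    ultimately show ?thesis using r(4,5) by (intro reducibleI[of "P \<union> (V - X)" Q V v w1 w2]) auto
  qed
  show ?thesis
  proof (cases "T \<subseteq> P")
    case True
    then show ?thesis using * r by blast
  next
    case nP: False
    show ?thesis
    proof (cases "T \<subseteq> Q")
      case True
      have "F \<inter> (Q - {v}) \<times> (P - {v}) = {(w2, w1)}" using r(5) gF(3) by (auto dest: symD)
      then show ?thesis using *[of Q P w2 w1] r True by (auto simp: Un_commute Int_commute)
    next
      case False
      then obtain s t where st: "s \<in> T" "s \<notin> P" "t \<in> T" "t \<notin> Q" using nP by auto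
      \<comment> \<open>The edge \<open>s t\<close> is already the only crossing edge; a third
        vertex of \<open>T\<close> would give another one.\<close>
      have "T \<noteq> {s, t}" using T(1) k3 card_insert_le_m1[of 2 "{t}" s] by auto
      then obtain z where z: "z \<in> T" "z \<noteq> s" "z \<noteq> t" using st by auto
      have PQ: "u \<in> P - {v} \<or> u \<in> Q - {v}" if "u \<in> T" for u using that r vT by (auto simp: W_def)
      have TF: "(a, b) = (w1, w2)" if "a \<in> T" "b \<in> T" "a \<in> P - {v}" "b \<in> Q - {v}" for a b
      proof -
        have "a \<noteq> b" using that r by auto
        then have "(a, b) \<in> F \<inter> (P - {v}) \<times> (Q - {v})" using that by (auto simp: F_iff W_def)
        then show ?thesis using r by auto
      qed
      show ?thesis using TF[of t s] TF[of t z] TF[of z s] PQ[of s] PQ[of t] PQ[of z] st z by auto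
    qed
  qed
qed

end

text \<open>With two vertices of degree above \<open>k\<close>, the smaller graph has a hub
  \<open>v\<close>. In \<open>T\<close> it would have a cut edge to each of at least two vertices of
  \<open>X\<close>, but only one meets it. In \<open>X\<close> it would be the end of all cut edges
  and thus a cut vertex of the original graph.\<close>

theorem irreducible_hub:
  assumes "critical k V E" "3 \<le> k" "cut_bounded k V E" "\<not> reducible V E"
  shows "\<exists>v\<in>V. \<forall>u\<in>V - {v}. (v, u) \<in> E \<and> card (E `` {u}) \<le> k"
  using assms(1,3,4)
proof (induction "card V" arbitrary: V E rule: less_induct)
  case less
  note g = critical_graph[OF less.prems(1)]
  show ?case
  proof (cases "\<exists>v\<in>V. \<forall>u\<in>V - {v}. card (E `` {u}) \<le> k")
    case True
    then show ?thesis using critical_one_large_vertex[OF less.prems(1) assms(2) less.prems(3)] by metis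
  next
    case False
    obtain z where "z \<in> V" using critical_pos[OF less.prems(1)] by auto
    then obtain x where x: "x \<in> V" "k < card (E `` {x})" using False by (metis DiffD1 not_le)
    then obtain y where y: "y \<in> V" "y \<noteq> x" "k < card (E `` {y})" using False by (metis Diff_iff insertCI not_le)
    obtain A0 where A0: "x \<in> A0" "y \<notin> A0" "card (edge_cut E A0) \<le> k"
      using less.prems(2) x y unfolding cut_bounded_def by metis
    define A where "A = A0 \<inter> V"
    have A: "A \<subseteq> V" "x \<in> A" "y \<in> V - A" using x y A0 by (auto simp: A_def)
    then have "k \<le> card (edge_cut E A)" by (intro critical_cut_ge[OF less.prems(1)]) auto
    moreover have "card (edge_cut E A) \<le> k" using A0(3) cut_Int_verts[OF g(2)] by (simp add: A_def)
    ultimately have cA: "card (edge_cut E A) = k" by simp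
    have k2: "2 \<le> k" using assms(2) by simp
    obtain X where X: "X = A \<or> X = V - A"
      "\<And>f p q. coloring k E X f \<Longrightarrow> p \<in> edge_cut E X \<Longrightarrow> q \<in> edge_cut E X \<Longrightarrow> f (fst p) = f (fst q)"
      "\<And>g. coloring k E (V - X) g \<Longrightarrow> inj_on (g \<circ> snd) (edge_cut E X)"
    proof (rule tight_cut_sides[OF less.prems(1) A(1) cA k2], goal_cases)
      case (1 X)
      show ?case by (rule 1(1)[OF 1(2-4)])
    qed
    have "edge_cut E (V - A) = edge_cut E (- A)" using g(2) by (auto simp: edge_cut_def)
    then have cX: "card (edge_cut E X) = k" using X(1) cA card_cut_Compl[OF g(3), of A] by auto
    have XV: "X \<subseteq> V" using X(1) A by auto
    interpret tight_cut k V E X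
      by unfold_locales (use less.prems(1) assms(2) XV cX X in auto)
    obtain x' y' where x': "x' \<in> X" "k < card (E `` {x'})" and y': "y' \<in> V - X" "k < card (E `` {y'})"
      using X(1) A x y by auto
    \<comment> \<open>This makes the new graph smaller: if \<open>T\<close> were the whole side,
      \<open>y'\<close> would have at most \<open>k - 1\<close> neighbours in \<open>T\<close> and
      one in \<open>X\<close>.\<close>
    have "T \<noteq> V - X"
    proof
      assume eq: "T = V - X"
      then obtain w where w: "w \<in> X" "(w, y') \<in> edge_cut E X" using y' TE by metis
      have "E `` {y'} \<subseteq> insert w (T - {y'})"
      proof
        fix u assume u: "u \<in> E `` {y'}"
        then have u': "(u, y') \<in> E" "u \<in> V" "u \<noteq> y'" using g(2,3,4) by (auto simp: irrefl_def dest: symD)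
        then have "u \<in> X \<Longrightarrow> (u, y') \<in> edge_cut E X" using y' by (auto simp: edge_cut_def)
        then show "u \<in> insert w (T - {y'})" using u' unique[OF w(2)] eq by auto
      qed
      then have "card (E `` {y'}) \<le> card (insert w (T - {y'}))" using T(2) by (intro card_mono) auto
      also have "\<dots> \<le> Suc (card (T - {y'}))" using T(2) by (simp add: card_insert_if)
      also have "\<dots> \<le> k" using T(1,2) y' eq assms(2) by simp
      finally show False using y' by simp
    qed
    then have "card T < card (V - X)" using T(3) g(1) by (intro psubset_card_mono) auto
    moreover have "X \<inter> T = {}" "finite X" using T(3) XV g(1) finite_subset by auto
    then have "card W = card X + card T" unfolding W_def using T(2) by (intro card_Un_disjoint) auto
    moreover have "card V = card X + card (V - X)" using XV g(1) \<open>finite X\<close>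
      by (metis card_Diff_subset card_mono le_add_diff_inverse)
    ultimately have "card W < card V" by simp
    moreover have "\<not> reducible W F" using reducible_F less.prems(3) by blast
    ultimately obtain v where v: "v \<in> W" "\<And>u. u \<in> W - {v} \<Longrightarrow> (v, u) \<in> F"
      using less.hyps[OF _ critical_F cut_bounded_F[OF less.prems(2)]] by blast
    \<comment> \<open>The cut around \<open>x'\<close> alone has more than \<open>k\<close>
      edges.\<close>
    have "X \<noteq> {x'}" using x' cX card_cut_singleton[OF g(4), of x'] by auto
    then obtain x'' where x'': "x'' \<in> X" "x'' \<noteq> x'" using x' by auto
    have "v \<notin> T"
    proof
      assume vT: "v \<in> T"
      then have "(u, v) \<in> edge_cut E X" if "u \<in> X" for u
      proof -
        have "u \<noteq> v" "u \<notin> T" using that vT T(3) by auto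
        then have "(v, u) \<in> E" using v(2)[of u] that by (auto simp: F_iff W_def)
        then show ?thesis using that vT T(3) g(3) by (auto simp: edge_cut_def dest: symD)
      qed
      then show False using unique x' x'' by metis
    qed
    with v have vX: "v \<in> X" by (auto simp: W_def)
    have only_v: "u = v" if "(u, t) \<in> edge_cut E X" for u t
    proof -
      have "t \<in> T" "t \<noteq> v" using that cutD vX by auto
      then have "(v, t) \<in> E" using v(2)[of t] \<open>v \<notin> T\<close> by (auto simp: F_iff W_def)
      then have "(v, t) \<in> edge_cut E X" using vX \<open>t \<in> T\<close> T(3) by (auto simp: edge_cut_def)
      then show ?thesis using unique that by blast
    qed
    obtain w where w: "w \<in> X - {v}" using x' x'' by auto
    \<comment> \<open>Since \<open>v\<close> is no cut vertex, some cut edge starts in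
      \<open>X\<close> away from \<open>v\<close>.\<close>
    obtain p q where "p \<in> X - {v}" "q \<in> V - {v} - (X - {v})" "(p, q) \<in> E"
      using connected_onD[OF critical_no_cutvertex[OF less.prems(1)], of v "X - {v}" w y'] w y' vX XV by blast
    then have "(p, q) \<in> edge_cut E X" by (auto simp: edge_cut_def)
    then show ?thesis using only_v \<open>p \<in> X - {v}\<close> by blast
  qed
qed

section \<open>Splitting off a Hajos join\<close>


text \<open>The data of \<open>reducible\<close>, fixed in order to undo the join. The sides are
  symmetric, so results for \<open>P\<close> are reused for \<open>Q\<close> through
  \<open>swapped\<close>.\<close>

locale one_edge_split =
  fixes k :: nat and V :: "'a set" and E :: "'a rel" and P Q :: "'a set" and v w1 w2 :: 'a
  assumes crit: "critical k V E" and k3: "3 \<le> k"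
    and PQ: "P \<union> Q = V" "P \<inter> Q = {v}" and w: "w1 \<in> P - {v}" "w2 \<in> Q - {v}"
    and one: "E \<inter> (P - {v}) \<times> (Q - {v}) = {(w1, w2)}"
begin

lemmas g = critical_graph[OF crit]

lemma swapped: "one_edge_split k V E Q P v w2 w1"
  using crit k3 PQ w one g(3) by unfold_locales (auto dest: symD)

lemma sub: "P \<subset> V" "Q \<subset> V" "v \<in> P" "v \<in> Q" "w2 \<notin> P" "w1 \<notin> Q"
  using PQ w by auto

lemma only_v: "x \<in> P \<Longrightarrow> x \<in> Q \<Longrightarrow> x = v"
  using PQ(2) by (metis IntI singletonD)

lemma w1w2: "(w1, w2) \<in> E" using one by auto

lemma crossing: "x \<in> P \<Longrightarrow> y \<in> Q \<Longrightarrow> (x, y) \<in> E \<Longrightarrow> x = v \<or> y = v \<or> (x = w1 \<and> y = w2)"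
  using one by blast

text \<open>Otherwise a colouring of \<open>Q\<close> could be permuted to fit: \<open>v\<close>
  takes its colour from \<open>f\<close>, and \<open>w2\<close> takes one that differs from the
  colour of \<open>w1\<close>.\<close>

lemma ends_agree:
  assumes f: "coloring k E P f" shows "f w1 = f v"
proof (rule ccontr)
  assume ne: "f w1 \<noteq> f v"
  obtain h where h: "coloring k E Q h" using critical_subset_colorable[OF crit sub(2)] by metis
  have lt: "f v < k" "h v < k" "h w2 < k" using f h sub w by (auto simp: coloring_def)
  obtain c where c: "c < k" "c \<noteq> f v" "c \<noteq> f w1"
  proof -
    have "card {f v, f w1} < card {..<k}" using k3 by (simp add: card_insert_if)
    then show thesis using that by (metis card_mono finite.emptyI finite_insert insertCI lessThan_iff not_less subsetI)
  qed
  \<comment> \<open>If \<open>h\<close> identifies \<open>w2\<close> with \<open>v\<close>, the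
    target must be \<open>f v\<close>. If not, it must avoid both \<open>f v\<close> and
    \<open>f w1\<close>, which takes a third colour.\<close>
  define b where "b = (if h w2 = h v then f v else c)"
  have "b < k" "h v = h w2 \<longleftrightarrow> f v = b" using lt c by (auto simp: b_def)
  then obtain \<sigma> where \<sigma>: "\<sigma> permutes {..<k}" "\<sigma> (h v) = f v" "\<sigma> (h w2) = b"
    using permutes_two_points[OF lt(2,3,1)] by metis
  have b: "b \<noteq> f w1" using c ne by (auto simp: b_def)
  have "coloring k E (P \<union> Q) (\<lambda>x. if x \<in> P then f x else (\<sigma> \<circ> h) x)"
  proof (rule coloring_glue[OF f coloring_permutes[OF h \<sigma>(1)] g(3)])
    fix x assume "x \<in> P" "x \<in> Q"
    then have "x = v" by (rule only_v)
    then show "f x = (\<sigma> \<circ> h) x" using \<sigma> by simp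
  next
    fix x y assume xy: "x \<in> P - Q" "y \<in> Q - P" "(x, y) \<in> E"
    then have "x = w1 \<and> y = w2" using crossing[of x y] sub by auto
    then show "f x \<noteq> (\<sigma> \<circ> h) y" using \<sigma> b by simp
  qed
  then show False using criticalD(3)[OF crit] PQ(1) by simp
qed

definition "E1 = E \<inter> P \<times> P \<union> {(v, w1), (w1, v)}"

lemma vw1_notin: "(v, w1) \<notin> E" "(w1, v) \<notin> E"
proof -
  obtain f where f: "coloring k E P f" using critical_subset_colorable[OF crit sub(1)] by metis
  then show "(v, w1) \<notin> E" using ends_agree[OF f] sub(3) w unfolding coloring_def by (metis DiffD1)
  then show "(w1, v) \<notin> E" using g(3) by (meson symD)
qed

lemma ugraph_E1: "ugraph P E1"
  using g sub w finite_subset[of P V] by (auto simp: ugraph_def E1_def sym_def irrefl_def)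

text \<open>The restored edge \<open>v w1\<close> contradicts \<open>ends_agree\<close>, and
  criticality comes from colourings of the whole graph without one edge, restricted to
  \<open>P\<close>.\<close>

lemma critical_left: "critical k P E1"
proof -
  have "\<exists>u. (x, u) \<in> E1" if x: "x \<in> P" for x
  proof (cases "x = v \<or> x = w1")
    case False
    obtain u where u: "(x, u) \<in> E" using criticalD(2)[OF crit, of x] x sub by blast
    then have "u \<in> V" using g(2) by auto
    have "u \<in> P"
    proof (rule ccontr)
      assume "u \<notin> P"
      then have "u \<in> Q" using \<open>u \<in> V\<close> PQ(1) by auto
      then show False using crossing[OF x _ u] False \<open>u \<notin> P\<close> sub by auto
    qed
    then show ?thesis using u x by (auto simp: E1_def)
  qed (auto simp: E1_def)
  moreover have "\<not> coloring k E1 P c" for c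
  proof
    assume c: "coloring k E1 P c"
    then have "coloring k E P c" by (rule coloring_mono) (auto simp: E1_def)
    then have "c w1 = c v" by (rule ends_agree)
    then show False using c w sub(3) by (auto simp: coloring_def E1_def)
  qed
  moreover have "\<exists>c. coloring k (E1 - {(x, y), (y, x)}) P c" if xy: "(x, y) \<in> E1" for x y
  proof (cases "(x, y) = (v, w1) \<or> (x, y) = (w1, v)")
    case True
    obtain f where "coloring k E P f" using critical_subset_colorable[OF crit sub(1)] by metis
    then have "coloring k (E1 - {(x, y), (y, x)}) P f"
      by (rule coloring_mono) (use True in \<open>auto simp: E1_def\<close>)
    then show ?thesis by blast
  next
    case False
    then have xyE: "(x, y) \<in> E" "x \<in> P" "y \<in> P" using xy by (auto simp: E1_def)
    then obtain h where h: "coloring k (E - {(x, y), (y, x)}) V h" using criticalD(4)[OF crit] by blast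
    have "x \<noteq> y" using xyE g(4) by (auto simp: irrefl_def)
    then have "\<not> (x \<in> Q \<and> y \<in> Q)" using xyE only_v by metis
    \<comment> \<open>All edges inside \<open>Q\<close> are still present, so \<open>v\<close> and
      \<open>w2\<close> agree by symmetry. As \<open>w1 w2\<close> is present too, \<open>w1\<close>
      and \<open>v\<close> differ, which suits the restored edge.\<close>
    then have "coloring k E Q h" using h sub by (intro coloring_mono[OF h]) auto
    then have "h w2 = h v" by (rule one_edge_split.ends_agree[OF swapped])
    moreover have "(w1, w2) \<in> E - {(x, y), (y, x)}" using w1w2 xyE sub by auto
    then have "h w1 \<noteq> h w2" using h w sub unfolding coloring_def by blast
    ultimately have "h w1 \<noteq> h v" by simp
    have hE: "h a \<noteq> h b" if "a \<in> P" "b \<in> P" "(a, b) \<in> E - {(x, y), (y, x)}" for a b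
      using h that sub(1) unfolding coloring_def by blast
    have "coloring k (E1 - {(x, y), (y, x)}) P h"
      unfolding coloring_def
    proof (intro conjI ballI impI)
      fix a assume "a \<in> P"
      then show "h a < k" using h sub(1) by (auto simp: coloring_def)
    next
      fix a b assume "a \<in> P" "b \<in> P" "(a, b) \<in> E1 - {(x, y), (y, x)}"
      then show "h a \<noteq> h b" using hE[of a b] \<open>h w1 \<noteq> h v\<close> by (auto simp: E1_def)
    qed
    then show ?thesis by blast
  qed
  ultimately show ?thesis unfolding critical_def using ugraph_E1 by blast
qed

end

context one_edge_split
begin

interpretation R: one_edge_split k V E Q P v w2 w1 by (rule swapped)

text \<open>The added arc \<open>(w1, v)\<close> may belong to the cut. It is paid for by a cut edge
  of \<open>E\<close> not inside \<open>P\<close>: either \<open>w1 w2\<close>, or, if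
  \<open>w2\<close> is in \<open>A\<close> as well, an edge of the other half, whose cut around
  \<open>A \<inter> Q\<close> has at least \<open>k \<ge> 3\<close> edges.\<close>

lemma cut_left:
  assumes "v \<notin> A"
  shows "card (edge_cut E1 (A \<inter> P)) \<le> card (edge_cut E A)"
proof -
  have fin: "finite (edge_cut E A)" by (rule finite_edge_cut[OF g(5)])
  have sub1: "edge_cut E1 (A \<inter> P) - {(w1, v)} \<subseteq> edge_cut E A \<inter> P \<times> P"
    using assms by (auto simp: edge_cut_def E1_def)
  show ?thesis
  proof (cases "w1 \<in> A")
    case False
    then have "edge_cut E1 (A \<inter> P) \<subseteq> edge_cut E A" using sub1 by (auto simp: edge_cut_def)
    then show ?thesis using fin by (rule card_mono[rotated])
  next
    case True
    have "\<exists>e\<in>edge_cut E A. e \<notin> P \<times> P"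
    proof (cases "w2 \<in> A")
      case False
      then show ?thesis using w1w2 True sub by (auto simp: edge_cut_def)
    next
      case True
      have "k \<le> card (edge_cut R.E1 (A \<inter> Q))"
        using critical_separating_cut_ge[OF R.critical_left, of w2 v] True w sub assms by auto
      moreover have "card (edge_cut R.E1 (A \<inter> Q)) \<le> 1" if "edge_cut R.E1 (A \<inter> Q) \<subseteq> {(w2, v)}"
        using card_mono[OF _ that] by simp
      ultimately have "\<not> edge_cut R.E1 (A \<inter> Q) \<subseteq> {(w2, v)}" using k3 by linarith
      then obtain x y where xy: "(x, y) \<in> edge_cut R.E1 (A \<inter> Q)" "(x, y) \<noteq> (w2, v)" by auto
      then have "(x, y) \<in> edge_cut E A" "x \<in> Q" "x \<noteq> v" using assms by (auto simp: edge_cut_def R.E1_def)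
      moreover from this have "x \<notin> P" using only_v by blast
      ultimately show ?thesis by blast
    qed
    then obtain e where e: "e \<in> edge_cut E A" "e \<notin> P \<times> P" by blast
    have "edge_cut E1 (A \<inter> P) \<subseteq> insert (w1, v) (edge_cut E A - {e})" using sub1 e by blast
    then have "card (edge_cut E1 (A \<inter> P)) \<le> card (insert (w1, v) (edge_cut E A - {e}))"
      using fin by (intro card_mono) auto
    also have "\<dots> \<le> Suc (card (edge_cut E A - {e}))" using fin by (simp add: card_insert_if)
    also have "\<dots> = card (edge_cut E A)" using fin e by (metis card_Suc_Diff1)
    finally show ?thesis .
  qed
qed

lemma cut_bounded_left:
  assumes "cut_bounded k V E"
  shows "cut_bounded k P E1"
  unfolding cut_bounded_def
proof (intro ballI impI)
  fix x y assume xy: "x \<in> P" "y \<in> P" "x \<noteq> y"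
  then have "x \<in> V" "y \<in> V" using sub(1) by auto
  then obtain A where A: "x \<in> A" "y \<notin> A" "card (edge_cut E A) \<le> k"
    using assms xy(3) unfolding cut_bounded_def by metis
  show "\<exists>A. x \<in> A \<and> y \<notin> A \<and> card (edge_cut E1 A) \<le> k"
  proof (cases "v \<in> A")
    case False
    then show ?thesis using cut_left[of A] A xy by (intro exI[of _ "A \<inter> P"]) auto
  next
    case True
    \<comment> \<open>The complement avoids \<open>v\<close> and has a cut of the same size.\<close>
    have "card (edge_cut E1 (- A \<inter> P)) \<le> k"
      using cut_left[of "- A"] True A(3) card_cut_Compl[OF g(3), of A] by simp
    then have "card (edge_cut E1 (- (- A \<inter> P))) \<le> k"
      by (simp only: card_cut_Compl[OF ugraphD(3)[OF ugraph_E1]])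
    then show ?thesis using A xy by (intro exI[of _ "- (- A \<inter> P)"]) auto
  qed
qed

end

section \<open>Odd cycles and lower bounds\<close>


lemma digraph_iso_pairI:
  assumes "E \<subseteq> V \<times> V" "inj_on \<phi> V"
  shows "digraph_iso (with_proj \<lparr>pverts = V, parcs = E\<rparr>)
    (with_proj \<lparr>pverts = \<phi> ` V, parcs = map_prod \<phi> \<phi> ` E\<rparr>)"
  unfolding digraph_iso_def
proof (intro exI conjI)
  let ?h = "\<lparr>iso_verts = \<phi>, iso_arcs = map_prod \<phi> \<phi>, iso_head = snd, iso_tail = fst\<rparr>"
  have "inj_on (map_prod \<phi> \<phi>) E"
    using map_prod_inj_on[OF assms(2,2)] assms(1) by (rule inj_on_subset)
  then show "pre_digraph.digraph_isomorphism (with_proj \<lparr>pverts = V, parcs = E\<rparr>) ?h"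
    using assms by (auto simp: pre_digraph.digraph_isomorphism_def wf_digraph_def)
  show "with_proj \<lparr>pverts = \<phi> ` V, parcs = map_prod \<phi> \<phi> ` E\<rparr>
      = app_iso ?h (with_proj \<lparr>pverts = V, parcs = E\<rparr>)"
    by (simp add: app_iso_def with_proj_def)
qed

lemma digraph_iso_pairE:
  assumes "digraph_iso (with_proj G) (with_proj H)"
  obtains \<phi> where "parcs G \<subseteq> pverts G \<times> pverts G" "inj_on \<phi> (pverts G)"
    "pverts H = \<phi> ` pverts G" "parcs H = map_prod \<phi> \<phi> ` parcs G"
proof -
  obtain h where h: "pre_digraph.digraph_isomorphism (with_proj G) h" "with_proj H = app_iso h (with_proj G)"
    using assms unfolding digraph_iso_def by blast
  have p: "iso_tail h = fst" "iso_head h = snd" "pverts H = iso_verts h ` pverts G"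
    "parcs H = iso_arcs h ` parcs G"
    using h(2) by (auto simp: app_iso_def with_proj_def)
  have "iso_arcs h e = map_prod (iso_verts h) (iso_verts h) e" if "e \<in> parcs G" for e
    using h(1) that p(1,2) by (auto simp: pre_digraph.digraph_isomorphism_def prod_eq_iff)
  then have "parcs H = map_prod (iso_verts h) (iso_verts h) ` parcs G" using p(4) by auto
  moreover have "parcs G \<subseteq> pverts G \<times> pverts G" "inj_on (iso_verts h) (pverts G)"
    using h(1) by (auto simp: pre_digraph.digraph_isomorphism_def wf_digraph_def)
  ultimately show thesis using that p(3) by blast
qed

lemma coloring_image:
  assumes "coloring k (map_prod \<phi> \<phi> ` E) (\<phi> ` V) c"
  shows "coloring k E V (c \<circ> \<phi>)"
  using assms unfolding coloring_def by force

lemma ugraph_image: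
  assumes "ugraph V E" "inj_on \<phi> V"
  shows "ugraph (\<phi> ` V) (map_prod \<phi> \<phi> ` E)"
  unfolding ugraph_def
proof (intro conjI)
  note g = ugraphD[OF assms(1)]
  show "finite (\<phi> ` V)" "map_prod \<phi> \<phi> ` E \<subseteq> \<phi> ` V \<times> \<phi> ` V" using g by auto
  show "sym (map_prod \<phi> \<phi> ` E)" using g(3) by (force simp: sym_def)
  show "irrefl (map_prod \<phi> \<phi> ` E)"
    unfolding irrefl_def
  proof (intro allI notI)
    fix a assume "(a, a) \<in> map_prod \<phi> \<phi> ` E"
    then obtain x y where xy: "(x, y) \<in> E" "\<phi> x = \<phi> y" by auto
    then have "x = y" using assms(2) g(2) by (meson inj_onD mem_Sigma_iff subsetD)
    then show False using xy g(4) by (auto simp: irrefl_def)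
  qed
qed

text \<open>Colours alternate along \<open>0, ..., n - 1\<close>; for odd \<open>n\<close> the two
  ends, which are adjacent, agree.\<close>

lemma odd_cycle_not_two_colorable:
  assumes "odd n"
  shows "\<not> coloring 2 (parcs (cycle_graph n)) {..<n} c"
proof
  assume c: "coloring 2 (parcs (cycle_graph n)) {..<n} c"
  have n: "0 < n" using assms by (rule odd_pos)
  have lt: "c i < 2" if "i < n" for i using c that by (auto simp: coloring_def)
  have alt: "i < n \<Longrightarrow> c i = (c 0 + i) mod 2" for i
  proof (induction i)
    case 0
    then show ?case using lt by simp
  next
    case (Suc i)
    have "(i, Suc i) \<in> parcs (cycle_graph n)" using Suc.prems by (auto simp: cycle_graph_def)
    then have "c i \<noteq> c (Suc i)" using c Suc.prems by (auto simp: coloring_def)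
    then show ?case using Suc lt[of "Suc i"] by simp presburger
  qed
  have "(n - 1, 0) \<in> parcs (cycle_graph n)" using n by (auto simp: cycle_graph_def)
  then have "c (n - 1) \<noteq> c 0" using c n by (auto simp: coloring_def)
  moreover obtain m where "n = Suc (2 * m)" using assms by (auto elim!: oddE)
  then have "c (n - 1) = c 0" using alt[of "n - 1"] lt[of 0] by simp
  ultimately show False by simp
qed

lemma relpow_segment:
  assumes "\<And>i. i < l \<Longrightarrow> (f i, f (Suc i)) \<in> R" "i + m \<le> l"
  shows "(f i, f (i + m)) \<in> R ^^ m"
  unfolding relpow_fun_conv using assms by (intro exI[of _ "\<lambda>t. f (i + t)"]) auto

text \<open>Without an edge \<open>a b\<close>, the vertices \<open>a\<close> and \<open>b\<close>
  get equal colours and stay connected, since cuts have at least two edges. A shortest path between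
  them has even length and closes with \<open>a b\<close> to an odd cycle, which by criticality is
  the whole graph.\<close>

theorem two_critical_odd_cycle:
  assumes "critical 2 V E"
  obtains n \<phi> where "3 \<le> n" "odd n" "inj_on \<phi> {..<n}" "V = \<phi> ` {..<n}"
    "E = map_prod \<phi> \<phi> ` parcs (cycle_graph n)"
proof -
  note g = critical_graph[OF assms]
  obtain a where "a \<in> V" using critical_pos[OF assms] by auto
  then obtain b where ab: "(a, b) \<in> E" using criticalD(2)[OF assms] by blast
  define R where "R = E - {(a, b), (b, a)}"
  have V: "a \<in> V" "b \<in> V" "a \<noteq> b" "(b, a) \<in> E" using ab g(2,3,4) by (auto simp: irrefl_def dest: symD)
  obtain h where h: "coloring 2 R V h" using criticalD(4)[OF assms ab] by (auto simp: R_def)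
  have hab: "h a = h b"
  proof (rule ccontr)
    assume "h a \<noteq> h b"
    moreover have "h u \<noteq> h v" if "u \<in> V" "v \<in> V" "(u, v) \<in> R" for u v
      using h that unfolding coloring_def by blast
    ultimately have "h u \<noteq> h v" if "u \<in> V" "v \<in> V" "(u, v) \<in> E" for u v
      using that by (cases "(u, v) \<in> R") (auto simp: R_def)
    then have "coloring 2 E V h" using h by (simp add: coloring_def)
    then show False using criticalD(3)[OF assms] by blast
  qed
  have "(a, b) \<in> R\<^sup>*"
  proof (rule ccontr)
    assume nab: "(a, b) \<notin> R\<^sup>*"
    have "edge_cut E {x. (a, x) \<in> R\<^sup>*} \<subseteq> {(a, b)}"
    proof (rule subrelI)
      fix x y assume xy: "(x, y) \<in> edge_cut E {x. (a, x) \<in> R\<^sup>*}"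
      then have "(a, x) \<in> R\<^sup>*" "(a, y) \<notin> R\<^sup>*" "(x, y) \<in> E" by (auto simp: edge_cut_def)
      moreover from this have "(x, y) \<notin> R" by (meson rtrancl.rtrancl_into_rtrancl)
      ultimately show "(x, y) \<in> {(a, b)}" by (auto simp: R_def)
    qed
    then have "card (edge_cut E {x. (a, x) \<in> R\<^sup>*}) \<le> card {(a, b)}" by (intro card_mono) auto
    then show False using critical_separating_cut_ge[OF assms V(1,2), of "{x. (a, x) \<in> R\<^sup>*}"] nab by simp
  qed
  define l where "l = (LEAST l. (a, b) \<in> R ^^ l)"
  have "(a, b) \<in> R ^^ l" unfolding l_def using \<open>(a, b) \<in> R\<^sup>*\<close> rtrancl_imp_relpow LeastI_ex by metis
  then obtain f where f: "f 0 = a" "f l = b" "\<And>i. i < l \<Longrightarrow> (f i, f (Suc i)) \<in> R"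
    unfolding relpow_fun_conv by blast
  have least: "l \<le> m" if "(a, b) \<in> R ^^ m" for m unfolding l_def using that by (rule Least_le)
  have RE: "R \<subseteq> E" "sym R" using g(3) by (auto simp: R_def sym_def)
  have fV: "f i \<in> V" if "i \<le> l" for i
  proof (cases i)
    case (Suc j)
    then have "(f j, f i) \<in> E" using f(3)[of j] that RE by auto
    then show ?thesis using g(2) by auto
  qed (use f V in simp)
  \<comment> \<open>A repeated vertex would give a shortcut.\<close>
  have inj_less: "f i \<noteq> f j" if "i < j" "j \<le> l" for i j
  proof
    assume eq: "f i = f j"
    have "(f 0, f (0 + i)) \<in> R ^^ i"
      by (rule relpow_segment[of l]) (use f(3) that in auto)
    moreover have "(f j, f (j + (l - j))) \<in> R ^^ (l - j)"
      by (rule relpow_segment[of l]) (use f(3) that in auto)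
    ultimately have "(a, f i) \<in> R ^^ i" "(f i, b) \<in> R ^^ (l - j)" using f(1,2) eq that by auto
    then have "(a, b) \<in> R ^^ (i + (l - j))" unfolding relpow_add by blast
    then show False using least that by fastforce
  qed
  have inj: "inj_on f {..<Suc l}"
    by (rule linorder_inj_onI) (use inj_less in auto)
  have alt: "i \<le> l \<Longrightarrow> h (f i) = (h a + i) mod 2" for i
  proof (induction i)
    case 0
    then show ?case using h f V by (auto simp: coloring_def)
  next
    case (Suc i)
    have "h (f i) \<noteq> h (f (Suc i))" "h (f (Suc i)) < 2"
      using h f(3)[of i] fV[of i] fV[of "Suc i"] Suc.prems by (auto simp: coloring_def)
    then show ?case using Suc by simp presburger
  qed
  have "even l" using alt[of l] hab f h V by (simp add: coloring_def) presburger
  moreover have "l \<noteq> 0" using f(1,2) V(3) by metis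
  ultimately have l: "odd (Suc l)" "3 \<le> Suc l" by (auto elim!: evenE)
  define C where "C = map_prod f f ` parcs (cycle_graph (Suc l))"
  have step: "(f i, f (Suc i mod Suc l)) \<in> E" if "i < Suc l" for i
  proof (cases "i = l")
    case True
    then show ?thesis using f V by simp
  next
    case False
    then show ?thesis using f(3)[of i] that RE by auto
  qed
  have CE: "C \<subseteq> E"
  proof
    fix e assume "e \<in> C"
    then obtain i j where ij: "e = (f i, f j)" "i < Suc l" "j < Suc l" "j = Suc i mod Suc l \<or> i = Suc j mod Suc l"
      by (auto simp: C_def cycle_graph_def)
    then show "e \<in> E" using step[of i] step[of j] g(3) by (auto dest: symD)
  qed
  have symC: "(y, x) \<in> C" if "(x, y) \<in> C" for x y
    using that by (force simp: C_def cycle_graph_def)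
  have sub: "f ` {..<Suc l} \<subseteq> V" using fV by auto
  have nC: "\<not> coloring 2 C (f ` {..<Suc l}) c" for c
    using coloring_image odd_cycle_not_two_colorable[OF l(1)] unfolding C_def by blast
  have EC: "E = C"
  proof (rule ccontr)
    assume "E \<noteq> C"
    then obtain x y where xy: "(x, y) \<in> E" "(x, y) \<notin> C" using CE by auto
    then obtain c where c: "coloring 2 (E - {(x, y), (y, x)}) V c" using criticalD(4)[OF assms] by blast
    have "coloring 2 C (f ` {..<Suc l}) c"
      by (rule coloring_mono[OF c sub]) (use CE xy symC in blast)
    then show False using nC by blast
  qed
  have "V \<subseteq> f ` {..<Suc l}"
  proof
    fix x assume "x \<in> V"
    then obtain y where "(x, y) \<in> C" using criticalD(2)[OF assms] EC by blast
    then show "x \<in> f ` {..<Suc l}" by (auto simp: C_def cycle_graph_def)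
  qed
  then have "V = f ` {..<Suc l}" using sub by blast
  then show thesis using that[OF l(2,1) inj] EC by (simp add: C_def)
qed

section \<open>Graphs of the Hajos classes are not \<open>k\<close>-colourable\<close>

lemma ugraph_cycle_graph:
  assumes "3 \<le> n" shows "ugraph (pverts (cycle_graph n)) (parcs (cycle_graph n))"
proof -
  have "i \<noteq> Suc i mod n" if "i < n" for i
    using that assms by (cases "Suc i = n") auto
  then show ?thesis by (auto simp: ugraph_def cycle_graph_def sym_def irrefl_def)
qed

lemma ugraph_wheel_graph:
  assumes "3 \<le> n" shows "ugraph (pverts (wheel_graph n)) (parcs (wheel_graph n))"
proof -
  have V: "pverts (cycle_graph n) = {..<n}" by (simp add: cycle_graph_def)
  note g = ugraphD[OF ugraph_cycle_graph[OF assms], unfolded V]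
  show ?thesis unfolding ugraph_def
  proof (intro conjI)
    show "finite (pverts (wheel_graph n))" by (simp add: wheel_graph_def V)
    show "parcs (wheel_graph n) \<subseteq> pverts (wheel_graph n) \<times> pverts (wheel_graph n)"
      using g(2) by (auto simp: wheel_graph_def V)
    show "sym (parcs (wheel_graph n))"
      using g(3) by (auto simp: wheel_graph_def sym_def)
    show "irrefl (parcs (wheel_graph n))"
      using g(4) by (auto simp: wheel_graph_def irrefl_def)
  qed
qed

lemma coloring_remove_hub:
  assumes "coloring (Suc k) E V c" "v \<in> V" "\<And>u. u \<in> V - {v} \<Longrightarrow> (v, u) \<in> E"
  shows "\<exists>c. coloring k E (V - {v}) c"
proof -
  have "c v < Suc k" using assms by (auto simp: coloring_def)
  then obtain \<sigma> where \<sigma>: "\<sigma> permutes {..<Suc k}" "\<sigma> (c v) = k"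
    using permutes_two_points[of "c v" "Suc k" "c v" k k] by auto
  have d: "coloring (Suc k) E V (\<sigma> \<circ> c)" by (rule coloring_permutes[OF assms(1) \<sigma>(1)])
  have "(\<sigma> \<circ> c) u < k" if "u \<in> V - {v}" for u
  proof -
    have "(\<sigma> \<circ> c) u < Suc k" "(\<sigma> \<circ> c) v \<noteq> (\<sigma> \<circ> c) u"
      using d assms(2) assms(3)[OF that] that unfolding coloring_def by blast+
    then show ?thesis using \<sigma>(2) by simp
  qed
  then have "coloring k E (V - {v}) (\<sigma> \<circ> c)" using d by (simp add: coloring_def)
  then show ?thesis by blast
qed

lemma odd_wheel_not_three_colorable:
  assumes "odd n"
  shows "\<not> coloring 3 (parcs (wheel_graph n)) (pverts (wheel_graph n)) c"
proof
  assume "coloring 3 (parcs (wheel_graph n)) (pverts (wheel_graph n)) c"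
  then have "\<exists>c. coloring 2 (parcs (wheel_graph n)) (pverts (wheel_graph n) - {n}) c"
    by (intro coloring_remove_hub[of 2]) (auto simp: wheel_graph_def cycle_graph_def numeral_3_eq_3)
  then obtain d where d: "coloring 2 (parcs (wheel_graph n)) (pverts (wheel_graph n) - {n}) d" by blast
  have "coloring 2 (parcs (cycle_graph n)) {..<n} d"
    by (rule coloring_mono[OF d]) (auto simp: wheel_graph_def cycle_graph_def)
  then show False using odd_cycle_not_two_colorable[OF assms] by blast
qed

lemma complete_not_colorable:
  assumes "finite V" "E = {(u, v). (u, v) \<in> V \<times> V \<and> u \<noteq> v}" "card V = k + 1"
  shows "\<not> coloring k E V c"
proof
  assume c: "coloring k E V c"
  then have "inj_on c V" using assms(2) by (auto simp: coloring_def intro!: inj_onI)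
  moreover have "c ` V \<subseteq> {..<k}" using c by (auto simp: coloring_def)
  ultimately have "card V \<le> card {..<k}" by (metis card_inj_on_le finite_lessThan)
  then show False using assms by simp
qed

lemma ugraph_complete:
  assumes "finite V" "E = {(u, v). (u, v) \<in> V \<times> V \<and> u \<noteq> v}"
  shows "ugraph V E"
  using assms by (auto simp: ugraph_def sym_def irrefl_def)

text \<open>A colouring of the join that separates \<open>v1\<close> and \<open>w1\<close> would
  colour \<open>G1\<close>. Otherwise the edge \<open>w1 w2\<close> separates \<open>w2\<close> from
  their common colour, and pulling back along the identification \<open>f\<close> would colour
  \<open>G2\<close>.\<close>

lemma hajos_join_not_colorable:
  assumes G1: "ugraph (pverts G1) (parcs G1)" "\<nexists>c. coloring k (parcs G1) (pverts G1) c"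
    and G2: "ugraph (pverts G2) (parcs G2)" "\<nexists>c. coloring k (parcs G2) (pverts G2) c"
    and disj: "pverts G1 \<inter> pverts G2 = {}"
    and arcs: "(v1, w1) \<in> parcs G1" "(v2, w2) \<in> parcs G2"
  defines "G \<equiv> hajos_join G1 v1 w1 G2 v2 w2"
  shows "ugraph (pverts G) (parcs G)" "\<nexists>c. coloring k (parcs G) (pverts G) c"
proof -
  note g1 = ugraphD[OF G1(1)] note g2 = ugraphD[OF G2(1)]
  define f where "f = (\<lambda>x. if x = v2 then v1 else x)"
  have V: "pverts G = pverts G1 \<union> f ` pverts G2"
    and E: "parcs G = (parcs G1 - {(v1, w1), (w1, v1)}) \<union>
      map_prod f f ` (parcs G2 - {(v2, w2), (w2, v2)}) \<union> {(w1, w2), (w2, w1)}"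
    by (simp_all add: G_def hajos_join_def f_def Let_def)
  have in1: "v1 \<in> pverts G1" "w1 \<in> pverts G1" "v1 \<noteq> w1" "(w1, v1) \<in> parcs G1"
    using arcs g1 by (auto simp: irrefl_def dest: symD)
  have in2: "v2 \<in> pverts G2" "w2 \<in> pverts G2" "v2 \<noteq> w2" "(w2, v2) \<in> parcs G2"
    using arcs g2 by (auto simp: irrefl_def dest: symD)
  have notin: "v1 \<notin> pverts G2" "w1 \<notin> pverts G2" "w1 \<noteq> w2" "f w2 = w2" "f v2 = v1"
    using in1 in2 disj by (auto simp: f_def)
  have inj: "inj_on f (pverts G2)" using notin by (auto simp: f_def inj_on_def)
  have u1: "ugraph (pverts G1) (parcs G1 - {(v1, w1), (w1, v1)})"
    using g1 by (auto simp: ugraph_def sym_def irrefl_def)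
  have "ugraph (pverts G2) (parcs G2 - {(v2, w2), (w2, v2)})"
    using g2 by (auto simp: ugraph_def sym_def irrefl_def)
  then have u2: "ugraph (f ` pverts G2) (map_prod f f ` (parcs G2 - {(v2, w2), (w2, v2)}))"
    using inj by (rule ugraph_image)
  have w2f: "w2 \<in> f ` pverts G2" using in2 notin by (metis imageI)
  show "ugraph (pverts G) (parcs G)"
    unfolding ugraph_def
  proof (intro conjI)
    show "finite (pverts G)" using g1 g2 by (simp add: V)
    show "parcs G \<subseteq> pverts G \<times> pverts G"
      using ugraphD(2)[OF u1] ugraphD(2)[OF u2] in1 w2f unfolding V E by blast
    show "sym (parcs G)" unfolding E using ugraphD(3)[OF u1] ugraphD(3)[OF u2]
      by (intro sym_Un) (auto simp: sym_def)
    show "irrefl (parcs G)" unfolding E using ugraphD(4)[OF u1] ugraphD(4)[OF u2] notin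
      by (auto simp: irrefl_def)
  qed
  show "\<nexists>c. coloring k (parcs G) (pverts G) c"
  proof
    assume "\<exists>c. coloring k (parcs G) (pverts G) c"
    then obtain c where c: "coloring k (parcs G) (pverts G) c" by blast
    have lt: "c u < k" if "u \<in> pverts G" for u using c that by (auto simp: coloring_def)
    have ne: "c u \<noteq> c v" if "u \<in> pverts G" "v \<in> pverts G" "(u, v) \<in> parcs G" for u v
      using c that by (auto simp: coloring_def)
    show False
    proof (cases "c v1 = c w1")
      case False
      have "coloring k (parcs G1) (pverts G1) c"
        unfolding coloring_def
      proof (intro conjI ballI impI)
        fix u assume "u \<in> pverts G1"
        then show "c u < k" using lt by (simp add: V)
      next
        fix u v assume uv: "u \<in> pverts G1" "v \<in> pverts G1" "(u, v) \<in> parcs G1"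
        then have "(u, v) \<in> parcs G \<or> (u, v) = (v1, w1) \<or> (u, v) = (w1, v1)" by (auto simp: E)
        then show "c u \<noteq> c v" using ne[of u v] uv False by (auto simp: V)
      qed
      then show False using G1(2) by blast
    next
      case True
      have "c w1 \<noteq> c w2" using ne[of w1 w2] in1 w2f by (simp add: V E)
      then have v1w2: "c v1 \<noteq> c w2" using True by simp
      have "coloring k (parcs G2) (pverts G2) (c \<circ> f)"
        unfolding coloring_def
      proof (intro conjI ballI impI)
        fix u assume "u \<in> pverts G2"
        then show "(c \<circ> f) u < k" using lt by (simp add: V)
      next
        fix u v assume uv: "u \<in> pverts G2" "v \<in> pverts G2" "(u, v) \<in> parcs G2"
        then have "(f u, f v) \<in> parcs G \<or> (u, v) = (v2, w2) \<or> (u, v) = (w2, v2)"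
          unfolding E by (auto simp: rev_image_eqI[of "(u, v)"])
        then show "(c \<circ> f) u \<noteq> (c \<circ> f) v" using ne[of "f u" "f v"] uv v1w2 notin(4,5) by (auto simp: V)
      qed
      then show False using G2(2) by blast
    qed
  qed
qed

lemma hajos_closure_not_colorable:
  assumes "hajos_closure B G"
    and "\<And>H. B H \<Longrightarrow> ugraph (pverts H) (parcs H) \<and> (\<nexists>c. coloring k (parcs H) (pverts H) c)"
  shows "ugraph (pverts G) (parcs G) \<and> (\<nexists>c. coloring k (parcs G) (pverts G) c)"
  using assms(1)
proof induction
  case (base G)
  then show ?case using assms(2) by blast
next
  case (iso G H)
  obtain \<phi> where \<phi>: "inj_on \<phi> (pverts G)" "pverts H = \<phi> ` pverts G" "parcs H = map_prod \<phi> \<phi> ` parcs G"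
    using iso.hyps(2) by (rule digraph_iso_pairE)
  then show ?case using iso.IH ugraph_image coloring_image by metis
next
  case (join G1 G2 v1 w1 v2 w2)
  then show ?case using hajos_join_not_colorable[of G1 k G2 v1 w1 v2 w2] by blast
qed

lemma hajos_class_not_colorable:
  assumes "hajos_class k G"
  shows "\<nexists>c. coloring k (parcs G) (pverts G) c"
proof -
  obtain H where H: "hajos_class_nat k H" "digraph_iso (with_proj H) (with_proj G)"
    using assms unfolding hajos_class_def by blast
  obtain \<phi> where \<phi>: "pverts G = \<phi> ` pverts H" "parcs G = map_prod \<phi> \<phi> ` parcs H"
    using H(2) by (rule digraph_iso_pairE)
  have complete: "ugraph (pverts H) (parcs H) \<and> (\<nexists>c. coloring k (parcs H) (pverts H) c)"
    if "complete_digraph (k + 1) (with_proj H)" for H :: "nat pair_pre_digraph"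
  proof -
    have p: "finite (pverts H)" "card (pverts H) = k + 1"
      "parcs H = {(u, v). (u, v) \<in> pverts H \<times> pverts H \<and> u \<noteq> v}"
      using that unfolding complete_digraph_pair_def by blast+
    show ?thesis using ugraph_complete[OF p(1,3)] complete_not_colorable[OF p(1,3,2)] by blast
  qed
  consider "k \<le> 1" | "k = 2" | "k = 3" | "4 \<le> k" by linarith
  then have "\<nexists>c. coloring k (parcs H) (pverts H) c"
  proof cases
    case 1
    then show ?thesis using H(1) complete by (simp add: hajos_class_nat_def)
  next
    case 2
    then obtain n where n: "odd n" "digraph_iso (with_proj (cycle_graph n)) (with_proj H)"
      using H(1) by (auto simp: hajos_class_nat_def)
    obtain \<psi> where \<psi>: "pverts H = \<psi> ` pverts (cycle_graph n)" "parcs H = map_prod \<psi> \<psi> ` parcs (cycle_graph n)"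
      using n(2) by (rule digraph_iso_pairE)
    have "pverts (cycle_graph n) = {..<n}" by (simp add: cycle_graph_def)
    then show ?thesis using \<psi> coloring_image odd_cycle_not_two_colorable[OF n(1)] 2 by metis
  next
    case 3
    then have "hajos_closure (\<lambda>H. \<exists>n\<ge>3. odd n \<and> H = wheel_graph n) H"
      using H(1) by (simp add: hajos_class_nat_def)
    from hajos_closure_not_colorable[OF this, of 3] show ?thesis
      using 3 ugraph_wheel_graph odd_wheel_not_three_colorable by blast
  next
    case 4
    then have "hajos_closure (\<lambda>H. complete_digraph (k + 1) (with_proj H)) H"
      using H(1) by (simp add: hajos_class_nat_def)
    from hajos_closure_not_colorable[OF this] show ?thesis using complete by blast
  qed
  then show ?thesis using \<phi> coloring_image by metis
qed

section \<open>Membership in the Hajos classes\<close>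


lemma coloringD:
  assumes "coloring k E A c" "u \<in> A"
  shows "c u < k" "v \<in> A \<Longrightarrow> (u, v) \<in> E \<Longrightarrow> c u \<noteq> c v"
  using assms by (simp_all add: coloring_def)

lemma coloring_image_inv:
  assumes "coloring k E V c" "inj_on \<phi> V"
  shows "coloring k (map_prod \<phi> \<phi> ` (E \<inter> V \<times> V)) (\<phi> ` V) (c \<circ> inv_into V \<phi>)"
  unfolding coloring_def
proof (intro conjI ballI impI)
  fix u assume "u \<in> \<phi> ` V"
  then show "(c \<circ> inv_into V \<phi>) u < k" using assms by (auto simp: coloring_def inv_into_f_f)
next
  fix u v assume "(u, v) \<in> map_prod \<phi> \<phi> ` (E \<inter> V \<times> V)"
  then obtain a b where ab: "(a, b) \<in> E" "a \<in> V" "b \<in> V" "u = \<phi> a" "v = \<phi> b" by auto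
  then have "c a \<noteq> c b" using assms(1) unfolding coloring_def by blast
  then show "(c \<circ> inv_into V \<phi>) u \<noteq> (c \<circ> inv_into V \<phi>) v"
    using ab assms(2) by (simp add: inv_into_f_f)
qed

text \<open>The classes are generated over \<open>nat\<close>, so criticality has to move along an
  injection of \<open>V\<close> into \<open>nat\<close>.\<close>

lemma critical_image:
  assumes "critical k V E" "inj_on \<phi> V"
  shows "critical k (\<phi> ` V) (map_prod \<phi> \<phi> ` E)"
  unfolding critical_def
proof (intro conjI ballI allI impI)
  note g = critical_graph[OF assms(1)]
  show "ugraph (\<phi> ` V) (map_prod \<phi> \<phi> ` E)"
    by (rule ugraph_image[OF criticalD(1)[OF assms(1)] assms(2)])
  show "\<exists>u. (v, u) \<in> map_prod \<phi> \<phi> ` E" if "v \<in> \<phi> ` V" for v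
    using that criticalD(2)[OF assms(1)] by fastforce
  show "\<nexists>c. coloring k (map_prod \<phi> \<phi> ` E) (\<phi> ` V) c"
    using coloring_image criticalD(3)[OF assms(1)] by blast
  fix x y assume "(x, y) \<in> map_prod \<phi> \<phi> ` E"
  then obtain p q where pq: "(p, q) \<in> E" "x = \<phi> p" "y = \<phi> q" by auto
  then obtain c where "coloring k (E - {(p, q), (q, p)}) V c" using criticalD(4)[OF assms(1)] by blast
  from coloring_image_inv[OF this assms(2)]
  have "coloring k (map_prod \<phi> \<phi> ` E - {(x, y), (y, x)}) (\<phi> ` V) (c \<circ> inv_into V \<phi>)"
  proof (rule coloring_mono[OF _ subset_refl], intro subsetI)
    fix e assume "e \<in> (map_prod \<phi> \<phi> ` E - {(x, y), (y, x)}) \<inter> \<phi> ` V \<times> \<phi> ` V"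
    then have e: "e \<in> map_prod \<phi> \<phi> ` E" "e \<noteq> (x, y)" "e \<noteq> (y, x)" by blast+
    then obtain a b where ab: "(a, b) \<in> E" "e = (\<phi> a, \<phi> b)" by auto
    then have "(a, b) \<in> (E - {(p, q), (q, p)}) \<inter> V \<times> V" using e(2,3) pq(2,3) g(2) by auto
    then show "e \<in> map_prod \<phi> \<phi> ` ((E - {(p, q), (q, p)}) \<inter> V \<times> V)" using ab(2) by force
  qed
  then show "\<exists>c. coloring k (map_prod \<phi> \<phi> ` E - {(x, y), (y, x)}) (\<phi> ` V) c" by blast
qed

lemma cut_bounded_image:
  assumes "cut_bounded k V E" "inj_on \<phi> V" "E \<subseteq> V \<times> V" "finite E"
  shows "cut_bounded k (\<phi> ` V) (map_prod \<phi> \<phi> ` E)"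
  unfolding cut_bounded_def
proof (intro ballI impI)
  fix x y assume "x \<in> \<phi> ` V" "y \<in> \<phi> ` V" "x \<noteq> y"
  then obtain p q where pq: "p \<in> V" "q \<in> V" "p \<noteq> q" "x = \<phi> p" "y = \<phi> q" by auto
  then obtain A where A: "p \<in> A" "q \<notin> A" "card (edge_cut E A) \<le> k"
    using assms(1) unfolding cut_bounded_def by metis
  have mem: "\<phi> z \<in> \<phi> ` (A \<inter> V) \<longleftrightarrow> z \<in> A" if "z \<in> V" for z
    using inj_on_image_mem_iff[OF assms(2) that, of "A \<inter> V"] that by simp
  have "edge_cut (map_prod \<phi> \<phi> ` E) (\<phi> ` (A \<inter> V)) \<subseteq> map_prod \<phi> \<phi> ` edge_cut E A"
  proof
    fix e assume "e \<in> edge_cut (map_prod \<phi> \<phi> ` E) (\<phi> ` (A \<inter> V))"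
    then have e: "e \<in> map_prod \<phi> \<phi> ` E" "fst e \<in> \<phi> ` (A \<inter> V)" "snd e \<notin> \<phi> ` (A \<inter> V)"
      unfolding edge_cut_def by (simp_all add: mem_Times_iff)
    then obtain a b where ab: "(a, b) \<in> E" "e = (\<phi> a, \<phi> b)" by auto
    with e(2,3) have "\<phi> a \<in> \<phi> ` (A \<inter> V)" "\<phi> b \<notin> \<phi> ` (A \<inter> V)" by simp_all
    with ab(1) have "(a, b) \<in> edge_cut E A" using mem[of a] mem[of b] assms(3) by (auto simp: edge_cut_def)
    then show "e \<in> map_prod \<phi> \<phi> ` edge_cut E A" using ab by force
  qed
  then have "card (edge_cut (map_prod \<phi> \<phi> ` E) (\<phi> ` (A \<inter> V))) \<le> card (map_prod \<phi> \<phi> ` edge_cut E A)"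
    using finite_edge_cut[OF assms(4)] by (intro card_mono) auto
  also have "\<dots> \<le> k" using card_image_le[OF finite_edge_cut[OF assms(4)]] A(3) le_trans by blast
  finally have "card (edge_cut (map_prod \<phi> \<phi> ` E) (\<phi> ` (A \<inter> V))) \<le> k" .
  moreover have "x \<in> \<phi> ` (A \<inter> V)" "y \<notin> \<phi> ` (A \<inter> V)"
    using mem[OF pq(1)] mem[OF pq(2)] A(1,2) pq(4,5) by simp_all
  ultimately show "\<exists>A. x \<in> A \<and> y \<notin> A \<and> card (edge_cut (map_prod \<phi> \<phi> ` E) A) \<le> k"
    by (intro exI[of _ "\<phi> ` (A \<inter> V)"] conjI)
qed

text \<open>Without its hub the graph is critical for two colours, hence an odd cycle; the hub is
  numbered \<open>n\<close>, as in \<open>wheel_graph\<close>.\<close>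

lemma hub_odd_wheel:
  fixes V :: "'a set"
  assumes "critical 3 V E" "v \<in> V" "\<And>u. u \<in> V - {v} \<Longrightarrow> (v, u) \<in> E"
  obtains n where "3 \<le> n" "odd n" "digraph_iso (with_proj (wheel_graph n)) (with_proj \<lparr>pverts = V, parcs = E\<rparr>)"
proof -
  note g = critical_graph[OF assms(1)]
  let ?W = "V - {v}"
  have "critical 2 ?W (E \<inter> ?W \<times> ?W)" using critical_remove_hub[OF assms(1) _ assms(2,3)] by simp
  then obtain n \<phi> where n: "3 \<le> n" "odd n" "inj_on \<phi> {..<n}" "?W = \<phi> ` {..<n}"
    "E \<inter> ?W \<times> ?W = map_prod \<phi> \<phi> ` parcs (cycle_graph n)"
    by (rule two_critical_odd_cycle)
  define \<psi> where "\<psi> = \<phi>(n := v)"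
  have \<psi>W: "\<psi> ` {..<n} = ?W" using n(4) by (auto simp: \<psi>_def)
  have inj: "inj_on \<psi> (insert n {..<n})"
  proof -
    have "inj_on \<psi> {..<n}" using n(3) by (auto simp: \<psi>_def inj_on_def)
    moreover have "\<psi> n \<notin> \<psi> ` {..<n}" unfolding \<psi>W by (simp add: \<psi>_def)
    ultimately show ?thesis by simp
  qed
  have "\<psi> ` insert n {..<n} = V" using \<psi>W assms(2) by (auto simp: \<psi>_def)
  moreover have "map_prod \<psi> \<psi> ` parcs (wheel_graph n) = E"
  proof -
    have "map_prod \<psi> \<psi> ` parcs (cycle_graph n) = map_prod \<phi> \<phi> ` parcs (cycle_graph n)"
    proof (rule image_cong[OF refl])
      fix e assume "e \<in> parcs (cycle_graph n)"
      then obtain i j where "e = (i, j)" "i < n" "j < n" unfolding cycle_graph_def by force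
      then show "map_prod \<psi> \<psi> e = map_prod \<phi> \<phi> e" by (simp add: \<psi>_def)
    qed
    moreover have "\<psi> ` {n} = {v}" by (simp add: \<psi>_def)
    then have "map_prod \<psi> \<psi> ` ({..<n} \<times> {n}) = ?W \<times> {v}" "map_prod \<psi> \<psi> ` ({n} \<times> {..<n}) = {v} \<times> ?W"
      using \<psi>W by (metis map_prod_surj_on)+
    ultimately have "map_prod \<psi> \<psi> ` parcs (wheel_graph n) = E \<inter> ?W \<times> ?W \<union> ?W \<times> {v} \<union> {v} \<times> ?W"
      using n(5) by (simp add: wheel_graph_def image_Un)
    also have "\<dots> = E"
    proof (intro set_eqI)
      fix e :: "'a \<times> 'a"
      obtain a b where e: "e = (a, b)" by (cases e)
      have "a \<in> ?W \<Longrightarrow> (v, a) \<in> E \<and> (a, v) \<in> E" "b \<in> ?W \<Longrightarrow> (v, b) \<in> E"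
        using assms(3) g(3) by (auto dest: symD)
      moreover have "(a, b) \<in> E \<Longrightarrow> a \<in> V \<and> b \<in> V \<and> a \<noteq> b" using g(2,4) by (auto simp: irrefl_def)
      ultimately show "e \<in> E \<inter> ?W \<times> ?W \<union> ?W \<times> {v} \<union> {v} \<times> ?W \<longleftrightarrow> e \<in> E" unfolding e by auto
    qed
    finally show ?thesis .
  qed
  moreover have "wheel_graph n = \<lparr>pverts = insert n {..<n}, parcs = parcs (wheel_graph n)\<rparr>"
    by (simp add: wheel_graph_def cycle_graph_def)
  moreover have "parcs (wheel_graph n) \<subseteq> insert n {..<n} \<times> insert n {..<n}"
    using ugraphD(2)[OF ugraph_wheel_graph[OF n(1)]] by (simp add: wheel_graph_def cycle_graph_def)
  ultimately have "digraph_iso (with_proj (wheel_graph n)) (with_proj \<lparr>pverts = V, parcs = E\<rparr>)"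
    using digraph_iso_pairI[OF _ inj, of "parcs (wheel_graph n)"] by simp
  then show thesis using that n by blast
qed

context one_edge_split
begin

interpretation R: one_edge_split k V E Q P v w2 w1 by (rule swapped)

text \<open>Both halves contain \<open>v\<close>, while a join asks for disjoint graphs. Hence
  \<open>v\<close> is renamed to a fresh \<open>n\<close> in the right half, and the join identifies
  \<open>n\<close> with \<open>v\<close> again.\<close>

lemma hajos_join_split:
  assumes "n \<notin> V"
  defines "\<rho> \<equiv> id(v := n)"
  shows "hajos_join \<lparr>pverts = P, parcs = E1\<rparr> v w1
      \<lparr>pverts = \<rho> ` Q, parcs = map_prod \<rho> \<rho> ` R.E1\<rparr> n w2 = \<lparr>pverts = V, parcs = E\<rparr>"
    "inj_on \<rho> Q" "P \<inter> \<rho> ` Q = {}" "(n, w2) \<in> map_prod \<rho> \<rho> ` R.E1"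
proof -
  have nPQ: "n \<notin> P" "n \<notin> Q" using assms sub by auto
  show "inj_on \<rho> Q" using nPQ by (auto simp: \<rho>_def inj_on_def)
  show "P \<inter> \<rho> ` Q = {}" using nPQ only_v by (auto simp: \<rho>_def)
  have w2: "w2 \<noteq> v" "w2 \<in> Q" using w by auto
  have "\<rho> v = n" "\<rho> w2 = w2" using w2 by (simp_all add: \<rho>_def)
  moreover have "(v, w2) \<in> R.E1" by (simp add: R.E1_def)
  ultimately show "(n, w2) \<in> map_prod \<rho> \<rho> ` R.E1" by (metis map_prod_imageI)
  define f where "f = (\<lambda>x. if x = n then v else x)"
  have f\<rho>: "f (\<rho> x) = x" if "x \<in> Q" for x using that nPQ by (auto simp: f_def \<rho>_def)
  have E2Q: "R.E1 \<subseteq> Q \<times> Q" using ugraphD(2)[OF R.ugraph_E1] .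
  have "map_prod \<rho> \<rho> ` R.E1 - {(n, w2), (w2, n)} = map_prod \<rho> \<rho> ` (E \<inter> Q \<times> Q)"
  proof -
    have "map_prod \<rho> \<rho> ` R.E1 = map_prod \<rho> \<rho> ` (E \<inter> Q \<times> Q) \<union> {(n, w2), (w2, n)}"
      unfolding R.E1_def image_Un using w2 by (simp add: \<rho>_def)
    moreover have "(n, w2) \<notin> map_prod \<rho> \<rho> ` (E \<inter> Q \<times> Q)" "(w2, n) \<notin> map_prod \<rho> \<rho> ` (E \<inter> Q \<times> Q)"
      using R.vw1_notin nPQ w2 by (auto simp: \<rho>_def split: if_splits)
    ultimately show ?thesis by auto
  qed
  moreover have "map_prod f f ` map_prod \<rho> \<rho> ` (E \<inter> Q \<times> Q) = E \<inter> Q \<times> Q"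
  proof -
    have "map_prod f f (map_prod \<rho> \<rho> e) = e" if "e \<in> E \<inter> Q \<times> Q" for e
      using that f\<rho> by auto
    then show ?thesis by (simp add: image_image)
  qed
  moreover have "f ` \<rho> ` Q = Q" using f\<rho> by (simp add: image_image)
  moreover have "E1 - {(v, w1), (w1, v)} = E \<inter> P \<times> P" using vw1_notin by (auto simp: E1_def)
  moreover have "E \<inter> P \<times> P \<union> E \<inter> Q \<times> Q \<union> {(w1, w2), (w2, w1)} = E"
  proof
    show "E \<subseteq> E \<inter> P \<times> P \<union> E \<inter> Q \<times> Q \<union> {(w1, w2), (w2, w1)}"
    proof (rule subrelI)
      fix x y assume xy: "(x, y) \<in> E"
      then have "(y, x) \<in> E" "x \<in> P \<or> x \<in> Q" "y \<in> P \<or> y \<in> Q" using g(2,3) PQ(1) by (auto dest: symD)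
      then show "(x, y) \<in> E \<inter> P \<times> P \<union> E \<inter> Q \<times> Q \<union> {(w1, w2), (w2, w1)}"
        using xy crossing[of x y] crossing[of y x] sub(3,4) by auto
    qed
  next
    have "(w2, w1) \<in> E" using w1w2 g(3) by (auto dest: symD)
    then show "E \<inter> P \<times> P \<union> E \<inter> Q \<times> Q \<union> {(w1, w2), (w2, w1)} \<subseteq> E" using w1w2 by auto
  qed
  ultimately show "hajos_join \<lparr>pverts = P, parcs = E1\<rparr> v w1
      \<lparr>pverts = \<rho> ` Q, parcs = map_prod \<rho> \<rho> ` R.E1\<rparr> n w2 = \<lparr>pverts = V, parcs = E\<rparr>"
    using PQ(1) unfolding hajos_join_def Let_def f_def[symmetric] by simp
qed

end

text \<open>The starting class \<open>B\<close> is kept abstract, so that one induction serves both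
  wheels and complete graphs.\<close>

theorem critical_hajos_closure:
  fixes V :: "nat set"
  assumes "critical k V E" "3 \<le> k" "cut_bounded k V E"
    and wheel: "\<And>n. k = 3 \<Longrightarrow> 3 \<le> n \<Longrightarrow> odd n \<Longrightarrow> B (wheel_graph n)"
    and complete: "\<And>H. 4 \<le> k \<Longrightarrow> complete_digraph (k + 1) (with_proj H) \<Longrightarrow> B H"
  shows "hajos_closure B \<lparr>pverts = V, parcs = E\<rparr>"
  using assms(1,3)
proof (induction "card V" arbitrary: V E rule: less_induct)
  case less
  note g = critical_graph[OF less.prems(1)]
  show ?case
  proof (cases "reducible V E")
    case True
    then obtain v P Q w1 w2 where r: "P \<union> Q = V" "P \<inter> Q = {v}" "w1 \<in> P - {v}" "w2 \<in> Q - {v}"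
      "E \<inter> (P - {v}) \<times> (Q - {v}) = {(w1, w2)}" by (rule reducibleE)
    interpret L: one_edge_split k V E P Q v w1 w2
      using less.prems(1) assms(2) r by unfold_locales
    interpret R: one_edge_split k V E Q P v w2 w1 by (rule L.swapped)
    have "card P < card V" "card Q < card V" using L.sub g(1) by (auto intro: psubset_card_mono)
    then have cl: "hajos_closure B \<lparr>pverts = P, parcs = L.E1\<rparr>" "hajos_closure B \<lparr>pverts = Q, parcs = R.E1\<rparr>"
      using less.hyps L.critical_left R.critical_left L.cut_bounded_left[OF less.prems(2)]
        R.cut_bounded_left[OF less.prems(2)] by blast+
    obtain n where n: "n \<notin> V" using g(1) ex_new_if_finite infinite_UNIV_nat by blast
    define \<rho> where "\<rho> = id(v := n)"
    note J = L.hajos_join_split[OF n, folded \<rho>_def]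
    have "digraph_iso (with_proj \<lparr>pverts = Q, parcs = R.E1\<rparr>)
      (with_proj \<lparr>pverts = \<rho> ` Q, parcs = map_prod \<rho> \<rho> ` R.E1\<rparr>)"
      by (rule digraph_iso_pairI[OF ugraphD(2)[OF R.ugraph_E1] J(2)])
    then have cl': "hajos_closure B \<lparr>pverts = \<rho> ` Q, parcs = map_prod \<rho> \<rho> ` R.E1\<rparr>"
      by (rule hajos_closure.iso[OF cl(2)])
    have "(v, w1) \<in> L.E1" by (simp add: L.E1_def)
    then have "hajos_closure B (hajos_join \<lparr>pverts = P, parcs = L.E1\<rparr> v w1
      \<lparr>pverts = \<rho> ` Q, parcs = map_prod \<rho> \<rho> ` R.E1\<rparr> n w2)"
      using J(3,4) by (intro hajos_closure.join[OF cl(1) cl']) auto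
    then show ?thesis by (simp only: J(1))
  next
    case False
    then obtain v where v: "v \<in> V" "\<And>u. u \<in> V - {v} \<Longrightarrow> (v, u) \<in> E"
      "\<And>u. u \<in> V - {v} \<Longrightarrow> card (E `` {u}) \<le> k"
      using irreducible_hub[OF less.prems(1) assms(2) less.prems(2)] by metis
    show ?thesis
    proof (cases "k = 3")
      case True
      then obtain n where "3 \<le> n" "odd n"
        "digraph_iso (with_proj (wheel_graph n)) (with_proj \<lparr>pverts = V, parcs = E\<rparr>)"
        using hub_odd_wheel[of V E v] less.prems(1) v(1,2) by blast
      then show ?thesis using wheel[OF True] hajos_closure.base hajos_closure.iso by metis
    next
      case False
      then have k: "4 \<le> k" using assms(2) by simp
      have "E = V \<times> V - Id" "card V = k + 1" using hub_critical_complete[OF less.prems(1) k v] by auto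
      then have "complete_digraph (k + 1) (with_proj \<lparr>pverts = V, parcs = E\<rparr>)"
        unfolding complete_digraph_pair_def using g(1) by auto
      then show ?thesis by (intro hajos_closure.base complete[OF k])
    qed
  qed
qed

lemma one_critical:
  assumes "critical 1 V E"
  obtains a b where "a \<noteq> b" "V = {a, b}" "E = {(a, b), (b, a)}"
proof -
  note g = critical_graph[OF assms]
  obtain a b where ab: "(a, b) \<in> E"
    using critical_pos(1)[OF assms] criticalD(2)[OF assms] by blast
  then obtain c where c: "coloring 1 (E - {(a, b), (b, a)}) V c"
    using criticalD(4)[OF assms] by blast
  have "e \<in> {(a, b), (b, a)}" if "e \<in> E" for e
  proof (rule ccontr)
    assume "e \<notin> {(a, b), (b, a)}"
    then have "(fst e, snd e) \<in> E - {(a, b), (b, a)}" using that by simp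
    moreover have ends: "fst e \<in> V" "snd e \<in> V"
      using subsetD[OF g(2) that] by (simp_all add: mem_Times_iff)
    ultimately have "c (fst e) \<noteq> c (snd e)" by (intro coloringD(2)[OF c])
    then show False using coloringD(1)[OF c ends(1)] coloringD(1)[OF c ends(2)] by simp
  qed
  moreover have "(b, a) \<in> E" using ab g(3) by (meson symD)
  ultimately have E: "E = {(a, b), (b, a)}" using ab by blast
  have "x \<in> {a, b}" if "x \<in> V" for x using criticalD(2)[OF assms that] unfolding E by auto
  moreover have "a \<in> V" "b \<in> V" using ab g(2) by auto
  ultimately have "V = {a, b}" by blast
  moreover have "a \<noteq> b" using ab g(4) by (auto simp: irrefl_def)
  ultimately show thesis using that E by blast
qed

theorem critical_hajos_class:
  fixes V :: "'a set"
  assumes "critical k V E" "cut_bounded k V E"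
  shows "hajos_class k \<lparr>pverts = V, parcs = E\<rparr>"
proof -
  note g = critical_graph[OF assms(1)]
  obtain \<phi> :: "'a \<Rightarrow> nat" where \<phi>: "inj_on \<phi> V" using finite_imp_inj_to_nat_seg[OF g(1)] by blast
  let ?H = "\<lparr>pverts = \<phi> ` V, parcs = map_prod \<phi> \<phi> ` E\<rparr>"
  have crit: "critical k (\<phi> ` V) (map_prod \<phi> \<phi> ` E)" by (rule critical_image[OF assms(1) \<phi>])
  have cb: "cut_bounded k (\<phi> ` V) (map_prod \<phi> \<phi> ` E)" by (rule cut_bounded_image[OF assms(2) \<phi> g(2,5)])
  have iso: "digraph_iso (with_proj ?H) (with_proj \<lparr>pverts = V, parcs = E\<rparr>)"
  proof -
    let ?i = "inv_into V \<phi>"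
    have "?i ` \<phi> ` V = V" using \<phi> by (simp add: inv_into_image_cancel)
    moreover have "map_prod ?i ?i ` map_prod \<phi> \<phi> ` E = E"
    proof -
      have "map_prod ?i ?i (map_prod \<phi> \<phi> e) = e" if "e \<in> E" for e
        using that g(2) \<phi> by (auto simp: inv_into_f_f)
      then show ?thesis by (simp add: image_image)
    qed
    moreover have "map_prod \<phi> \<phi> ` E \<subseteq> \<phi> ` V \<times> \<phi> ` V" using g(2) by auto
    ultimately show ?thesis using digraph_iso_pairI[of "map_prod \<phi> \<phi> ` E" "\<phi> ` V" ?i]
      by (simp add: inj_on_inv_into)
  qed
  consider "k = 1" | "k = 2" | "k = 3" | "4 \<le> k" using critical_pos(2)[OF assms(1)] by linarith
  then have "hajos_class_nat k ?H"
  proof cases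
    case 1
    then obtain a b where "a \<noteq> b" and VE: "\<phi> ` V = {a, b}" "map_prod \<phi> \<phi> ` E = {(a, b), (b, a)}"
      using one_critical crit by metis
    have "complete_digraph 2 (with_proj ?H)"
      unfolding complete_digraph_pair_def VE using \<open>a \<noteq> b\<close> by (auto simp: VE)
    then show ?thesis using 1 by (simp add: hajos_class_nat_def numeral_2_eq_2)
  next
    case 2
    then obtain n \<psi> where n: "3 \<le> n" "odd n" "inj_on \<psi> {..<n}" "\<phi> ` V = \<psi> ` {..<n}"
      "map_prod \<phi> \<phi> ` E = map_prod \<psi> \<psi> ` parcs (cycle_graph n)"
      using two_critical_odd_cycle[of "\<phi> ` V" "map_prod \<phi> \<phi> ` E"] crit by metis
    have "cycle_graph n = \<lparr>pverts = {..<n}, parcs = parcs (cycle_graph n)\<rparr>"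
      by (simp add: cycle_graph_def)
    moreover have "parcs (cycle_graph n) \<subseteq> {..<n} \<times> {..<n}" by (auto simp: cycle_graph_def)
    ultimately have "digraph_iso (with_proj (cycle_graph n)) (with_proj ?H)"
      using digraph_iso_pairI[OF _ n(3), of "parcs (cycle_graph n)"] n(4,5) by simp
    then show ?thesis using 2 n(1,2) by (auto simp: hajos_class_nat_def)
  next
    case 3
    then have "hajos_closure (\<lambda>H. \<exists>n\<ge>3. odd n \<and> H = wheel_graph n) ?H"
      by (intro critical_hajos_closure[OF crit _ cb]) auto
    then show ?thesis using 3 by (simp add: hajos_class_nat_def)
  next
    case 4
    then have "hajos_closure (\<lambda>H. complete_digraph (k + 1) (with_proj H)) ?H"
      by (intro critical_hajos_closure[OF crit _ cb]) auto
    then show ?thesis using 4 by (simp add: hajos_class_nat_def)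
  qed
  then show ?thesis unfolding hajos_class_def using iso by blast
qed

section \<open>Menger's theorem\<close>


text \<open>Paths in a bare arc relation, because flows are sets of arcs without a vertex
  set.\<close>

definition simple_path :: "'a rel \<Rightarrow> 'a \<Rightarrow> ('a \<times> 'a) list \<Rightarrow> 'a \<Rightarrow> bool" where
  "simple_path R s p t \<longleftrightarrow> set p \<subseteq> R \<and> pcas s p t \<and> distinct (pawalk_verts s p)"

lemma apath_iff_simple_path:
  "pre_digraph.apath (with_proj G) s p t \<longleftrightarrow> s \<in> pverts G \<and> simple_path (parcs G) s p t"
  by (auto simp: pre_digraph.apath_def pre_digraph.awalk_def simple_path_def
      cas_with_proj_eq awalk_verts_with_proj_eq)

lemma simple_path_mono: "simple_path R s p t \<Longrightarrow> R \<subseteq> S \<Longrightarrow> simple_path S s p t"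
  by (auto simp: simple_path_def)

lemma rtrancl_simple_path:
  assumes "(s, t) \<in> R\<^sup>*"
  obtains p where "simple_path R s p t" "distinct p"
proof -
  let ?H = "\<lparr>pverts = UNIV, parcs = R\<rparr>"
  interpret H: pair_wf_digraph ?H by unfold_locales auto
  have "s \<rightarrow>\<^sup>*\<^bsub>with_proj ?H\<^esub> t" using assms H.reachable_conv by auto
  then obtain p where p: "H.apath s p t" using H.reachable_apath by blast
  have "distinct p"
    using p H.distinct_verts_imp_distinct[of s p t] by (auto simp: H.apath_def)
  then show thesis using that p apath_iff_simple_path[of ?H] by auto
qed

text \<open>Net outflow of \<open>A\<close>: arcs inside \<open>A\<close> cancel, and the form as a
  sum makes it additive in \<open>F\<close>.\<close>

definition net_flow :: "'a rel \<Rightarrow> 'a set \<Rightarrow> int" where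
  "net_flow F A = (\<Sum>e\<in>F. of_bool (fst e \<in> A) - of_bool (snd e \<in> A))"

text \<open>A unit-capacity flow of value \<open>m\<close>. Conservation at inner vertices is
  encoded by demanding the same net outflow from every set that separates \<open>s\<close> from
  \<open>t\<close>.\<close>

definition is_flow :: "'a rel \<Rightarrow> 'a \<Rightarrow> 'a \<Rightarrow> nat \<Rightarrow> bool" where
  "is_flow F s t m \<longleftrightarrow> (\<forall>A. s \<in> A \<longrightarrow> t \<notin> A \<longrightarrow> net_flow F A = int m)"

lemma net_flow_Un:
  "finite F \<Longrightarrow> finite H \<Longrightarrow> F \<inter> H = {} \<Longrightarrow> net_flow (F \<union> H) A = net_flow F A + net_flow H A"
  unfolding net_flow_def by (rule sum.union_disjoint)

lemma net_flow_path:
  assumes "pcas s p t" "distinct p"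
  shows "net_flow (set p) A = of_bool (s \<in> A) - of_bool (t \<in> A)"
proof -
  have "(\<Sum>e\<leftarrow>p. of_bool (fst e \<in> A) - of_bool (snd e \<in> A) :: int) = of_bool (s \<in> A) - of_bool (t \<in> A)"
    using assms(1) by (induction p arbitrary: s) auto
  then show ?thesis unfolding net_flow_def using assms(2) by (simp add: sum_list_distinct_conv_sum_set)
qed

lemma net_flow_cut:
  assumes "finite F"
  shows "net_flow F A = int (card (edge_cut F A)) - int (card (edge_cut F (- A)))"
proof -
  have "net_flow F A = (\<Sum>e\<in>F. of_bool (e \<in> edge_cut F A) - of_bool (e \<in> edge_cut F (- A)))"
    unfolding net_flow_def by (rule sum.cong) (auto simp: edge_cut_def)
  also have "\<dots> = (\<Sum>e\<in>F. of_bool (e \<in> edge_cut F A)) - (\<Sum>e\<in>F. of_bool (e \<in> edge_cut F (- A)))"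
    by (rule sum_subtractf)
  also have "\<dots> = int (card (edge_cut F A)) - int (card (edge_cut F (- A)))"
  proof -
    have "F \<inter> {e. e \<in> edge_cut F B} = edge_cut F B" for B by (auto simp: edge_cut_def)
    then show ?thesis using assms by (simp add: sum_of_bool_eq)
  qed
  finally show ?thesis .
qed

text \<open>Reversing all arcs changes the sign of the sum but not the set.\<close>

lemma net_flow_sym: "sym F \<Longrightarrow> net_flow F A = 0"
proof -
  assume F: "sym F"
  have "net_flow F A = (\<Sum>e\<in>prod.swap ` F. of_bool (fst e \<in> A) - of_bool (snd e \<in> A))"
    unfolding net_flow_def using F by (intro sum.cong) (force dest: symD)+
  also have "\<dots> = (\<Sum>e\<in>F. of_bool (snd e \<in> A) - of_bool (fst e \<in> A))"
    by (subst sum.reindex) (auto simp: inj_on_def)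
  also have "\<dots> = - net_flow F A"
    unfolding net_flow_def by (simp flip: sum_negf)
  finally show ?thesis by simp
qed

text \<open>
  Adding an augmenting path to a flow and cancelling opposite arcs increases the value by one. Without
  an augmenting path, the vertices reachable in the residual graph form a cut saturated by the flow.
\<close>

lemma flow_exists:
  assumes "finite E" "sym E" "s \<noteq> t"
    and "\<And>A. s \<in> A \<Longrightarrow> t \<notin> A \<Longrightarrow> m \<le> card (edge_cut E A)" and "j \<le> m"
  shows "\<exists>F\<subseteq>E. F \<inter> F\<inverse> = {} \<and> is_flow F s t j"
  using assms(5)
proof (induction j)
  case 0
  then show ?case by (intro exI[of _ "{}"]) (simp add: is_flow_def net_flow_def)
next
  case (Suc j)
  then obtain F where F: "F \<subseteq> E" "F \<inter> F\<inverse> = {}" "is_flow F s t j" by auto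
  have finF: "finite F" using F(1) assms(1) finite_subset by blast
  show ?case
  proof (cases "(s, t) \<in> (E - F)\<^sup>*")
    case True
    then obtain p where p: "simple_path (E - F) s p t" "distinct p" by (rule rtrancl_simple_path)
    define H where "H = F \<union> set p"
    have H: "H \<subseteq> E" "finite H" using F p finF by (auto simp: H_def simple_path_def)
    have "net_flow H A = int (Suc j)" if "s \<in> A" "t \<notin> A" for A
    proof -
      have "net_flow H A = net_flow F A + net_flow (set p) A"
        unfolding H_def using finF p(1) by (intro net_flow_Un) (auto simp: simple_path_def)
      moreover have "net_flow (set p) A = 1"
        using net_flow_path[of s p t A] p that by (simp add: simple_path_def)
      ultimately show ?thesis using F(3) that by (simp add: is_flow_def)
    qed
    moreover have "net_flow (H - H\<inverse>) A = net_flow H A" for A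
    proof -
      have "net_flow (H \<inter> H\<inverse>) A = 0" by (rule net_flow_sym) (auto simp: sym_def)
      moreover have "net_flow ((H - H\<inverse>) \<union> (H \<inter> H\<inverse>)) A = net_flow (H - H\<inverse>) A + net_flow (H \<inter> H\<inverse>) A"
        using H(2) by (intro net_flow_Un) auto
      moreover have "(H - H\<inverse>) \<union> (H \<inter> H\<inverse>) = H" by auto
      ultimately show ?thesis by simp
    qed
    ultimately have "is_flow (H - H\<inverse>) s t (Suc j)" unfolding is_flow_def by simp
    then show ?thesis using H by (intro exI[of _ "H - H\<inverse>"]) auto
  next
    case False
    define A where "A = {x. (s, x) \<in> (E - F)\<^sup>*}"
    have A: "s \<in> A" "t \<notin> A" using False by (auto simp: A_def)
    have sat: "edge_cut E A \<subseteq> F"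
    proof (rule subrelI)
      fix x y assume "(x, y) \<in> edge_cut E A"
      then have "(s, x) \<in> (E - F)\<^sup>*" "(x, y) \<in> E" "(s, y) \<notin> (E - F)\<^sup>*" by (auto simp: edge_cut_def A_def)
      then show "(x, y) \<in> F" by (meson DiffI rtrancl.rtrancl_into_rtrancl)
    qed
    have "edge_cut F (- A) = {}"
    proof -
      have False if "(x, y) \<in> edge_cut F (- A)" for x y
      proof -
        have "(y, x) \<in> edge_cut E A" "(x, y) \<in> F" using that F(1) assms(2) by (auto simp: edge_cut_def dest: symD)
        then show False using sat F(2) by auto
      qed
      then show ?thesis by auto
    qed
    moreover have "edge_cut F A = edge_cut E A" using sat F(1) by (auto simp: edge_cut_def)
    ultimately have "int j = int (card (edge_cut E A))"
      using F(3) A net_flow_cut[OF finF, of A] by (simp add: is_flow_def)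
    then show ?thesis using assms(4)[OF A] Suc.prems by simp
  qed
qed

text \<open>A positive flow reaches \<open>t\<close>, and removing a simple path lowers the net
  outflow of every separating set by one. Circulations may remain at the end.\<close>

lemma flow_decomposition:
  assumes "finite F" "is_flow F s t j" "s \<noteq> t"
  shows "\<exists>P. finite P \<and> card P = j \<and> (\<forall>p\<in>P. simple_path F s p t) \<and>
    (\<forall>p\<in>P. \<forall>q\<in>P. p \<noteq> q \<longrightarrow> set p \<inter> set q = {})"
  using assms(1,2)
proof (induction j arbitrary: F)
  case 0
  then show ?case by (intro exI[of _ "{}"]) simp
next
  case (Suc j)
  have "(s, t) \<in> F\<^sup>*"
  proof (rule ccontr)
    assume "(s, t) \<notin> F\<^sup>*"
    define A where "A = {x. (s, x) \<in> F\<^sup>*}"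
    have "edge_cut F A = {}" by (auto simp: A_def edge_cut_def)
    moreover have "s \<in> A" "t \<notin> A" using \<open>(s, t) \<notin> F\<^sup>*\<close> by (auto simp: A_def)
    ultimately show False
      using Suc.prems net_flow_cut[OF Suc.prems(1), of A] by (auto simp: is_flow_def)
  qed
  then obtain p where p: "simple_path F s p t" "distinct p" by (rule rtrancl_simple_path)
  have pF: "set p \<subseteq> F" "pcas s p t" using p by (auto simp: simple_path_def)
  have "net_flow (F - set p) A = int j" if "s \<in> A" "t \<notin> A" for A
  proof -
    have "net_flow ((F - set p) \<union> set p) A = net_flow (F - set p) A + net_flow (set p) A"
      using Suc.prems by (intro net_flow_Un) auto
    moreover have "(F - set p) \<union> set p = F" using pF by auto
    ultimately show ?thesis using net_flow_path[OF pF(2) p(2), of A] Suc.prems(2) that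
      by (simp add: is_flow_def)
  qed
  then obtain P where P: "finite P" "card P = j" "\<forall>q\<in>P. simple_path (F - set p) s q t"
    "\<forall>p\<in>P. \<forall>q\<in>P. p \<noteq> q \<longrightarrow> set p \<inter> set q = {}"
    using Suc.IH[of "F - set p"] Suc.prems(1) unfolding is_flow_def by blast
  have disj: "set p \<inter> set q = {}" if "q \<in> P" for q
    using P(3) that by (auto simp: simple_path_def)
  \<comment> \<open>A nonempty path is not disjoint from itself, so \<open>p\<close> is a new
    member.\<close>
  have "p \<noteq> []" using pF(2) assms(3) by auto
  then have "p \<notin> P" using disj[of p] by auto
  then have "card (insert p P) = Suc j" using P by simp
  moreover have "simple_path F s q t" if "q \<in> insert p P" for q
    using that p(1) P(3) simple_path_mono[of "F - set p" s q t F] by auto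
  moreover have "set a \<inter> set b = {}" if "a \<in> insert p P" "b \<in> insert p P" "a \<noteq> b" for a b
    using that P(4) disj[of a] disj[of b] by (cases "a = p"; cases "b = p") (simp_all add: Int_commute)
  ultimately show ?case using P(1) by (intro exI[of _ "insert p P"] conjI ballI impI) simp_all
qed

text \<open>The flow never uses both orientations of an edge, so its arc-disjoint paths are disjoint
  as sets of undirected edges.\<close>

theorem menger:
  fixes G :: "'a pair_pre_digraph"
  assumes "ugraph (pverts G) (parcs G)" "s \<in> pverts G" "t \<in> pverts G" "s \<noteq> t"
    and "\<And>A. s \<in> A \<Longrightarrow> t \<notin> A \<Longrightarrow> m \<le> card (edge_cut (parcs G) A)"
  shows "m \<le> local_edge_connectivity G s t"
proof -
  note g = ugraphD[OF assms(1)]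
  obtain F where F: "F \<subseteq> parcs G" "F \<inter> F\<inverse> = {}" "is_flow F s t m"
    using flow_exists[OF g(5,3) assms(4,5), of m] by auto
  have "finite F" using F(1) g(5) finite_subset by blast
  then obtain P where P: "finite P" "card P = m" "\<forall>p\<in>P. simple_path F s p t"
    "\<forall>p\<in>P. \<forall>q\<in>P. p \<noteq> q \<longrightarrow> set p \<inter> set q = {}"
    using flow_decomposition[OF _ F(3) assms(4)] by blast
  interpret pair_fin_digraph G using g by unfold_locales auto
  let ?S = "{card P | P. P \<subseteq> {p. apath s p t} \<and> disjoint_family_on path_edges P}"
  have "?S \<subseteq> card ` Pow {p. apath s p t}" by auto
  then have fin: "finite ?S" using apaths_finite finite_subset by blast
  have "P \<subseteq> {p. apath s p t}"
    using P(3) simple_path_mono[OF _ F(1)] assms(2) by (auto simp: apath_iff_simple_path)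
  moreover have "disjoint_family_on path_edges P"
    unfolding disjoint_family_on_def
  proof (intro ballI impI)
    fix p q assume pq: "p \<in> P" "q \<in> P" "p \<noteq> q"
    have sub: "set p \<subseteq> F" "set q \<subseteq> F" using P(3) pq by (auto simp: simple_path_def)
    have disj: "set p \<inter> set q = {}" using P(4) pq by blast
    show "path_edges p \<inter> path_edges q = {}"
    proof (rule ccontr)
      assume "path_edges p \<inter> path_edges q \<noteq> {}"
      then obtain a b c d where abcd: "(a, b) \<in> set p" "(c, d) \<in> set q" "{a, b} = {c, d}"
        unfolding path_edges_def by fastforce
      then consider "a = c" "b = d" | "a = d" "b = c" by (auto simp: doubleton_eq_iff)
      then show False
      proof cases
        case 1
        then show False using abcd disj by blast
      next
        case 2
        then have "(a, b) \<in> F \<inter> F\<inverse>" using abcd sub by auto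
        then show False using F(2) by blast
      qed
    qed
  qed
  ultimately have "card P \<in> ?S" by blast
  then have "card P \<le> Max ?S" using fin by (rule Max_ge[rotated])
  then show ?thesis using P(2) by (simp add: local_edge_connectivity_def)
qed

theorem cut_bounded_max_local_edge_connectivity:
  assumes "ugraph (pverts G) (parcs G)"
  shows "cut_bounded (max_local_edge_connectivity G) (pverts G) (parcs G)"
  unfolding cut_bounded_def
proof (intro ballI impI)
  fix x y assume xy: "x \<in> pverts G" "y \<in> pverts G" "x \<noteq> y"
  have fin: "finite (pverts G)" using ugraphD[OF assms] by simp
  let ?S = "{local_edge_connectivity G v w | v w. v \<in> pverts G \<and> w \<in> pverts G \<and> v \<noteq> w}"
  have "card (pverts G) \<noteq> 1" using xy by (auto simp: card_1_singleton_iff)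
  then have Max: "max_local_edge_connectivity G = Max ?S" by (simp add: max_local_edge_connectivity_def)
  have "?S \<subseteq> (\<lambda>(v, w). local_edge_connectivity G v w) ` (pverts G \<times> pverts G)" by auto
  then have "finite ?S" by (rule finite_subset) (use fin in simp)
  moreover have "local_edge_connectivity G x y \<in> ?S" using xy by blast
  ultimately have le: "local_edge_connectivity G x y \<le> max_local_edge_connectivity G"
    unfolding Max by (rule Max_ge)
  show "\<exists>A. x \<in> A \<and> y \<notin> A \<and> card (edge_cut (parcs G) A) \<le> max_local_edge_connectivity G"
  proof (rule ccontr)
    assume "\<not> ?thesis"
    then have "Suc (max_local_edge_connectivity G) \<le> card (edge_cut (parcs G) A)" if "x \<in> A" "y \<notin> A" for A
      using that by (meson not_less_eq_eq)
    then have "Suc (max_local_edge_connectivity G) \<le> local_edge_connectivity G x y"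
      by (rule menger[OF assms xy])
    then show False using le by simp
  qed
qed

section \<open>Blocks and the chromatic number\<close>


lemma graph_with_proj_iff: "graph (with_proj \<lparr>pverts = W, parcs = F\<rparr>) \<longleftrightarrow> ugraph W F"
proof
  assume "graph (with_proj \<lparr>pverts = W, parcs = F\<rparr>)"
  then interpret graph "with_proj \<lparr>pverts = W, parcs = F\<rparr>" .
  have "(a, a) \<notin> F" for a using no_loops[of "(a, a)"] by auto
  then show "ugraph W F" unfolding ugraph_def
    using finite_verts sym_arcs tail_in_verts head_in_verts
    by (auto simp: symmetric_def irrefl_def)
next
  assume "ugraph W F"
  note g = ugraphD[OF this]
  show "graph (with_proj \<lparr>pverts = W, parcs = F\<rparr>)"
    by unfold_locales (use g in \<open>auto simp: arc_to_ends_def symmetric_def irrefl_def prod_eq_iff\<close>)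
qed

lemma pair_graph_ugraph:
  assumes "pair_graph G"
  shows "ugraph (pverts G) (parcs G)"
proof -
  interpret pair_graph G by (rule assms)
  have "with_proj \<lparr>pverts = pverts G, parcs = parcs G\<rparr> = with_proj G" by (simp add: with_proj_def)
  then have "graph (with_proj \<lparr>pverts = pverts G, parcs = parcs G\<rparr>)" using graph_axioms by (simp only:)
  then show ?thesis unfolding graph_with_proj_iff .
qed

lemma rtrancl_on_subset_Times: "rtrancl_on W (F \<inter> W \<times> W) = rtrancl_on W F"
proof (intro equalityI subrelI)
  fix x y
  show "(x, y) \<in> rtrancl_on W (F \<inter> W \<times> W) \<Longrightarrow> (x, y) \<in> rtrancl_on W F"
    by (rule rtrancl_on_mono[OF Int_lower1 subset_refl])
  assume "(x, y) \<in> rtrancl_on W F"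
  then show "(x, y) \<in> rtrancl_on W (F \<inter> W \<times> W)"
    by (induction rule: rtrancl_on_induct) (auto intro: rtrancl_on_into_rtrancl_on)
qed

text \<open>Links the cut form of connectedness to the reachability used by the library. The empty
  set counts as connected on both sides.\<close>

lemma connected_on_iff_rtrancl_on:
  "connected_on F W \<longleftrightarrow> (\<forall>x\<in>W. \<forall>y\<in>W. (x, y) \<in> rtrancl_on W F)"
proof
  assume conn: "connected_on F W"
  show "\<forall>x\<in>W. \<forall>y\<in>W. (x, y) \<in> rtrancl_on W F"
  proof (intro ballI, rule ccontr)
    fix x y assume xy: "x \<in> W" "y \<in> W" "(x, y) \<notin> rtrancl_on W F"
    define A where "A = {z. (x, z) \<in> rtrancl_on W F}"
    have A: "A \<subseteq> W" "x \<in> A" "y \<in> W - A" using xy by (auto simp: A_def dest: in_rtrancl_on_in_F)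
    obtain u v where uv: "u \<in> A" "v \<in> W - A" "(u, v) \<in> F" by (rule connected_onD[OF conn A])
    then have "(x, v) \<in> rtrancl_on W F" unfolding A_def by (auto intro: rtrancl_on_into_rtrancl_on)
    then show False using uv by (simp add: A_def)
  qed
next
  assume reach: "\<forall>x\<in>W. \<forall>y\<in>W. (x, y) \<in> rtrancl_on W F"
  show "connected_on F W"
    unfolding connected_on_def
  proof (intro allI impI notI)
    fix A assume A: "A \<subseteq> W" "A \<noteq> {}" "A \<noteq> W" "F \<inter> A \<times> (W - A) = {}"
    obtain x y where xy: "x \<in> A" "y \<in> W - A" using A(1,2,3) by blast
    have "z \<in> A" if "(x, z) \<in> rtrancl_on W F" for z
      using that xy(1) A(4) by (induction rule: rtrancl_on_induct) auto
    then show False using reach xy A(1) by blast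
  qed
qed

lemma connected_with_proj_iff:
  assumes "sym F"
  shows "connected (with_proj \<lparr>pverts = W, parcs = F\<rparr>) \<longleftrightarrow> W \<noteq> {} \<and> connected_on F W"
proof -
  have "mk_symmetric (with_proj \<lparr>pverts = W, parcs = F\<rparr>) = \<lparr>pverts = W, parcs = F\<rparr>"
    using assms by (auto simp: mk_symmetric_def dest: symD)
  then show ?thesis
    by (simp add: connected_def strongly_connected_def reachable_def connected_on_iff_rtrancl_on)
qed

lemma no_separating_vertex_iff:
  assumes "connected_on F W" "F \<subseteq> W \<times> W"
  shows "(\<forall>v. \<not> separating_vertex (with_proj \<lparr>pverts = W, parcs = F\<rparr>) v) \<longleftrightarrow>
    (\<forall>v\<in>W. connected_on F (W - {v}))"
proof -
  let ?G = "with_proj \<lparr>pverts = W, parcs = F\<rparr>"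
  have R: "x \<rightarrow>\<^sup>*\<^bsub>pre_digraph.del_vert ?G v\<^esub> y \<longleftrightarrow> (x, y) \<in> rtrancl_on (W - {v}) F" for x y v
  proof -
    have "arcs_ends (pre_digraph.del_vert ?G v) = F \<inter> (W - {v}) \<times> (W - {v})"
      using assms(2) by (auto simp: arcs_ends_conv pre_digraph.del_vert_def)
    moreover have "verts (pre_digraph.del_vert ?G v) = W - {v}"
      by (simp add: pre_digraph.del_vert_def)
    ultimately show ?thesis unfolding reachable_def by (simp only: rtrancl_on_subset_Times)
  qed
  have V: "verts ?G = W" by simp
  have reach: "x \<rightarrow>\<^sup>*\<^bsub>?G\<^esub> y" if "x \<in> W" "y \<in> W" for x y
    using assms(1) that by (simp add: reachable_def connected_on_iff_rtrancl_on)
  show ?thesis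
    unfolding separating_vertex_def connected_on_iff_rtrancl_on R V using reach by blast
qed

text \<open>Every intermediate subgraph inherits \<open>fst\<close> and \<open>snd\<close> from
  \<open>G\<close>, so it is a pair of sets and maximality can be checked on such pairs.\<close>

lemma is_blockI:
  assumes "ugraph (pverts G) (parcs G)" "ugraph V' E'" "V' \<subseteq> pverts G" "E' \<subseteq> parcs G"
    and "V' \<noteq> {}" "connected_on E' V'" "\<And>v. v \<in> V' \<Longrightarrow> connected_on E' (V' - {v})"
    and max: "\<And>W F. V' \<subseteq> W \<Longrightarrow> W \<subseteq> pverts G \<Longrightarrow> E' \<subseteq> F \<Longrightarrow> F \<subseteq> parcs G \<Longrightarrow> ugraph W F \<Longrightarrow>
      connected_on F W \<Longrightarrow> (\<And>v. v \<in> W \<Longrightarrow> connected_on F (W - {v})) \<Longrightarrow> W = V' \<and> F = E'"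
  shows "is_block G \<lparr>pverts = V', parcs = E'\<rparr>"
proof -
  let ?B = "\<lparr>pverts = V', parcs = E'\<rparr>"
  let ?P = "\<lambda>H. graph H \<and> connected H \<and> (\<forall>v. \<not> separating_vertex H v)"
  have wf: "wf_digraph (with_proj G)" using ugraphD(2)[OF assms(1)] by (auto simp: wf_digraph_def)
  have "subgraph (with_proj ?B) (with_proj G)"
    using assms(3,4) wf ugraphD(2)[OF assms(2)] by (auto simp: subgraph_def compatible_def wf_digraph_def)
  moreover have "?P (with_proj ?B)"
    unfolding graph_with_proj_iff connected_with_proj_iff[OF ugraphD(3)[OF assms(2)]]
      no_separating_vertex_iff[OF assms(6) ugraphD(2)[OF assms(2)]]
    using assms(2,5,6,7) by simp
  moreover have "H' = with_proj ?B"
    if H': "subgraph (with_proj ?B) H'" "subgraph H' (with_proj G)" "?P H'" for H'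
  proof -
    define W F where "W = verts H'" and "F = arcs H'"
    have "tail H' = fst" "head H' = snd" using H'(2) by (auto simp: subgraph_def compatible_def)
    then have eq: "H' = with_proj \<lparr>pverts = W, parcs = F\<rparr>"
      by (simp add: with_proj_def W_def F_def)
    have sub: "V' \<subseteq> W" "W \<subseteq> pverts G" "E' \<subseteq> F" "F \<subseteq> parcs G"
      using H'(1,2) by (auto simp: subgraph_def W_def F_def)
    have u: "ugraph W F" using H'(3) unfolding eq graph_with_proj_iff by blast
    have c: "connected_on F W" using H'(3) unfolding eq connected_with_proj_iff[OF ugraphD(3)[OF u]] by blast
    have "connected_on F (W - {v})" if "v \<in> W" for v
      using H'(3) that unfolding eq no_separating_vertex_iff[OF c ugraphD(2)[OF u]] by blast
    then have "W = V' \<and> F = E'" by (rule max[OF sub u c])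
    then show ?thesis by (simp add: eq)
  qed
  ultimately show ?thesis unfolding is_block_def pre_digraph.max_subgraph_def by blast
qed

text \<open>
  A larger graph without separating vertex would contain an ear of the critical subgraph between two
  vertices \<open>x\<close> and \<open>y\<close>, and every cut between them would have at least \<open>k + 1\<close> edges.
\<close>

lemma critical_subgraph_is_block:
  assumes "ugraph (pverts G) (parcs G)" "cut_bounded k (pverts G) (parcs G)"
    and "critical k V' E'" "V' \<subseteq> pverts G" "E' \<subseteq> parcs G"
  shows "is_block G \<lparr>pverts = V', parcs = E'\<rparr>"
proof (rule is_blockI[OF assms(1) criticalD(1)[OF assms(3)] assms(4,5) critical_pos(1)[OF assms(3)]
      critical_connected_on[OF assms(3)] critical_no_cutvertex[OF assms(3)]])
  fix W F
  assume WF: "V' \<subseteq> W" "W \<subseteq> pverts G" "E' \<subseteq> F" "F \<subseteq> parcs G" "ugraph W F" "connected_on F W"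
    and nosep: "\<And>v. v \<in> W \<Longrightarrow> connected_on F (W - {v})"
  note g = critical_graph[OF assms(3)] note gF = ugraphD[OF WF(5)] note gG = ugraphD[OF assms(1)]
  \<comment> \<open>Every cut between \<open>x\<close> and \<open>y\<close> has at least
    \<open>k\<close> edges of the critical graph and one more outside it, against
    \<open>cut_bounded\<close>.\<close>
  have contradiction: False
    if xy: "x \<in> V'" "y \<in> V'" "x \<noteq> y" and cross: "\<And>A. x \<in> A \<Longrightarrow> y \<notin> A \<Longrightarrow> edge_cut F A - E' \<noteq> {}" for x y
  proof -
    obtain A where A: "x \<in> A" "y \<notin> A" "card (edge_cut (parcs G) A) \<le> k"
      using assms(2,4) xy unfolding cut_bounded_def by (metis subsetD)
    have fin: "finite (edge_cut (parcs G) A)" by (rule finite_edge_cut[OF gG(5)])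
    obtain e where e: "e \<in> edge_cut F A" "e \<notin> E'" using cross A(1,2) by blast
    have "insert e (edge_cut E' A) \<subseteq> edge_cut (parcs G) A" using e WF(3,4) by (auto simp: edge_cut_def)
    then have "card (insert e (edge_cut E' A)) \<le> k" using card_mono[OF fin] A(3) le_trans by blast
    moreover have "e \<notin> edge_cut E' A" using e by (auto simp: edge_cut_def)
    moreover have "finite (edge_cut E' A)" by (rule finite_edge_cut[OF g(5)])
    ultimately have "Suc (card (edge_cut E' A)) \<le> k" by simp
    moreover have "k \<le> card (edge_cut E' A)" by (rule critical_separating_cut_ge[OF assms(3) xy(1,2) A(1,2)])
    ultimately show False by simp
  qed
  show "W = V' \<and> F = E'"
  proof (cases "W = V'")
    case True
    have "F \<subseteq> E'"
    proof (rule subrelI, rule ccontr)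
      fix x y assume xy: "(x, y) \<in> F" "(x, y) \<notin> E'"
      then have "x \<in> V'" "y \<in> V'" "x \<noteq> y" using gF(2,4) True by (auto simp: irrefl_def)
      moreover have "edge_cut F A - E' \<noteq> {}" if "x \<in> A" "y \<notin> A" for A
        using xy that by (auto simp: edge_cut_def)
      ultimately show False by (rule contradiction)
    qed
    then show ?thesis using True WF(3) by blast
  next
    case False
    then obtain w0 where w0: "w0 \<in> W - V'" using WF(1) by blast
    obtain z where z: "z \<in> V'" using critical_pos(1)[OF assms(3)] by blast
    obtain x w where xw: "x \<in> V'" "w \<in> W - V'" "(x, w) \<in> F"
      by (rule connected_onD[OF WF(6,1) z w0])
    obtain x' where "(x, x') \<in> E'" using criticalD(2)[OF assms(3) xw(1)] by blast
    then have x': "x' \<in> V'" "x' \<noteq> x" using g(2,4) by (auto simp: irrefl_def)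
    \<comment> \<open>This is the component of \<open>w\<close> outside \<open>V'\<close>. As
      \<open>x\<close> does not separate, \<open>D\<close> has an edge to a second vertex
      \<open>y\<close> of \<open>V'\<close>, which completes the ear.\<close>
    define D where "D = {d. (w, d) \<in> rtrancl_on (W - V') F}"
    have D: "D \<subseteq> W - V'" "w \<in> D" using xw by (auto simp: D_def dest: in_rtrancl_on_in_F)
    have xW: "x \<in> W" using xw WF(1) by blast
    have D': "D \<subseteq> W - {x}" "x' \<in> W - {x} - D" using D xw x' WF(1) by auto
    obtain d y where dy: "d \<in> D" "y \<in> W - {x} - D" "(d, y) \<in> F"
      by (rule connected_onD[OF nosep[OF xW] D'(1) D(2) D'(2)])
    have "y \<in> V'"
    proof (rule ccontr)
      assume "y \<notin> V'"
      then have "y \<in> D" using dy D unfolding D_def by (auto intro: rtrancl_on_into_rtrancl_on)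
      then show False using dy by blast
    qed
    have "edge_cut F A - E' \<noteq> {}" if A: "x \<in> A" "y \<notin> A" for A
    proof
      assume no: "edge_cut F A - E' = {}"
      \<comment> \<open>The set \<open>A\<close> is closed along edges with an end outside
        \<open>V'\<close>, so it would follow the ear from \<open>x\<close> to
        \<open>y\<close>.\<close>
      have step: "b \<in> A" if "a \<in> A" "(a, b) \<in> F" "a \<notin> V' \<or> b \<notin> V'" for a b
      proof (rule ccontr)
        assume "b \<notin> A"
        then have "(a, b) \<in> edge_cut F A" using that by (auto simp: edge_cut_def)
        then have "(a, b) \<in> E'" using no by blast
        then show False using that(3) g(2) by auto
      qed
      have "w \<in> A" using step A(1) xw by blast
      have "(w, d) \<in> rtrancl_on (W - V') F" using dy(1) by (simp add: D_def)
      then have "d \<in> A" using \<open>w \<in> A\<close> step by (induction rule: rtrancl_on_induct) auto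
      then have "y \<in> A" using step dy(1,3) D(1) by blast
      then show False using A by blast
    qed
    then have False using contradiction[OF xw(1) \<open>y \<in> V'\<close>] dy(2) by blast
    then show ?thesis ..
  qed
qed

text \<open>A minimal symmetric non-colourable subset of \<open>E\<close> is taken on the fixed
  vertex set \<open>V\<close>, and isolated vertices are dropped afterwards. Colouring them again
  takes one colour, hence \<open>1 \<le> k\<close>.\<close>

lemma critical_subgraph_exists:
  assumes "ugraph V E" "1 \<le> k" "\<nexists>c. coloring k E V c"
  obtains V' E' where "V' \<subseteq> V" "E' \<subseteq> E" "critical k V' E'"
proof -
  note g = ugraphD[OF assms(1)]
  define S where "S = {F. F \<subseteq> E \<and> sym F \<and> (\<nexists>c. coloring k F V c)}"
  have "S \<subseteq> Pow E" by (auto simp: S_def)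
  then have "finite S" by (rule finite_subset) (use g(5) in simp)
  moreover have "E \<in> S" using assms(3) g(3) by (simp add: S_def)
  ultimately obtain F where F: "F \<in> S" "\<And>F'. F' \<in> S \<Longrightarrow> F' \<subseteq> F \<Longrightarrow> F = F'"
    using finite_has_minimal2[of S E] by blast
  have FE: "F \<subseteq> E" "sym F" "\<nexists>c. coloring k F V c" using F(1) by (auto simp: S_def)
  let ?V = "Domain F"
  have FV: "F \<subseteq> ?V \<times> ?V" using FE(2) by (auto dest: symD)
  have VV: "?V \<subseteq> V" using FE(1) g(2) by auto
  have "ugraph ?V F"
    using FE FV g VV finite_subset by (auto simp: ugraph_def irrefl_def)
  moreover have "\<not> coloring k F ?V c" for c
  proof
    assume c: "coloring k F ?V c"
    have "coloring k F V (\<lambda>x. if x \<in> ?V then c x else 0)"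
      using c FV assms(2) unfolding coloring_def by auto
    then show False using FE(3) by blast
  qed
  moreover have "\<exists>c. coloring k (F - {(x, y), (y, x)}) ?V c" if xy: "(x, y) \<in> F" for x y
  proof -
    have "F - {(x, y), (y, x)} \<notin> S" using F(2)[of "F - {(x, y), (y, x)}"] xy by blast
    moreover have "sym (F - {(x, y), (y, x)})" using FE(2) by (auto simp: sym_def)
    ultimately obtain c where "coloring k (F - {(x, y), (y, x)}) V c" using FE(1) by (auto simp: S_def)
    then have "coloring k (F - {(x, y), (y, x)}) ?V c" by (rule coloring_mono[OF _ VV]) auto
    then show ?thesis by blast
  qed
  ultimately have "critical k ?V F" unfolding critical_def by blast
  then show thesis using that VV FE(1) by blast
qed

lemma cut_bounded_subgraph:
  assumes "cut_bounded k V E" "V' \<subseteq> V" "E' \<subseteq> E" "finite E"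
  shows "cut_bounded k V' E'"
  unfolding cut_bounded_def
proof (intro ballI impI)
  fix x y assume "x \<in> V'" "y \<in> V'" "x \<noteq> y"
  then obtain A where A: "x \<in> A" "y \<notin> A" "card (edge_cut E A) \<le> k"
    using assms(1,2) unfolding cut_bounded_def by (metis subsetD)
  have "edge_cut E' A \<subseteq> edge_cut E A" using assms(3) by (auto simp: edge_cut_def)
  then have "card (edge_cut E' A) \<le> k" using card_mono[OF finite_edge_cut[OF assms(4)]] A(3) le_trans by blast
  then show "\<exists>A. x \<in> A \<and> y \<notin> A \<and> card (edge_cut E' A) \<le> k" using A by blast
qed

lemma cut_bounded_colorable:
  assumes "ugraph V E" "cut_bounded k V E"
  shows "\<exists>c. coloring (k + 1) E V c"
proof (rule ccontr)
  assume "\<not> ?thesis"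
  then obtain V' E' where crit: "V' \<subseteq> V" "E' \<subseteq> E" "critical (k + 1) V' E'"
    using critical_subgraph_exists[OF assms(1), of "k + 1"] by auto
  note g = critical_graph[OF crit(3)]
  obtain x where x: "x \<in> V'" using critical_pos(1)[OF crit(3)] by blast
  then obtain y where "(x, y) \<in> E'" using criticalD(2)[OF crit(3)] by blast
  then have y: "y \<in> V'" "x \<noteq> y" using g(2,4) by (auto simp: irrefl_def)
  have "cut_bounded k V' E'"
    by (rule cut_bounded_subgraph[OF assms(2) crit(1,2) ugraphD(5)[OF assms(1)]])
  then obtain A where "x \<in> A" "y \<notin> A" "card (edge_cut E' A) \<le> k"
    using x y unfolding cut_bounded_def by metis
  then show False using critical_separating_cut_ge[OF crit(3) x y(1)] by fastforce
qed

text \<open>For \<open>k = 0\<close> there are no critical graphs, so this case is separate: empty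
  cuts between all vertices leave no edges, and every vertex is a block.\<close>

lemma edgeless_block:
  assumes "ugraph (pverts G) (parcs G)" "cut_bounded 0 (pverts G) (parcs G)" "v \<in> pverts G"
  shows "is_block G \<lparr>pverts = {v}, parcs = {}\<rparr>"
proof (rule is_blockI[OF assms(1)])
  have E: "parcs G = {}"
  proof (rule ccontr)
    note g = ugraphD[OF assms(1)]
    assume "parcs G \<noteq> {}"
    then obtain x y where xy: "(x, y) \<in> parcs G" by auto
    then have "x \<in> pverts G" "y \<in> pverts G" "x \<noteq> y" using g(2,4) by (auto simp: irrefl_def)
    then obtain A where "x \<in> A" "y \<notin> A" "card (edge_cut (parcs G) A) = 0"
      using assms(2) unfolding cut_bounded_def by (metis le_zero_eq)
    moreover from this have "(x, y) \<in> edge_cut (parcs G) A" using xy by (auto simp: edge_cut_def)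
    ultimately show False using finite_edge_cut[OF g(5)] by auto
  qed
  show "ugraph {v} {}" by (simp add: ugraph_def irrefl_def sym_def)
  show "connected_on {} {v}" "connected_on {} ({v} - {u})" for u
    by (auto simp: connected_on_def)
  fix W and F :: "'a rel"
  assume W: "{v} \<subseteq> W" "F \<subseteq> parcs G" "connected_on F W"
  then have "W = {v}" using E unfolding connected_on_def by blast
  then show "W = {v} \<and> F = {}" using W E by blast
qed (use assms in auto)

lemma singleton_hajos_class: "hajos_class 0 \<lparr>pverts = {v}, parcs = {}\<rparr>"
proof -
  have "complete_digraph 1 (with_proj \<lparr>pverts = {0 :: nat}, parcs = {}\<rparr>)"
    unfolding complete_digraph_pair_def by auto
  then have "hajos_class_nat 0 \<lparr>pverts = {0}, parcs = {}\<rparr>" by (simp add: hajos_class_nat_def)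
  moreover have "digraph_iso (with_proj \<lparr>pverts = {0 :: nat}, parcs = {}\<rparr>) (with_proj \<lparr>pverts = {v}, parcs = {}\<rparr>)"
    using digraph_iso_pairI[of "{}" "{0 :: nat}" "\<lambda>_. v"] by simp
  ultimately show ?thesis unfolding hajos_class_def by blast
qed

lemma proper_coloring_iff:
  assumes "ugraph (pverts G) (parcs G)"
  shows "proper_coloring G k c \<longleftrightarrow> coloring k (parcs G) (pverts G) c"
  using ugraphD(2)[OF assms] unfolding proper_coloring_def coloring_def by blast

lemma chromatic_number_le_iff:
  assumes "ugraph (pverts G) (parcs G)" "\<exists>c. coloring m (parcs G) (pverts G) c"
  shows "chromatic_number G \<le> k \<longleftrightarrow> (\<exists>c. coloring k (parcs G) (pverts G) c)"
proof
  have ex: "\<exists>c. proper_coloring G m c" using assms proper_coloring_iff by blast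
  assume le: "chromatic_number G \<le> k"
  obtain c where "proper_coloring G (chromatic_number G) c"
    unfolding chromatic_number_def using LeastI[of "\<lambda>k. \<exists>c. proper_coloring G k c", OF ex] by blast
  then have "coloring k (parcs G) (pverts G) c"
    using le unfolding proper_coloring_iff[OF assms(1)] coloring_def by (meson less_le_trans)
  then show "\<exists>c. coloring k (parcs G) (pverts G) c" by blast
next
  assume "\<exists>c. coloring k (parcs G) (pverts G) c"
  then have "\<exists>c. proper_coloring G k c" using proper_coloring_iff[OF assms(1)] by blast
  then show "chromatic_number G \<le> k" unfolding chromatic_number_def by (rule Least_le)
qed

theorem theorem2:
  fixes G :: "'a pair_pre_digraph"
  assumes "pair_graph G" and "pverts G \<noteq> {}"
  shows "chromatic_number G \<le> max_local_edge_connectivity G + 1 \<and>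
    (chromatic_number G = max_local_edge_connectivity G + 1 \<longleftrightarrow>
      (\<exists>B. is_block G B \<and> hajos_class (max_local_edge_connectivity G) B))"
proof -
  define k where "k = max_local_edge_connectivity G"
  have u: "ugraph (pverts G) (parcs G)" by (rule pair_graph_ugraph[OF assms(1)])
  note g = ugraphD[OF u]
  have cb: "cut_bounded k (pverts G) (parcs G)"
    unfolding k_def by (rule cut_bounded_max_local_edge_connectivity[OF u])
  have col: "\<exists>c. coloring (k + 1) (parcs G) (pverts G) c" by (rule cut_bounded_colorable[OF u cb])
  note chrom = chromatic_number_le_iff[OF u col]
  have upper: "chromatic_number G \<le> k + 1" using chrom col by blast
  then have "chromatic_number G = k + 1 \<longleftrightarrow> \<not> chromatic_number G \<le> k" by linarith
  then have eq_iff: "chromatic_number G = k + 1 \<longleftrightarrow> (\<nexists>c. coloring k (parcs G) (pverts G) c)"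
    by (simp only: chrom)
  have "(\<nexists>c. coloring k (parcs G) (pverts G) c) \<longleftrightarrow> (\<exists>B. is_block G B \<and> hajos_class k B)"
  proof
    assume nc: "\<nexists>c. coloring k (parcs G) (pverts G) c"
    show "\<exists>B. is_block G B \<and> hajos_class k B"
    proof (cases "k = 0")
      case True
      obtain v where v: "v \<in> pverts G" using assms(2) by blast
      then show ?thesis using edgeless_block[OF u _ v] cb True singleton_hajos_class by metis
    next
      case False
      then obtain V' E' where crit: "V' \<subseteq> pverts G" "E' \<subseteq> parcs G" "critical k V' E'"
        using critical_subgraph_exists[OF u _ nc] by auto
      have "is_block G \<lparr>pverts = V', parcs = E'\<rparr>"
        by (rule critical_subgraph_is_block[OF u cb crit(3,1,2)])
      moreover have "hajos_class k \<lparr>pverts = V', parcs = E'\<rparr>"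
        by (rule critical_hajos_class[OF crit(3) cut_bounded_subgraph[OF cb crit(1,2) g(5)]])
      ultimately show ?thesis by blast
    qed
  next
    assume "\<exists>B. is_block G B \<and> hajos_class k B"
    then obtain B where B: "is_block G B" "hajos_class k B" by blast
    have sub: "pverts B \<subseteq> pverts G" "parcs B \<subseteq> parcs G"
      using B(1) by (auto simp: is_block_def pre_digraph.max_subgraph_def subgraph_def)
    have "coloring k (parcs B) (pverts B) c" if "coloring k (parcs G) (pverts G) c" for c
      by (rule coloring_mono[OF that sub(1)]) (use sub(2) in auto)
    then show "\<nexists>c. coloring k (parcs G) (pverts G) c"
      using hajos_class_not_colorable[OF B(2)] by blast
  qed
  then show ?thesis using upper eq_iff unfolding k_def by blast
qed

end
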